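(* Let $\Omega$ be a non-empty set and let $K:\Omega\times\Omega\to\mathbb{C}$ be a non-vanishing kernel on $\Omega$ that is normalized at a point $\mathsf{w}\in\Omega$. Suppose that $$1-\frac{1}{K(x,y)}=g(x)g(y)^*-f(x)f(y)^*\qquad (x,y\in\Omega)$$ for some function $f:\Omega\to\mathcal{B}(\mathcal{E},\mathbb{C})$ and some non-zero function $g:\Omega\to\mathcal{B}(\mathcal{F},\mathbb{C})$, where $\mathcal{E}$ and $\mathcal{F}$ are Hilbert spaces. Let $\varphi:\Omega\to\mathbb{D}$ be a non-constant function in $\mathcal{M}_1(\mathcal{H}(K))$ with $\varphi(\mathsf{w})=0$. Then the de Branges-Rovnyak space $\mathcal{H}(K^\varphi)$ is a CNP space if and only if there exists $\Psi\in H^\infty_1(\mathbb{D},\mathcal{B}(\mathcal{E}\oplus\mathbb{C},\mathcal{F}))$ such that $$f(x)=g(x)\,\psi_1(\varphi(x))\quad\text{and}\quad \varphi(x)=g(x)\,\psi_2(\varphi(x))\qquad (x\in\Omega),$$ where for all $z\in\mathbb{D}$, $\Psi(z)=\begin{bmatrix}\psi_1(z)&\psi_2(z)\end{bmatrix}$ with $\psi_1(z)\in\mathcal{B}(\mathcal{E},\mathcal{F})$ and $\psi_2(z)\in\mathcal{B}(\mathbb{C},\mathcal{F})$.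
   Context: All Hilbert spaces are complex. $\mathbb{D}$ is the open unit disc in $\mathbb{C}$. $\mathcal{B}(\mathcal{F},\mathcal{G})$ denotes the bounded linear operators from $\mathcal{F}$ to $\mathcal{G}$; $\mathcal{B}(\mathbb{C})$ is identified with $\mathbb{C}$, so e.g. $g(x)g(y)^*\in\mathbb{C}$ for $g(x),g(y)\in\mathcal{B}(\mathcal{F},\mathbb{C})$. A kernel on $\Omega$ is a function $K:\Omega\times\Omega\to\mathbb{C}$ such that for every finite set $\{x_1,\dots,x_n\}\subset\Omega$ the matrix $[K(x_i,x_j)]_{i,j=1}^n$ is positive semi-definite; $\mathcal{H}(K)$ is the associated reproducing kernel Hilbert space of functions on $\Omega$. $K$ is non-vanishing if $K(x,y)\ne0$ for all $x,y$, and normalized at $\mathsf{w}$ if $K(x,\mathsf{w})=1$ for all $x\in\Omega$. A multiplier of $\mathcal{H}(K)$ is a function $\varphi:\Omega\to\mathbb{C}$ with $\varphi f\in\mathcal{H}(K)$ for all $f\in\mathcal{H}(K)$; it is contractive if the multiplication operator $M_\varphi f=\varphi f$ satisfies $\|M_\varphi\|\le1$, equivalently if $(1-\varphi(x)\overline{\varphi(y)})K(x,y)$ is a kernel. $\mathcal{M}_1(\mathcal{H}(K))$ is the set of contractive multipliers. For $\varphi\in\mathcal{M}_1(\mathcal{H}(K))$, $K^\varphi(x,y)=(1-\varphi(x)\overline{\varphi(y)})K(x,y)$, and $\mathcal{H}(K^\varphi)$ is the de Branges-Rovnyak space associated to $\varphi$. A kernel $K$ on $\Omega$ is a complete Nevanlinna-Pick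 (CNP) kernel, and $\mathcal{H}(K)$ a CNP space, if for all $m,n\in\mathbb{N}$, every finite set of distinct points $x_1,\dots,x_k\in\Omega$ and all complex $m\times n$ matrices $W_1,\dots,W_k$ for which the block matrix $[(I-W_iW_j^* )K(x_i,x_j)]_{i,j=1}^k$ is positive semi-definite, there is a function $\Phi$ from $\Omega$ to the $m\times n$ matrices, multiplying $\mathcal{H}(K)\otimes\mathbb{C}^n$ into $\mathcal{H}(K)\otimes\mathbb{C}^m$, with $\Phi(x_i)=W_i$ for all $i$ and $\|M_\Phi\|\le1$. $H^\infty_1(\mathbb{D},\mathcal{B}(\mathcal{F},\mathcal{G}))$ is the set of holomorphic functions $\Psi:\mathbb{D}\to\mathcal{B}(\mathcal{F},\mathcal{G})$ with $\sup_{z\in\mathbb{D}}\|\Psi(z)\|\le1$. *)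

theory Defs
  imports "HOL-Analysis.Analysis"
begin

class scaleC = fixes scaleC :: "complex \<Rightarrow> 'a \<Rightarrow> 'a" (infixr "*\<^sub>C" 75)

class complex_normed_vector = real_normed_vector + scaleC +
  assumes scaleC_add_right: "a *\<^sub>C (x + y) = a *\<^sub>C x + a *\<^sub>C y"
    and scaleC_add_left: "(a + b) *\<^sub>C x = a *\<^sub>C x + b *\<^sub>C x"
    and scaleC_scaleC: "a *\<^sub>C b *\<^sub>C x = (a * b) *\<^sub>C x"
    and scaleC_of_real: "complex_of_real r *\<^sub>C x = r *\<^sub>R x"
    and norm_scaleC: "norm (a *\<^sub>C x) = cmod a * norm x"

text \<open>
  The inner product of a complex Hilbert space is linear in its first argument. The underlying real
  Hilbert space carries the real part of it as its inner product; by
  \<open>norm_eq_sqrt_inner\<close>, the norm is therefore the one of the complex inner product.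
\<close>

class chilbert_space = complex_normed_vector + real_inner + complete_space +
  fixes cinner :: "'a \<Rightarrow> 'a \<Rightarrow> complex"
  assumes cinner_add_left: "cinner (x + y) z = cinner x z + cinner y z"
    and cinner_scaleC_left: "cinner (a *\<^sub>C x) y = a * cinner x y"
    and cinner_commute: "cinner x y = cnj (cinner y x)"
    and Re_cinner: "Re (cinner x y) = inner x y"

instantiation complex :: chilbert_space
begin

definition scaleC_complex_def: "a *\<^sub>C (x :: complex) = a * x"
definition cinner_complex_def: "cinner (x :: complex) y = x * cnj y"

instance
  by standard
    (auto simp: scaleC_complex_def cinner_complex_def algebra_simps norm_mult scaleR_conv_of_real
      inner_complex_def)

end

text \<open>The Hilbert space direct sum: the library norm on pairs is the Euclidean one.\<close>

instantiation prod :: (complex_normed_vector, complex_normed_vector) complex_normed_vector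
begin

definition scaleC_prod_def: "a *\<^sub>C (x :: 'a \<times> 'b) = (a *\<^sub>C fst x, a *\<^sub>C snd x)"

instance
proof
  fix a b :: complex and r :: real and x y :: "'a \<times> 'b"
  show "norm (a *\<^sub>C x) = cmod a * norm x"
    by (simp add: scaleC_prod_def norm_prod_def norm_scaleC power_mult_distrib
        flip: distrib_left) (simp add: real_sqrt_mult)
qed (auto simp: scaleC_prod_def prod_eq_iff scaleC_add_right scaleC_add_left scaleC_scaleC
      scaleC_of_real)

end

instantiation prod :: (chilbert_space, chilbert_space) chilbert_space
begin

definition cinner_prod_def:
  "cinner (x :: 'a \<times> 'b) y = cinner (fst x) (fst y) + cinner (snd x) (snd y)"

instance
proof
  fix x y :: "'a \<times> 'b"
  show "cinner x y = cnj (cinner y x)"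
    unfolding cinner_prod_def complex_cnj_add
    by (metis cinner_commute)
qed (auto simp: cinner_prod_def scaleC_prod_def cinner_add_left cinner_scaleC_left Re_cinner
      inner_prod_def algebra_simps)

end

lemma bounded_linear_scaleC: "bounded_linear (\<lambda>x :: 'a :: complex_normed_vector. a *\<^sub>C x)"
proof (rule bounded_linear_intro[where K = "cmod a"])
  fix x y :: 'a and r :: real
  show "a *\<^sub>C (x + y) = a *\<^sub>C x + a *\<^sub>C y"
    by (rule scaleC_add_right)
  show "a *\<^sub>C r *\<^sub>R x = r *\<^sub>R a *\<^sub>C x"
    by (simp add: scaleC_scaleC mult.commute flip: scaleC_of_real)
  show "norm (a *\<^sub>C x) \<le> norm x * cmod a"
    by (simp add: norm_scaleC mult.commute)
qed

lemma scaleC_one: "1 *\<^sub>C (x :: 'a :: complex_normed_vector) = x"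
  using scaleC_of_real[of 1 x] by simp

instantiation blinfun :: (real_normed_vector, complex_normed_vector) complex_normed_vector
begin

definition scaleC_blinfun_def: "a *\<^sub>C (T :: 'a \<Rightarrow>\<^sub>L 'b) = Blinfun (\<lambda>x. a *\<^sub>C T x)"

lemma blinfun_apply_scaleC [simp]: "blinfun_apply (a *\<^sub>C T) x = a *\<^sub>C blinfun_apply T x"
  for T :: "'a \<Rightarrow>\<^sub>L 'b"
proof -
  have "bounded_linear (\<lambda>x. a *\<^sub>C T x)"
    using bounded_linear_compose[OF bounded_linear_scaleC blinfun.bounded_linear_right] .
  then show ?thesis
    by (simp add: scaleC_blinfun_def bounded_linear_Blinfun_apply)
qed

instance
proof
  fix a b :: complex and r :: real and S T :: "'a \<Rightarrow>\<^sub>L 'b"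
  show "a *\<^sub>C (S + T) = a *\<^sub>C S + a *\<^sub>C T"
    by (rule blinfun_eqI) (simp add: blinfun.add_left scaleC_add_right)
  show "(a + b) *\<^sub>C T = a *\<^sub>C T + b *\<^sub>C T"
    by (rule blinfun_eqI) (simp add: blinfun.add_left scaleC_add_left)
  show assoc: "a *\<^sub>C b *\<^sub>C T = (a * b) *\<^sub>C T" for a b :: complex and T :: "'a \<Rightarrow>\<^sub>L 'b"
    by (rule blinfun_eqI) (simp add: scaleC_scaleC)
  show of_real: "complex_of_real r *\<^sub>C T = r *\<^sub>R T" for r and T :: "'a \<Rightarrow>\<^sub>L 'b"
    by (rule blinfun_eqI) (simp add: blinfun.scaleR_left scaleC_of_real)
  have le: "norm (a *\<^sub>C T) \<le> cmod a * norm T" for a :: complex and T :: "'a \<Rightarrow>\<^sub>L 'b"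
    by (rule norm_blinfun_bound)
      (simp_all add: norm_scaleC mult.assoc mult_left_mono norm_blinfun)
  show "norm (a *\<^sub>C T) = cmod a * norm T"
  proof (cases "a = 0")
    case True
    then show ?thesis using of_real[of 0 T] by simp
  next
    case False
    have "inverse a *\<^sub>C a *\<^sub>C T = T"
      using False of_real[of 1 T] by (simp add: assoc)
    then have "norm T \<le> cmod (inverse a) * norm (a *\<^sub>C T)"
      using le[of "inverse a" "a *\<^sub>C T"] by simp
    then have "cmod a * norm T \<le> norm (a *\<^sub>C T)"
      using False by (simp add: norm_inverse norm_divide field_simps)
    then show ?thesis using le[of a T] by simp
  qed
qed

end

text \<open>
  The library type of bounded real-linear maps carries the operator norm; the bounded complex-linear
  operators are its elements that commute with complex scalars.
\<close>

definition bounded_ops :: "('a :: complex_normed_vector \<Rightarrow>\<^sub>L 'b :: complex_normed_vector) set"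
  where "bounded_ops = {T. \<forall>a x. blinfun_apply T (a *\<^sub>C x) = a *\<^sub>C blinfun_apply T x}"

definition adjoint_op ::
    "('a :: chilbert_space \<Rightarrow>\<^sub>L 'b :: chilbert_space) \<Rightarrow> ('b \<Rightarrow>\<^sub>L 'a)"
  where "adjoint_op T = (THE S. S \<in> bounded_ops \<and> (\<forall>x y. cinner (T x) y = cinner x (S y)))"

definition scalar_of_op :: "(complex \<Rightarrow>\<^sub>L complex) \<Rightarrow> complex"
  where "scalar_of_op T = T 1"

definition row_op ::
    "('a :: real_normed_vector \<Rightarrow>\<^sub>L 'c :: real_normed_vector) \<Rightarrow> ('b :: real_normed_vector \<Rightarrow>\<^sub>L 'c)
      \<Rightarrow> (('a \<times> 'b) \<Rightarrow>\<^sub>L 'c)"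
  where "row_op S T = (S o\<^sub>L fst_blinfun) + (T o\<^sub>L snd_blinfun)"

text \<open>
  Complex differentiability in norm. The library's \<open>holomorphic_on\<close> is confined to functions with
  complex values.
\<close>

definition vector_holomorphic_on ::
    "(complex \<Rightarrow> 'a :: complex_normed_vector) \<Rightarrow> complex set \<Rightarrow> bool"
  where "vector_holomorphic_on F S \<longleftrightarrow>
    (\<forall>z\<in>S. \<exists>D. (F has_derivative (\<lambda>h. h *\<^sub>C D)) (at z within S))"

definition Hinf_ball ::
    "(complex \<Rightarrow> ('a :: complex_normed_vector \<Rightarrow>\<^sub>L 'b :: complex_normed_vector)) set"
  where "Hinf_ball = {F. (\<forall>z\<in>ball 0 1. F z \<in> bounded_ops) \<and>
    vector_holomorphic_on F (ball 0 1) \<and> (\<forall>z\<in>ball 0 1. norm (F z) \<le> 1)}"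

text \<open>Being a nonnegative real for every vector \<open>c\<close> entails that the matrix is Hermitian.\<close>

definition psd :: "'i set \<Rightarrow> ('i \<Rightarrow> 'i \<Rightarrow> complex) \<Rightarrow> bool"
  where "psd I M \<longleftrightarrow>
    (\<forall>c :: 'i \<Rightarrow> complex. (\<Sum>i\<in>I. \<Sum>j\<in>I. cnj (c i) * M i j * c j) \<in> \<real>\<^sub>\<ge>\<^sub>0)"

definition kernel_on :: "'x set \<Rightarrow> ('x \<Rightarrow> 'x \<Rightarrow> complex) \<Rightarrow> bool"
  where "kernel_on \<Omega> K \<longleftrightarrow> (\<forall>X. finite X \<and> X \<subseteq> \<Omega> \<longrightarrow> psd X K)"

text \<open>
  A function on \<open>\<Omega>\<close> is represented by its extension by zero to the whole type, so that equality and
  the vector space operations are those of functions on \<open>\<Omega>\<close>.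
\<close>

definition kernel_fun :: "'x set \<Rightarrow> ('x \<Rightarrow> 'x \<Rightarrow> complex) \<Rightarrow> 'x \<Rightarrow> 'x \<Rightarrow> complex"
  where "kernel_fun \<Omega> K y = (\<lambda>x. if x \<in> \<Omega> then K x y else 0)"

locale is_rkhs =
  fixes \<Omega> :: "'x set" and K :: "'x \<Rightarrow> 'x \<Rightarrow> complex"
    and H :: "('x \<Rightarrow> complex) set" and ip :: "('x \<Rightarrow> complex) \<Rightarrow> ('x \<Rightarrow> complex) \<Rightarrow> complex"
  assumes supported: "h \<in> H \<Longrightarrow> x \<notin> \<Omega> \<Longrightarrow> h x = 0"
    and zero_mem: "(\<lambda>x. 0) \<in> H"
    and add_mem: "h \<in> H \<Longrightarrow> k \<in> H \<Longrightarrow> (\<lambda>x. h x + k x) \<in> H"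
    and scale_mem: "h \<in> H \<Longrightarrow> (\<lambda>x. a * h x) \<in> H"
    and ip_add: "h \<in> H \<Longrightarrow> k \<in> H \<Longrightarrow> l \<in> H \<Longrightarrow> ip (\<lambda>x. h x + k x) l = ip h l + ip k l"
    and ip_scale: "h \<in> H \<Longrightarrow> l \<in> H \<Longrightarrow> ip (\<lambda>x. a * h x) l = a * ip h l"
    and ip_commute: "h \<in> H \<Longrightarrow> k \<in> H \<Longrightarrow> ip h k = cnj (ip k h)"
    and ip_nonneg: "h \<in> H \<Longrightarrow> ip h h \<in> \<real>\<^sub>\<ge>\<^sub>0"
    and ip_definite: "h \<in> H \<Longrightarrow> ip h h = 0 \<Longrightarrow> h = (\<lambda>x. 0)"
    and complete: "(\<And>n :: nat. s n \<in> H) \<Longrightarrow>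
      (\<And>e. 0 < e \<Longrightarrow> \<exists>N. \<forall>m\<ge>N. \<forall>n\<ge>N.
        sqrt (Re (ip (\<lambda>x. s m x - s n x) (\<lambda>x. s m x - s n x))) < e) \<Longrightarrow>
      \<exists>h\<in>H. (\<lambda>n. sqrt (Re (ip (\<lambda>x. s n x - h x) (\<lambda>x. s n x - h x)))) \<longlonglongrightarrow> 0"
    and kernel_fun_mem: "y \<in> \<Omega> \<Longrightarrow> kernel_fun \<Omega> K y \<in> H"
    and reproducing: "h \<in> H \<Longrightarrow> y \<in> \<Omega> \<Longrightarrow> h y = ip h (kernel_fun \<Omega> K y)"

text \<open>
  For a kernel, the set \<open>H\<close> and the restriction of \<open>ip\<close> to it are determined by \<open>is_rkhs\<close>
  (Moore--Aronszajn); the choice only concerns the values of \<open>ip\<close> outside \<open>H\<close>.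
\<close>

definition rkhs ::
    "'x set \<Rightarrow> ('x \<Rightarrow> 'x \<Rightarrow> complex)
      \<Rightarrow> ('x \<Rightarrow> complex) set \<times> (('x \<Rightarrow> complex) \<Rightarrow> ('x \<Rightarrow> complex) \<Rightarrow> complex)"
  where "rkhs \<Omega> K = (SOME p. is_rkhs \<Omega> K (fst p) (snd p))"

definition rkhs_space :: "'x set \<Rightarrow> ('x \<Rightarrow> 'x \<Rightarrow> complex) \<Rightarrow> ('x \<Rightarrow> complex) set"
  where "rkhs_space \<Omega> K = fst (rkhs \<Omega> K)"

definition rkhs_norm :: "'x set \<Rightarrow> ('x \<Rightarrow> 'x \<Rightarrow> complex) \<Rightarrow> ('x \<Rightarrow> complex) \<Rightarrow> real"
  where "rkhs_norm \<Omega> K h = sqrt (Re (snd (rkhs \<Omega> K) h h))"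

definition contractive_multipliers ::
    "'x set \<Rightarrow> ('x \<Rightarrow> 'x \<Rightarrow> complex) \<Rightarrow> ('x \<Rightarrow> complex) set"
  where "contractive_multipliers \<Omega> K = {\<phi>. \<forall>h\<in>rkhs_space \<Omega> K.
    (\<lambda>x. \<phi> x * h x) \<in> rkhs_space \<Omega> K \<and> rkhs_norm \<Omega> K (\<lambda>x. \<phi> x * h x) \<le> rkhs_norm \<Omega> K h}"

text \<open>
  Matrices are functions of two natural indices: an \<open>m \<times> n\<close> matrix \<open>W\<close> has the entries \<open>W a b\<close> with
  \<open>a < m\<close> and \<open>b < n\<close>. The tensor product of the space with complex \<open>n\<close>-space is its \<open>n\<close>-fold
  Hilbert space direct sum, that is, the set of \<open>n\<close>-tuples \<open>h 0, \<dots>, h (n - 1)\<close> in the space.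
\<close>

definition tuple_norm ::
    "'x set \<Rightarrow> ('x \<Rightarrow> 'x \<Rightarrow> complex) \<Rightarrow> nat \<Rightarrow> (nat \<Rightarrow> 'x \<Rightarrow> complex) \<Rightarrow> real"
  where "tuple_norm \<Omega> K n h = sqrt (\<Sum>b<n. (rkhs_norm \<Omega> K (h b))\<^sup>2)"

definition matrix_mult_op ::
    "nat \<Rightarrow> ('x \<Rightarrow> nat \<Rightarrow> nat \<Rightarrow> complex) \<Rightarrow> (nat \<Rightarrow> 'x \<Rightarrow> complex) \<Rightarrow> (nat \<Rightarrow> 'x \<Rightarrow> complex)"
  where "matrix_mult_op n \<Phi> h = (\<lambda>a x. \<Sum>b<n. \<Phi> x a b * h b x)"

definition contractive_matrix_multiplier ::
    "'x set \<Rightarrow> ('x \<Rightarrow> 'x \<Rightarrow> complex) \<Rightarrow> nat \<Rightarrow> nat \<Rightarrow> ('x \<Rightarrow> nat \<Rightarrow> nat \<Rightarrow> complex) \<Rightarrow> bool"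
  where "contractive_matrix_multiplier \<Omega> K m n \<Phi> \<longleftrightarrow>
    (\<forall>h. (\<forall>b<n. h b \<in> rkhs_space \<Omega> K) \<longrightarrow>
      (\<forall>a<m. matrix_mult_op n \<Phi> h a \<in> rkhs_space \<Omega> K) \<and>
      tuple_norm \<Omega> K m (matrix_mult_op n \<Phi> h) \<le> tuple_norm \<Omega> K n h)"

text \<open>The entries of the block matrix \<open>(I - W x (W y)\<^sup>*) K x y\<close>, for \<open>x\<close> and \<open>y\<close> in the given set.\<close>

definition pick_matrix ::
    "('x \<Rightarrow> 'x \<Rightarrow> complex) \<Rightarrow> nat \<Rightarrow> ('x \<Rightarrow> nat \<Rightarrow> nat \<Rightarrow> complex)
      \<Rightarrow> 'x \<times> nat \<Rightarrow> 'x \<times> nat \<Rightarrow> complex"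
  where "pick_matrix K n W = (\<lambda>(x, a) (y, b).
    (of_bool (a = b) - (\<Sum>l<n. W x a l * cnj (W y b l))) * K x y)"

definition cnp_kernel :: "'x set \<Rightarrow> ('x \<Rightarrow> 'x \<Rightarrow> complex) \<Rightarrow> bool"
  where "cnp_kernel \<Omega> K \<longleftrightarrow> kernel_on \<Omega> K \<and>
    (\<forall>m n X W. 0 < m \<and> 0 < n \<and> finite X \<and> X \<subseteq> \<Omega> \<and>
        psd (X \<times> {..<m}) (pick_matrix K n W) \<longrightarrow>
      (\<exists>\<Phi>. contractive_matrix_multiplier \<Omega> K m n \<Phi> \<and>
        (\<forall>x\<in>X. \<forall>a<m. \<forall>b<n. \<Phi> x a b = W x a b)))"

definition dbr_kernel :: "('x \<Rightarrow> 'x \<Rightarrow> complex) \<Rightarrow> ('x \<Rightarrow> complex) \<Rightarrow> 'x \<Rightarrow> 'x \<Rightarrow> complex"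
  where "dbr_kernel K \<phi> x y = (1 - \<phi> x * cnj (\<phi> y)) * K x y"

end

theory Submission
  imports Defs "HOL-Complex_Analysis.Complex_Analysis" "HOL-Library.Function_Algebras"
begin

text \<open>
  The de Branges-Rovnyak kernel \<open>L = dbr_kernel K \<phi>\<close> satisfies
  \<open>1 - 1 / L = (g g\<^sup>* - f f\<^sup>* - \<phi> \<phi>\<^sup>*) / (1 - \<phi> \<phi>\<^sup>*)\<close>. By the McCullough-Quiggin theorem, \<open>L\<close> is CNP
  iff this is a kernel, which is the solvability condition of the tangential interpolation problem
  \<open>\<Psi> (\<phi> x)\<^sup>* (g x)\<^sup>* = ((f x)\<^sup>*, cnj (\<phi> x))\<close> in the unit ball of \<open>H\<^sup>\<infinity>\<close>. One extension principle yields
  both the multipliers in the McCullough-Quiggin theorem and \<open>\<Psi>\<close>: if \<open>1 - 1 / k\<close> is a kernel, then a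
  family \<open>v\<close> with \<open>(G - \<langle>v, v\<rangle>) k \<ge> 0\<close> extends to one more index (Parrott), hence to all of them (Zorn).
  For \<open>\<Psi>\<close>, \<open>k\<close> is the Szego kernel of the disc, whose positivity on three points bounds the second
  divided differences of \<open>\<Psi>\<close> and so makes it holomorphic in norm.
\<close>

section \<open>Positive semi-definite matrices\<close>

text \<open>For an arbitrary kernel \<open>k\<close>, positivity of
  \<open>(G - \<langle>v, v\<rangle>) k\<close> need not extend to a new index \<open>i\<close>. It
  does here because the complement of \<open>k\<close>, normalized at \<open>i\<close>, is again a
  kernel and vanishes on the row of \<open>i\<close>: its Schur product with the given positive
  matrix is positive and leaves the new row to be filled by a contraction. Infinite dimension rules
  out bases and compactness; since positivity is a condition on finite sets, it survives unions of
  chains, and \<open>\<Omega>\<close> and the Hilbert spaces may have any size. Operators enter only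
  through vectors: a matrix function is the family of its rows, indexed by pairs of a point and a
  row number; \<open>\<Psi>\<close> is the family of the vectors \<open>T a x\<close>, the adjoint
  of \<open>\<Psi> a\<close> at \<open>x\<close>, indexed by pairs of a point and a vector.
  Linearity and boundedness of \<open>T a\<close> are not imposed but follow from
  positivity.\<close>

definition qform :: "'i set \<Rightarrow> ('i \<Rightarrow> 'i \<Rightarrow> complex) \<Rightarrow> ('i \<Rightarrow> complex) \<Rightarrow> complex"
  where "qform I M c = (\<Sum>i\<in>I. \<Sum>j\<in>I. cnj (c i) * M i j * c j)"

lemma psd_iff_qform: "psd I M \<longleftrightarrow> (\<forall>c. 0 \<le> Re (qform I M c) \<and> Im (qform I M c) = 0)"
  unfolding psd_def qform_def complex_nonneg_Reals_iff by simp

lemma qform_cong: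
  "(\<And>i j. i \<in> I \<Longrightarrow> j \<in> I \<Longrightarrow> M i j = N i j) \<Longrightarrow> (\<And>i. i \<in> I \<Longrightarrow> c i = d i) \<Longrightarrow>
    qform I M c = qform I N d"
  unfolding qform_def by (intro sum.cong refl) auto

lemma psd_cong: "(\<And>i j. i \<in> I \<Longrightarrow> j \<in> I \<Longrightarrow> M i j = N i j) \<Longrightarrow> psd I M \<longleftrightarrow> psd I N"
  unfolding psd_iff_qform using qform_cong[of I M N] by metis

lemma qform_hermitian_real:
  assumes "\<And>i j. i \<in> I \<Longrightarrow> j \<in> I \<Longrightarrow> M j i = cnj (M i j)"
  shows "Im (qform I M c) = 0"
proof -
  have "cnj (qform I M c) = (\<Sum>i\<in>I. \<Sum>j\<in>I. cnj (c j) * M j i * c i)"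
    unfolding qform_def cnj_sum
  proof (intro sum.cong refl)
    fix i j assume "i \<in> I" "j \<in> I"
    from assms[OF this] show "cnj (cnj (c i) * M i j * c j) = cnj (c j) * M j i * c i"
      by simp
  qed
  also have "\<dots> = qform I M c"
    unfolding qform_def by (rule sum.swap)
  finally show ?thesis
    by (simp add: complex_eq_iff)
qed

lemma psdI:
  assumes "\<And>i j. i \<in> I \<Longrightarrow> j \<in> I \<Longrightarrow> M j i = cnj (M i j)"
    and "\<And>c. 0 \<le> Re (qform I M c)"
  shows "psd I M"
  unfolding psd_iff_qform
proof (intro allI conjI)
  show "Im (qform I M c) = 0" for c
    using assms(1) by (rule qform_hermitian_real)
qed (rule assms(2))

lemma qform_mono_neutral:
  assumes "finite I" "J \<subseteq> I" "\<And>i. i \<in> I - J \<Longrightarrow> c i = 0"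
  shows "qform I M c = qform J M c"
proof -
  have inner: "(\<Sum>j\<in>I. cnj (c i) * M i j * c j) = (\<Sum>j\<in>J. cnj (c i) * M i j * c j)" for i
    using assms by (intro sum.mono_neutral_right) auto
  show ?thesis unfolding qform_def inner
    using assms by (intro sum.mono_neutral_right) auto
qed

lemma psd_subset:
  assumes "psd I M" "finite I" "J \<subseteq> I"
  shows "psd J M"
  unfolding psd_iff_qform
proof
  fix c :: "_ \<Rightarrow> complex"
  let ?c = "\<lambda>i. if i \<in> J then c i else 0"
  have "qform I M ?c = qform J M ?c"
    using assms by (intro qform_mono_neutral) auto
  also have "\<dots> = qform J M c"
    by (rule qform_cong) auto
  finally show "0 \<le> Re (qform J M c) \<and> Im (qform J M c) = 0"
    using assms(1) unfolding psd_iff_qform by metis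
qed

lemma psd_diag:
  assumes "psd I M" "finite I" "i \<in> I"
  shows "0 \<le> Re (M i i)" "Im (M i i) = 0"
proof -
  have "psd {i} M"
    using assms by (auto intro: psd_subset[OF assms(1)])
  then have "0 \<le> Re (qform {i} M (\<lambda>_. 1)) \<and> Im (qform {i} M (\<lambda>_. 1)) = 0"
    unfolding psd_iff_qform by blast
  then show "0 \<le> Re (M i i)" "Im (M i i) = 0"
    by (auto simp: qform_def)
qed

lemma psd_hermitian:
  assumes "psd I M" "finite I" "i \<in> I" "j \<in> I"
  shows "M j i = cnj (M i j)"
proof (cases "i = j")
  case True
  then show ?thesis using psd_diag[OF assms(1-3)] by (simp add: complex_eq_iff)
next
  case False
  have *: "psd {i, j} M"
    using assms by (auto intro: psd_subset[OF assms(1)])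
  \<comment> \<open>The value \<open>a = 1\<close> makes the sum of the two off-diagonal entries
    real, \<open>a = \<i>\<close> makes their difference imaginary.\<close>
  have "Im (qform {i, j} M ((\<lambda>_. 0)(i := 1, j := a))) = 0" for a
    using * unfolding psd_iff_qform by blast
  from this[of 1] this[of \<i>] show ?thesis
    using False psd_diag[OF assms(1-3)] psd_diag[OF assms(1,2,4)]
    by (auto simp: qform_def complex_eq_iff)
qed

lemma qform_add: "qform I (\<lambda>i j. M i j + N i j) c = qform I M c + qform I N c"
  unfolding qform_def by (simp add: algebra_simps sum.distrib)

lemma qform_diff: "qform I (\<lambda>i j. M i j - N i j) c = qform I M c - qform I N c"
  unfolding qform_def by (simp add: algebra_simps sum_subtractf)

lemma psd_add: "psd I M \<Longrightarrow> psd I N \<Longrightarrow> psd I (\<lambda>i j. M i j + N i j)"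
  unfolding psd_iff_qform qform_add by auto

lemma qform_rank_one:
  "qform I (\<lambda>i j. a i * cnj (a j)) c = of_real ((cmod (\<Sum>i\<in>I. cnj (a i) * c i))\<^sup>2)"
proof -
  have "qform I (\<lambda>i j. a i * cnj (a j)) c =
      cnj (\<Sum>i\<in>I. cnj (a i) * c i) * (\<Sum>i\<in>I. cnj (a i) * c i)"
    unfolding qform_def cnj_sum sum_product by (intro sum.cong refl) (simp add: mult_ac)
  then show ?thesis
    by (simp only: complex_norm_square mult.commute)
qed

lemma psd_rank_one: "psd I (\<lambda>i j. a i * cnj (a j))"
  unfolding psd_iff_qform qform_rank_one by simp

text \<open>The map \<open>p\<close> may identify indices; the coefficients over one fibre then add
  up. This is what makes kernels pull back along projections such as \<open>fst\<close>.\<close>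

lemma qform_reindex_fibres:
  assumes "finite J"
  shows "qform J (\<lambda>i j. M (p i) (p j)) c = qform (p ` J) M (\<lambda>a. \<Sum>i\<in>{i\<in>J. p i = a}. c i)"
proof -
  let ?C = "\<lambda>a. \<Sum>i\<in>{i\<in>J. p i = a}. c i"
  have "qform J (\<lambda>i j. M (p i) (p j)) c =
      (\<Sum>a\<in>p ` J. \<Sum>i\<in>{i\<in>J. p i = a}. \<Sum>b\<in>p ` J. \<Sum>j\<in>{j\<in>J. p j = b}.
        cnj (c i) * M (p i) (p j) * c j)"
    unfolding qform_def
    by (subst sum.image_gen[OF assms, of _ p], intro sum.cong refl, subst sum.image_gen[OF assms, of _ p])
      simp
  also have "\<dots> = (\<Sum>a\<in>p ` J. \<Sum>i\<in>{i\<in>J. p i = a}. \<Sum>b\<in>p ` J. cnj (c i) * (M a b * ?C b))"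
    by (intro sum.cong refl) (auto simp: sum_distrib_left mult_ac intro!: sum.cong)
  also have "\<dots> = (\<Sum>a\<in>p ` J. \<Sum>b\<in>p ` J. \<Sum>i\<in>{i\<in>J. p i = a}. cnj (c i) * (M a b * ?C b))"
    by (intro sum.cong refl) (rule sum.swap)
  also have "\<dots> = qform (p ` J) M ?C"
    unfolding qform_def by (intro sum.cong refl) (simp add: sum_distrib_right mult.assoc)
  finally show ?thesis .
qed

lemma psd_reindex: "finite J \<Longrightarrow> psd (p ` J) M \<Longrightarrow> psd J (\<lambda>i j. M (p i) (p j))"
  unfolding psd_iff_qform qform_reindex_fibres by blast

lemma psd_image_inj:
  assumes "inj_on p J" "psd J (\<lambda>i j. M (p i) (p j))"
  shows "psd (p ` J) M"
proof -
  have "qform (p ` J) M c = qform J (\<lambda>i j. M (p i) (p j)) (\<lambda>i. c (p i))" for c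
    unfolding qform_def using assms(1) by (simp add: sum.reindex)
  then show ?thesis using assms(2) unfolding psd_iff_qform by simp
qed

lemma psd_extend_zero:
  assumes "finite I" "psd (I - {z}) M" "\<And>i. i \<in> I \<Longrightarrow> M z i = 0 \<and> M i z = 0"
  shows "psd I M"
proof -
  have "qform I M c = qform (I - {z}) M c" for c
  proof -
    have "qform I M c = qform I M (c(z := 0))"
      unfolding qform_def by (intro sum.cong refl) (auto simp: assms(3))
    also have "\<dots> = qform (I - {z}) M (c(z := 0))"
      using assms(1) by (intro qform_mono_neutral) auto
    also have "\<dots> = qform (I - {z}) M c"
      by (intro qform_cong) auto
    finally show ?thesis .
  qed
  then show ?thesis using assms(2) unfolding psd_iff_qform by simp
qed

lemma qform_insert:
  assumes "finite I" "z \<notin> I"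
  shows "qform (insert z I) M c = cnj (c z) * M z z * c z + cnj (c z) * (\<Sum>j\<in>I. M z j * c j)
    + (\<Sum>i\<in>I. cnj (c i) * M i z) * c z + qform I M c"
  using assms unfolding qform_def
  by (simp add: sum.distrib sum_distrib_left sum_distrib_right algebra_simps)

text \<open>If the pivot vanishes, then so do its row and column, and the division by zero is harmless.\<close>

lemma psd_schur_complement:
  assumes "finite I" "z \<notin> I" "psd (insert z I) M"
  shows "psd I (\<lambda>i j. M i j - M i z * M z j / M z z)"
    and "M z z = 0 \<Longrightarrow> i \<in> I \<Longrightarrow> M i z = 0"
proof -
  have herm: "M j i = cnj (M i j)" if "i \<in> insert z I" "j \<in> insert z I" for i j
    using psd_hermitian[OF assms(3) _ that] assms(1) by blast
  define a where "a = Re (M z z)"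
  have a: "M z z = of_real a" "0 \<le> a"
    using psd_diag[OF assms(3), of z] assms(1) by (auto simp: a_def complex_eq_iff)
  define b where "b c = (\<Sum>j\<in>I. M z j * c j)" for c
  have b': "(\<Sum>i\<in>I. cnj (c i) * M i z) = cnj (b c)" for c
    unfolding b_def cnj_sum
  proof (rule sum.cong[OF refl])
    fix i assume "i \<in> I"
    then have "M i z = cnj (M z i)"
      by (intro herm) auto
    then show "cnj (c i) * M i z = cnj (M z i * c i)"
      by simp
  qed
  \<comment> \<open>The form at \<open>c\<close> with the value \<open>x\<close> inserted at
    \<open>z\<close>, as a real quadratic polynomial in \<open>x\<close>.\<close>
  have ineq: "0 \<le> Re (qform I M c) + 2 * Re (cnj x * b c) + a * (cmod x)\<^sup>2" for c x
  proof -
    have "qform (insert z I) M (c(z := x)) =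
        cnj x * M z z * x + cnj x * b c + cnj (b c) * x + qform I M c"
    proof -
      have "(\<Sum>j\<in>I. M z j * (c(z := x)) j) = b c" "qform I M (c(z := x)) = qform I M c"
        unfolding b_def using assms(2) by (auto intro!: sum.cong qform_cong)
      moreover have "(\<Sum>i\<in>I. cnj ((c(z := x)) i) * M i z) = cnj (b c)"
        unfolding b'[of c, symmetric] using assms(2) by (auto intro!: sum.cong)
      moreover note qform_insert[OF assms(1,2), of M "c(z := x)"]
      ultimately show ?thesis
        by simp
    qed
    moreover have "Re (cnj x * M z z * x) = a * (cmod x)\<^sup>2"
      unfolding a cmod_power2 by (simp add: power2_eq_square algebra_simps)
    moreover have "Re (cnj (b c) * x) = Re (cnj x * b c)"
      by simp
    ultimately show ?thesis
      using assms(3) unfolding psd_iff_qform by (smt (verit) plus_complex.sel(1))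
  qed
  have b0: "b c = 0" if "a = 0" for c
  proof (rule ccontr)
    assume nz: "b c \<noteq> 0"
    \<comment> \<open>With zero pivot the polynomial in \<open>ineq\<close> is affine;
      \<open>x = - of_real t * b c\<close> takes it to \<open>- Re (qform I M c) - 2\<close>,
      whereas \<open>x = 0\<close> gives \<open>0 \<le> Re (qform I M c)\<close>.\<close>
    define t where "t = (Re (qform I M c) + 1) / (cmod (b c))\<^sup>2"
    have "Re (cnj (- of_real t * b c) * b c) = - t * (cmod (b c))\<^sup>2"
      unfolding cmod_power2 by (simp add: power2_eq_square algebra_simps)
    also have "\<dots> = - (Re (qform I M c) + 1)"
      using nz by (simp add: t_def)
    finally show False
      using ineq[of c "- of_real t * b c"] ineq[of c 0] \<open>a = 0\<close> by simp
  qed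
  show "M i z = 0" if "M z z = 0" "i \<in> I"
  proof -
    have "b (\<lambda>j. of_bool (j = i)) = M z i"
      using that assms(1) by (simp add: b_def of_bool_def if_distrib sum.delta' cong: if_cong)
    then show ?thesis
      using b0 that a(1) herm[of z i] by (metis complex_cnj_zero_iff insertCI of_real_eq_0_iff)
  qed
  have qf: "qform I (\<lambda>i j. M i j - M i z * M z j / M z z) c = qform I M c - of_real ((cmod (b c))\<^sup>2) / M z z"
    for c
  proof -
    have "qform I (\<lambda>i j. M i z * M z j / M z z) c = cnj (b c) * b c / M z z"
      unfolding b'[symmetric] unfolding b_def sum_product qform_def sum_divide_distrib
      by (intro sum.cong refl) (simp add: mult_ac)
    then show ?thesis
      by (simp only: qform_diff complex_norm_square mult.commute)
  qed
  show "psd I (\<lambda>i j. M i j - M i z * M z j / M z z)"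
  proof (rule psdI)
    show "M j i - M j z * M z i / M z z = cnj (M i j - M i z * M z j / M z z)"
      if "i \<in> I" "j \<in> I" for i j
    proof -
      have "M j i = cnj (M i j)" "M j z = cnj (M z j)" "M z i = cnj (M i z)"
        using that by (auto intro!: herm)
      then show ?thesis by (simp add: a mult.commute)
    qed
    show "0 \<le> Re (qform I (\<lambda>i j. M i j - M i z * M z j / M z z) c)" for c
    proof (cases "a = 0")
      case True
      then show ?thesis using ineq[of c 0] by (simp add: qf a)
    next
      case False
      \<comment> \<open>The value \<open>x = - b c / of_real a\<close> minimizes the polynomial in
        \<open>ineq\<close>.\<close>
      have "Re (cnj (- b c / of_real a) * b c) = - (cmod (b c))\<^sup>2 / a"
        using False unfolding cmod_power2 by (simp add: power2_eq_square field_simps)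
      moreover have "a * (cmod (- b c / of_real a))\<^sup>2 = (cmod (b c))\<^sup>2 / a"
        using False a by (simp add: norm_divide power2_eq_square)
      moreover have "Re (of_real ((cmod (b c))\<^sup>2) / M z z) = (cmod (b c))\<^sup>2 / a"
        unfolding a by (metis Re_complex_of_real of_real_divide)
      ultimately show ?thesis using ineq[of c "- b c / of_real a"] by (simp only: qf minus_complex.sel)
    qed
  qed
qed

text \<open>Cholesky factorization: every induction step splits off the pivot column as one more
  coordinate and factors the Schur complement. The dimension is kept positive because
  \<open>cnp_kernel\<close> speaks only of matrices with at least one column.\<close>

lemma psd_gram:
  assumes "finite I" "psd I M"
  obtains N :: nat and v :: "'i \<Rightarrow> nat \<Rightarrow> complex"
  where "0 < N" "\<And>i j. i \<in> I \<Longrightarrow> j \<in> I \<Longrightarrow> M i j = (\<Sum>l<N. v i l * cnj (v j l))"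
proof -
  have "\<exists>N v. 0 < N \<and> (\<forall>i\<in>I. \<forall>j\<in>I. M i j = (\<Sum>l<N::nat. v i l * cnj (v j l)))"
    using assms
  proof (induction I arbitrary: M rule: finite_induct)
    case empty
    then show ?case by auto
  next
    case (insert z I)
    note sc = psd_schur_complement[OF insert.hyps(1,2) insert.prems]
    have herm: "M j i = cnj (M i j)" if "i \<in> insert z I" "j \<in> insert z I" for i j
      using psd_hermitian[OF insert.prems _ that] insert.hyps by blast
    obtain N v where N: "0 < N" and v: "\<And>i j. i \<in> I \<Longrightarrow> j \<in> I \<Longrightarrow>
        M i j - M i z * M z j / M z z = (\<Sum>l<N::nat. v i l * cnj (v j l))"
      using insert.IH[OF sc(1)] by blast
    define a where "a = Re (M z z)"
    have a: "M z z = of_real a" "0 \<le> a"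
      using psd_diag[OF insert.prems, of z] insert.hyps(1) by (auto simp: a_def complex_eq_iff)
    \<comment> \<open>The vector of \<open>z\<close> has the new coordinate \<open>N\<close> only.
      If the pivot is zero, so is its column, and the quotient is zero as well.\<close>
    define u where "u i l = (if l = N then M i z / of_real (sqrt a) else if i = z then 0 else v i l)"
      for i l
    have sqrt: "complex_of_real (sqrt a) * complex_of_real (sqrt a) = of_real a"
      using a(2) by (simp flip: of_real_mult)
    have "M i j = (\<Sum>l<Suc N. u i l * cnj (u j l))" if "i \<in> insert z I" "j \<in> insert z I" for i j
    proof -
      have last: "u i N * cnj (u j N) = M i z * M z j / M z z"
        using herm[of j z] that by (simp add: u_def a sqrt)
      show ?thesis
      proof (cases "i = z \<or> j = z")
        case True
        then have "(\<Sum>l<N. u i l * cnj (u j l)) = 0"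
          by (intro sum.neutral) (auto simp: u_def)
        moreover have "M i z * M z j / M z z = M i j"
        proof (cases "M z z = 0")
          case False
          then show ?thesis using True by auto
        next
          case zero: True
          have "M i j = 0"
            using True sc(2)[OF zero] herm[of z] zero that
            by (metis complex_cnj_zero_iff insert_iff)
          then show ?thesis by (simp add: zero)
        qed
        ultimately show ?thesis by (simp add: last)
      next
        case False
        then have "(\<Sum>l<N. u i l * cnj (u j l)) = (\<Sum>l<N. v i l * cnj (v j l))"
          by (intro sum.cong) (auto simp: u_def)
        then show ?thesis using v[of i j] that False by (simp add: last algebra_simps)
      qed
    qed
    then show ?case by (intro exI[of _ "Suc N"] exI[of _ u]) auto
  qed
  then show ?thesis using that by blast
qed

text \<open>With \<open>A\<close> factored, the form of the product at \<open>c\<close> is the sum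
  over \<open>l\<close> of the form of \<open>B\<close> at \<open>cnj (v i l) * c i\<close>.\<close>

lemma psd_schur_product:
  assumes "finite I" "psd I A" "psd I B"
  shows "psd I (\<lambda>i j. A i j * B i j)"
proof -
  obtain N :: nat and v where v: "\<And>i j. i \<in> I \<Longrightarrow> j \<in> I \<Longrightarrow> A i j = (\<Sum>l<N. v i l * cnj (v j l))"
    using psd_gram[OF assms(1,2)] by metis
  have "qform I (\<lambda>i j. A i j * B i j) c = (\<Sum>l<N. qform I B (\<lambda>i. cnj (v i l) * c i))" for c
  proof -
    have "qform I (\<lambda>i j. A i j * B i j) c =
        (\<Sum>i\<in>I. \<Sum>j\<in>I. \<Sum>l<N. cnj (cnj (v i l) * c i) * B i j * (cnj (v j l) * c j))"
      unfolding qform_def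
      by (intro sum.cong refl) (simp add: v sum_distrib_left sum_distrib_right mult_ac)
    also have "\<dots> = (\<Sum>i\<in>I. \<Sum>l<N. \<Sum>j\<in>I. cnj (cnj (v i l) * c i) * B i j * (cnj (v j l) * c j))"
      by (intro sum.cong refl) (rule sum.swap)
    also have "\<dots> = (\<Sum>l<N. \<Sum>i\<in>I. \<Sum>j\<in>I. cnj (cnj (v i l) * c i) * B i j * (cnj (v j l) * c j))"
      by (rule sum.swap)
    finally show ?thesis unfolding qform_def .
  qed
  then show ?thesis
    using assms(3) unfolding psd_iff_qform by (auto intro!: sum_nonneg)
qed

section \<open>Kernels\<close>

lemma kernel_onD: "kernel_on S M \<Longrightarrow> finite X \<Longrightarrow> X \<subseteq> S \<Longrightarrow> psd X M"
  unfolding kernel_on_def by blast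

lemma kernel_on_cong:
  "(\<And>x y. x \<in> S \<Longrightarrow> y \<in> S \<Longrightarrow> M x y = N x y) \<Longrightarrow> kernel_on S M \<longleftrightarrow> kernel_on S N"
  unfolding kernel_on_def by (metis psd_cong subsetD)

lemma kernel_on_hermitian: "kernel_on S M \<Longrightarrow> x \<in> S \<Longrightarrow> y \<in> S \<Longrightarrow> M y x = cnj (M x y)"
  using psd_hermitian[of "{x, y}" M x y] unfolding kernel_on_def by auto

lemma kernel_on_diag: "kernel_on S M \<Longrightarrow> x \<in> S \<Longrightarrow> 0 \<le> Re (M x x) \<and> Im (M x x) = 0"
  using psd_diag[of "{x}" M x] unfolding kernel_on_def by auto

lemma kernel_on_pullback:
  assumes "kernel_on S M" "p ` T \<subseteq> S"
  shows "kernel_on T (\<lambda>x y. M (p x) (p y))"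
  unfolding kernel_on_def
proof (intro allI impI)
  fix X assume "finite X \<and> X \<subseteq> T"
  then show "psd X (\<lambda>x y. M (p x) (p y))"
    using assms(2) by (intro psd_reindex[OF _ kernel_onD[OF assms(1)]]) auto
qed

text \<open>A finite part of the image needs only one preimage per point, and \<open>p\<close> is
  injective on these. This converts indexed data into positivity on a set of pairs, the form in
  which \<open>pick_extension\<close> takes them.\<close>

lemma kernel_on_image:
  assumes "kernel_on T (\<lambda>x y. M (p x) (p y))"
  shows "kernel_on (p ` T) M"
  unfolding kernel_on_def
proof (intro allI impI)
  fix X assume "finite X \<and> X \<subseteq> p ` T"
  then obtain Y where Y: "Y \<subseteq> T" "inj_on p Y" "X = p ` Y"
    using subset_image_inj[of X p T] by auto
  with \<open>finite X \<and> X \<subseteq> p ` T\<close> have "finite Y"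
    using finite_image_iff by metis
  then show "psd X M"
    unfolding Y(3) using Y(1,2) assms by (intro psd_image_inj) (auto simp: kernel_on_def)
qed

lemma kernel_on_schur: "kernel_on S A \<Longrightarrow> kernel_on S B \<Longrightarrow> kernel_on S (\<lambda>x y. A x y * B x y)"
  unfolding kernel_on_def using psd_schur_product by blast

lemma kernel_on_add: "kernel_on S A \<Longrightarrow> kernel_on S B \<Longrightarrow> kernel_on S (\<lambda>x y. A x y + B x y)"
  unfolding kernel_on_def using psd_add by blast

lemma kernel_on_rank_one: "kernel_on S (\<lambda>x y. a x * cnj (a y))"
  unfolding kernel_on_def using psd_rank_one by blast

lemma kernel_on_insert_zero:
  assumes "kernel_on S M" "z \<notin> S" "\<And>x. x \<in> insert z S \<Longrightarrow> M z x = 0 \<and> M x z = 0"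
  shows "kernel_on (insert z S) M"
  unfolding kernel_on_def
proof (intro allI impI)
  fix X assume "finite X \<and> X \<subseteq> insert z S"
  then show "psd X M"
    using assms(3) by (intro psd_extend_zero[of X z] kernel_onD[OF assms(1)]) auto
qed

text \<open>
  The conclusion is the hypothesis for \<open>k\<close> normalized at \<open>z\<close>: it is \<open>k x z * k z y / k z z\<close> times the
  sum of the Schur complement of \<open>1 - 1 / k\<close> at \<open>z\<close> and a matrix of rank one.
\<close>

lemma kernel_on_change_base:
  assumes F: "kernel_on S (\<lambda>x y. 1 - 1 / k x y)"
    and nz: "\<And>x y. x \<in> S \<Longrightarrow> y \<in> S \<Longrightarrow> k x y \<noteq> 0"
    and z: "z \<in> S" and pos: "0 < Re (k z z)"
  shows "kernel_on S (\<lambda>x y. 1 - k x z * k z y / (k z z * k x y))"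
  unfolding kernel_on_def
proof (intro allI impI)
  let ?F = "\<lambda>x y. 1 - k x z * k z y / (k z z * k x y)"
  fix X assume "finite X \<and> X \<subseteq> S"
  define Y where "Y = X - {z}"
  have Y: "finite Y" "Y \<subseteq> S" "z \<notin> Y" and X: "finite X" "X \<subseteq> S"
    using \<open>finite X \<and> X \<subseteq> S\<close> by (auto simp: Y_def)
  have herm: "k x z = cnj (k z x)" if "x \<in> S" for x
    using kernel_on_hermitian[OF F z that] by simp
  define r where "r = Re (k z z)"
  have r: "k z z = of_real r" "0 < r"
    using pos herm[OF z] by (auto simp: r_def complex_eq_iff)
  have "1 / r \<le> 1" using kernel_on_diag[OF F z] by (simp add: r)
  then have r1: "1 \<le> r" using r(2) by simp
  define f where "f x y = 1 - 1 / k x y" for x y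
  have "psd (insert z Y) f"
    unfolding f_def using Y z by (intro kernel_onD[OF F]) auto
  note schur = psd_schur_complement[OF Y(1,3) this]
  \<comment> \<open>The target asks for \<open>1 - r * s * t\<close> where the Schur complement
    subtracts \<open>r * (1 - s) * (1 - t) / (r - 1)\<close>, with \<open>s = 1 / k x z\<close> and
    \<open>t = 1 / k z y\<close>. The excess of the latter over the former is
    \<open>(1 - r * s) * (1 - r * t) / (r - 1)\<close>, the rank-one term of
    \<open>b\<close>.\<close>
  define b where "b x = (1 / k x z - 1 / of_real r) * of_real (r / sqrt (r - 1))" for x
  define c where "c x = k x z / of_real (sqrt r)" for x
  have "psd Y (\<lambda>x y. (f x y - f x z * f z y / f z z + b x * cnj (b y)) * (c x * cnj (c y)))"
    by (intro psd_schur_product[OF Y(1)] psd_add schur(1) psd_rank_one)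
  moreover have "(f x y - f x z * f z y / f z z + b x * cnj (b y)) * (c x * cnj (c y)) =
      1 - k x z * k z y / (k z z * k x y)" if "x \<in> Y" "y \<in> Y" for x y
  proof -
    have S: "x \<in> S" "y \<in> S" using that Y by auto
    have cc: "c x * cnj (c y) = k x z * k z y / of_real r"
      using r(2) by (simp add: c_def herm[OF S(2)] flip: of_real_mult)
    show ?thesis
    proof (cases "r = 1")
      case True
      \<comment> \<open>Here the pivot \<open>f z z\<close> is zero, so its column vanishes and
        \<open>k\<close> is 1 along \<open>z\<close>; \<open>b\<close> is zero too.\<close>
      have "k z x = 1" "k z y = 1"
        using schur(2)[of x] schur(2)[of y] that True r(1) herm[OF S(1)] herm[OF S(2)]
        by (auto simp: f_def)
      then show ?thesis using True r(1) cc herm[OF S(1)] by (simp add: f_def b_def)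
    next
      case False
      define R where "R = complex_of_real r"
      have R: "R \<noteq> 0" "R - 1 \<noteq> 0" using False r(2) by (auto simp: R_def)
      define q where "q = complex_of_real (r / sqrt (r - 1))"
      have qq: "q * q = R * R / (R - 1)"
        using r1 by (simp add: q_def R_def flip: of_real_mult)
      have "cnj q = q" by (simp add: q_def)
      then have "b x * cnj (b y) = (1 / k x z - 1 / R) * (1 / k z y - 1 / R) * (q * q)"
        unfolding b_def q_def[symmetric] by (simp add: herm[OF S(2)] R_def)
      note bb = this[unfolded qq]
      have "k x y \<noteq> 0" "k x z \<noteq> 0" "k z y \<noteq> 0" using nz S z by auto
      then show ?thesis
        using R unfolding cc bb r(1) R_def[symmetric] f_def by (simp add: divide_simps) algebra
    qed
  qed
  ultimately have "psd (X - {z}) ?F"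
    unfolding Y_def by (rule psd_cong[THEN iffD1, rotated])
  then show "psd X ?F"
  proof (rule psd_extend_zero[OF X(1)])
    fix x assume "x \<in> X"
    then show "1 - k z z * k z x / (k z z * k z x) = 0 \<and> 1 - k x z * k z z / (k z z * k x z) = 0"
      using nz z X by (auto simp: subset_iff)
  qed
qed

section \<open>Semi-inner product spaces and Hilbert spaces with a carrier\<close>

text \<open>
  With a carrier, one locale covers chilbert_space types, their powers \<open>V\<^sup>m\<close> for variable \<open>m\<close> and the
  function spaces of \<open>is_rkhs\<close>.
\<close>

locale semi_ip = vector_space scale
  for scale :: "complex \<Rightarrow> 'v :: ab_group_add \<Rightarrow> 'v" +
  fixes V :: "'v set" and ip :: "'v \<Rightarrow> 'v \<Rightarrow> complex"
  assumes subspace_V: "subspace V"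
    and ip_add_left: "x \<in> V \<Longrightarrow> y \<in> V \<Longrightarrow> z \<in> V \<Longrightarrow> ip (x + y) z = ip x z + ip y z"
    and ip_scale_left: "x \<in> V \<Longrightarrow> y \<in> V \<Longrightarrow> ip (scale a x) y = a * ip x y"
    and ip_commute: "x \<in> V \<Longrightarrow> y \<in> V \<Longrightarrow> ip x y = cnj (ip y x)"
    and ip_nonneg: "x \<in> V \<Longrightarrow> 0 \<le> Re (ip x x)"
begin

definition nrm2 :: "'v \<Rightarrow> real" where "nrm2 x = Re (ip x x)"

definition nrm :: "'v \<Rightarrow> real" where "nrm x = sqrt (nrm2 x)"

definition Cauchy_seq :: "(nat \<Rightarrow> 'v) \<Rightarrow> bool"
  where "Cauchy_seq s \<longleftrightarrow> (\<forall>n. s n \<in> V) \<and>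
    (\<forall>e>0. \<exists>N. \<forall>m\<ge>N. \<forall>n\<ge>N. nrm (s m - s n) < e)"

lemma mem_V [simp, intro]:
  "0 \<in> V" "x \<in> V \<Longrightarrow> y \<in> V \<Longrightarrow> x + y \<in> V" "x \<in> V \<Longrightarrow> y \<in> V \<Longrightarrow> x - y \<in> V"
  "x \<in> V \<Longrightarrow> scale a x \<in> V" "x \<in> V \<Longrightarrow> - x \<in> V"
  using subspace_V by (auto simp: subspace_0 subspace_add subspace_diff subspace_scale subspace_neg)

lemma ip_diff_left: "x \<in> V \<Longrightarrow> y \<in> V \<Longrightarrow> z \<in> V \<Longrightarrow> ip (x - y) z = ip x z - ip y z"
  using ip_add_left[of "x - y" y z] by simp

lemma ip_zero_left: "z \<in> V \<Longrightarrow> ip 0 z = 0"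
  using ip_add_left[of 0 0 z] by simp

lemma ip_zero_right: "z \<in> V \<Longrightarrow> ip z 0 = 0"
  using ip_commute[of z 0] ip_zero_left by simp

lemma ip_add_right: "x \<in> V \<Longrightarrow> y \<in> V \<Longrightarrow> z \<in> V \<Longrightarrow> ip z (x + y) = ip z x + ip z y"
  using ip_add_left[of x y z] ip_commute[of z "x + y"] ip_commute[of z x] ip_commute[of z y] by simp

lemma ip_diff_right: "x \<in> V \<Longrightarrow> y \<in> V \<Longrightarrow> z \<in> V \<Longrightarrow> ip z (x - y) = ip z x - ip z y"
  using ip_add_right[of "x - y" y z] by simp

lemma ip_scale_right: "x \<in> V \<Longrightarrow> y \<in> V \<Longrightarrow> ip x (scale a y) = cnj a * ip x y"
  using ip_scale_left[of y x a] ip_commute[of x "scale a y"] ip_commute[of x y] by simp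

lemma sum_mem: "(\<And>i. i \<in> A \<Longrightarrow> f i \<in> V) \<Longrightarrow> (\<Sum>i\<in>A. f i) \<in> V"
  using subspace_sum[OF subspace_V] by blast

lemma ip_sum_left:
  assumes "\<And>i. i \<in> A \<Longrightarrow> f i \<in> V" "z \<in> V"
  shows "ip (\<Sum>i\<in>A. f i) z = (\<Sum>i\<in>A. ip (f i) z)"
  using assms(1)
  by (induction A rule: infinite_finite_induct)
    (simp_all add: ip_zero_left ip_add_left sum_mem assms(2))

lemma ip_sum_right:
  assumes "\<And>i. i \<in> A \<Longrightarrow> f i \<in> V" "z \<in> V"
  shows "ip z (\<Sum>i\<in>A. f i) = (\<Sum>i\<in>A. ip z (f i))"
  using assms(1)
  by (induction A rule: infinite_finite_induct)
    (simp_all add: ip_zero_right ip_add_right sum_mem assms(2))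

lemma ip_self: "x \<in> V \<Longrightarrow> ip x x = of_real (nrm2 x)"
  using ip_commute[of x x] by (simp add: nrm2_def complex_eq_iff)

lemma nrm2_nonneg: "x \<in> V \<Longrightarrow> 0 \<le> nrm2 x"
  unfolding nrm2_def by (rule ip_nonneg)

lemma nrm_nonneg: "x \<in> V \<Longrightarrow> 0 \<le> nrm x"
  by (simp add: nrm_def nrm2_nonneg)

lemma nrm_sq: "x \<in> V \<Longrightarrow> (nrm x)\<^sup>2 = nrm2 x"
  by (simp add: nrm_def nrm2_nonneg)

lemma nrm2_add: "x \<in> V \<Longrightarrow> y \<in> V \<Longrightarrow> nrm2 (x + y) = nrm2 x + nrm2 y + 2 * Re (ip x y)"
  using ip_commute[of y x] by (simp add: nrm2_def ip_add_left ip_add_right)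

lemma nrm2_diff: "x \<in> V \<Longrightarrow> y \<in> V \<Longrightarrow> nrm2 (x - y) = nrm2 x + nrm2 y - 2 * Re (ip x y)"
  using ip_commute[of y x] by (simp add: nrm2_def ip_diff_left ip_diff_right)

lemma nrm2_scale: "x \<in> V \<Longrightarrow> nrm2 (scale a x) = (cmod a)\<^sup>2 * nrm2 x"
proof -
  assume x: "x \<in> V"
  then have "ip (scale a x) (scale a x) = (a * cnj a) * ip x x"
    by (simp add: ip_scale_left ip_scale_right)
  also have "\<dots> = of_real ((cmod a)\<^sup>2 * nrm2 x)"
    by (simp only: complex_norm_square[symmetric] ip_self[OF x] of_real_mult)
  finally show ?thesis
    by (simp only: nrm2_def Re_complex_of_real)
qed

lemma nrm2_diff_commute: "x \<in> V \<Longrightarrow> y \<in> V \<Longrightarrow> nrm2 (x - y) = nrm2 (y - x)"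
  using ip_commute[of y x] by (simp add: nrm2_diff)

lemma nrm_diff_commute: "x \<in> V \<Longrightarrow> y \<in> V \<Longrightarrow> nrm (x - y) = nrm (y - x)"
  by (simp add: nrm_def nrm2_diff_commute)

lemma Cauchy_Schwarz:
  assumes "x \<in> V" "y \<in> V"
  shows "(cmod (ip x y))\<^sup>2 \<le> nrm2 x * nrm2 y"
proof -
  \<comment> \<open>Expand the squared norm of \<open>x\<close> minus \<open>t\<close> times
    \<open>ip x y\<close> times \<open>y\<close>. The form may be degenerate: if
    \<open>nrm2 y\<close> is zero, large \<open>t\<close> forces \<open>ip x y\<close> to
    vanish.\<close>
  have key: "2 * t * (cmod (ip x y))\<^sup>2 \<le> nrm2 x + t\<^sup>2 * (cmod (ip x y))\<^sup>2 * nrm2 y" for t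
  proof -
    have "0 \<le> nrm2 (x - scale (of_real t * ip x y) y)"
      using assms by (intro nrm2_nonneg) auto
    also have "\<dots> = nrm2 x + t\<^sup>2 * (cmod (ip x y))\<^sup>2 * nrm2 y - 2 * t * (cmod (ip x y))\<^sup>2"
    proof -
      have "Re (ip x (scale (of_real t * ip x y) y)) = t * (cmod (ip x y))\<^sup>2"
        using assms unfolding cmod_power2 by (simp add: ip_scale_right power2_eq_square algebra_simps)
      then show ?thesis
        using assms by (simp add: nrm2_diff nrm2_scale norm_mult power_mult_distrib)
    qed
    finally show ?thesis by simp
  qed
  show ?thesis
  proof (cases "nrm2 y = 0")
    case True
    have "(cmod (ip x y))\<^sup>2 = 0"
    proof (rule ccontr)
      assume "(cmod (ip x y))\<^sup>2 \<noteq> 0"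
      then have "2 * ((nrm2 x + 1) / (cmod (ip x y))\<^sup>2) * (cmod (ip x y))\<^sup>2 = 2 * (nrm2 x + 1)"
        by simp
      then show False
        using key[of "(nrm2 x + 1) / (cmod (ip x y))\<^sup>2"] True nrm2_nonneg[OF assms(1)] by simp
    qed
    then show ?thesis using True by simp
  next
    case False
    then have "0 < nrm2 y" using nrm2_nonneg[OF assms(2)] by simp
    then show ?thesis using key[of "1 / nrm2 y"] by (simp add: field_simps power2_eq_square)
  qed
qed

lemma cmod_ip_le: "x \<in> V \<Longrightarrow> y \<in> V \<Longrightarrow> cmod (ip x y) \<le> nrm x * nrm y"
  using Cauchy_Schwarz[of x y] unfolding nrm_def
  by (metis real_sqrt_mult real_sqrt_le_iff norm_ge_zero real_sqrt_unique)

lemma nrm_triangle: "x \<in> V \<Longrightarrow> y \<in> V \<Longrightarrow> nrm (x + y) \<le> nrm x + nrm y"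
proof -
  assume xy: "x \<in> V" "y \<in> V"
  have "nrm2 (x + y) \<le> nrm2 x + nrm2 y + 2 * (nrm x * nrm y)"
    using cmod_ip_le[OF xy] complex_Re_le_cmod[of "ip x y"] xy by (simp add: nrm2_add)
  also have "\<dots> = (nrm x + nrm y)\<^sup>2"
    using xy by (simp add: power2_sum nrm_sq)
  finally have "nrm2 (x + y) \<le> (nrm x + nrm y)\<^sup>2" .
  with xy show ?thesis
    unfolding nrm_def[of "x + y"] using nrm_nonneg by (intro real_le_lsqrt) auto
qed

lemma nrm_triangle_diff:
  "x \<in> V \<Longrightarrow> y \<in> V \<Longrightarrow> z \<in> V \<Longrightarrow> nrm (x - z) \<le> nrm (x - y) + nrm (y - z)"
  using nrm_triangle[of "x - y" "y - z"] by simp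

lemma nrm_reverse_triangle: "x \<in> V \<Longrightarrow> y \<in> V \<Longrightarrow> \<bar>nrm x - nrm y\<bar> \<le> nrm (x - y)"
  using nrm_triangle[of "x - y" y] nrm_triangle[of "y - x" x] nrm_diff_commute[of x y] by simp

lemma tendsto_nrm:
  assumes "\<And>n. s n \<in> V" "l \<in> V" "(\<lambda>n. nrm (s n - l)) \<longlonglongrightarrow> 0"
  shows "(\<lambda>n. nrm (s n)) \<longlonglongrightarrow> nrm l"
proof -
  have "(\<lambda>n. nrm (s n) - nrm l) \<longlonglongrightarrow> 0"
    using assms by (intro Lim_null_comparison[OF _ assms(3)] always_eventually)
      (auto simp: nrm_reverse_triangle)
  then show ?thesis by (simp add: LIM_zero_iff)
qed

lemma Cauchy_seq_bounded:
  assumes "Cauchy_seq s"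
  obtains B where "0 < B" "\<And>n. nrm (s n) \<le> B"
proof -
  have V: "s n \<in> V" for n using assms by (simp add: Cauchy_seq_def)
  obtain N where N: "\<And>n. N \<le> n \<Longrightarrow> nrm (s n - s N) < 1"
    using assms unfolding Cauchy_seq_def by (meson order_refl zero_less_one)
  define B where "B = 1 + nrm (s N) + (\<Sum>n<N. nrm (s n))"
  have nn: "0 \<le> (\<Sum>n<N. nrm (s n))" using V by (intro sum_nonneg nrm_nonneg)
  have "nrm (s n) \<le> B" for n
  proof (cases "n < N")
    case True
    then have "nrm (s n) \<le> (\<Sum>n<N. nrm (s n))"
      using V by (intro member_le_sum nrm_nonneg) auto
    then show ?thesis using nrm_nonneg[OF V[of N]] by (simp add: B_def)
  next
    case False
    then show ?thesis
      using N[of n] nrm_triangle[of "s n - s N" "s N"] V nn by (simp add: B_def)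
  qed
  moreover have "0 < B" using nn nrm_nonneg[OF V[of N]] by (simp add: B_def)
  ultimately show ?thesis using that by blast
qed

lemma Cauchy_seq_mem: "Cauchy_seq s \<Longrightarrow> s n \<in> V"
  by (simp add: Cauchy_seq_def)

lemma Cauchy_seq_const: "x \<in> V \<Longrightarrow> Cauchy_seq (\<lambda>_. x)"
  by (simp add: Cauchy_seq_def nrm_def nrm2_def ip_zero_left)

lemma nrm_scale: "x \<in> V \<Longrightarrow> nrm (scale a x) = cmod a * nrm x"
  by (simp add: nrm_def nrm2_scale real_sqrt_mult)

lemma Cauchy_seq_lincomb:
  assumes "Cauchy_seq s" "Cauchy_seq t"
  shows "Cauchy_seq (\<lambda>n. scale a (s n) + t n)"
  unfolding Cauchy_seq_def
proof (intro conjI allI impI)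
  fix e :: real assume "0 < e"
  define d where "d = e / 2"
  have e: "0 < d / (cmod a + 1)" "0 < d" using \<open>0 < e\<close> by (simp_all add: d_def add_nonneg_pos)
  have V: "s n \<in> V" "t n \<in> V" for n using assms by (simp_all add: Cauchy_seq_def)
  obtain N where N: "\<And>m n. N \<le> m \<Longrightarrow> N \<le> n \<Longrightarrow> nrm (s m - s n) < d / (cmod a + 1)"
    using assms(1) e unfolding Cauchy_seq_def by meson
  obtain N' where N': "\<And>m n. N' \<le> m \<Longrightarrow> N' \<le> n \<Longrightarrow> nrm (t m - t n) < d"
    using assms(2) e unfolding Cauchy_seq_def by meson
  have "nrm (scale a (s m) + t m - (scale a (s n) + t n)) < e" if "max N N' \<le> m" "max N N' \<le> n" for m n
  proof -
    have eq: "scale a (s m) + t m - (scale a (s n) + t n) = scale a (s m - s n) + (t m - t n)"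
      by (simp add: scale_right_diff_distrib)
    have "nrm (scale a (s m) + t m - (scale a (s n) + t n)) \<le> cmod a * nrm (s m - s n) + nrm (t m - t n)"
      unfolding eq using nrm_triangle[of "scale a (s m - s n)" "t m - t n"] V by (simp add: nrm_scale)
    also have "\<dots> \<le> (cmod a + 1) * nrm (s m - s n) + nrm (t m - t n)"
      using V by (intro add_right_mono mult_right_mono nrm_nonneg) auto
    also have "\<dots> < d + d"
      using N[of m n] N'[of m n] that
      by (intro add_strict_mono) (auto simp: pos_less_divide_eq add_nonneg_pos mult.commute)
    finally show ?thesis by (simp add: d_def)
  qed
  then show "\<exists>N. \<forall>m\<ge>N. \<forall>n\<ge>N. nrm (scale a (s m) + t m - (scale a (s n) + t n)) < e" by blast
qed (use assms in \<open>auto simp: Cauchy_seq_def\<close>)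

lemma Cauchy_seq_add: "Cauchy_seq s \<Longrightarrow> Cauchy_seq t \<Longrightarrow> Cauchy_seq (\<lambda>n. s n + t n)"
  using Cauchy_seq_lincomb[of s t 1] by simp

lemma Cauchy_seq_scale: "Cauchy_seq s \<Longrightarrow> Cauchy_seq (\<lambda>n. scale a (s n))"
  using Cauchy_seq_lincomb[of s "\<lambda>_. 0" a] Cauchy_seq_const[of 0] by simp

lemma Cauchy_seq_diff: "Cauchy_seq s \<Longrightarrow> Cauchy_seq t \<Longrightarrow> Cauchy_seq (\<lambda>n. s n - t n)"
  using Cauchy_seq_lincomb[of t s "-1"] by simp

lemma Cauchy_seq_ip_convergent:
  assumes "Cauchy_seq s" "Cauchy_seq t"
  shows "convergent (\<lambda>n. ip (s n) (t n))"
proof -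
  have V: "s n \<in> V" "t n \<in> V" for n using assms by (simp_all add: Cauchy_seq_def)
  obtain A where A: "0 < A" "\<And>n. nrm (s n) \<le> A" using Cauchy_seq_bounded[OF assms(1)] by blast
  obtain B where B: "0 < B" "\<And>n. nrm (t n) \<le> B" using Cauchy_seq_bounded[OF assms(2)] by blast
  have "Cauchy (\<lambda>n. ip (s n) (t n))"
    unfolding Cauchy_def dist_norm
  proof (intro allI impI)
    fix e :: real assume "0 < e"
    then have e: "0 < e / (2 * B)" "0 < e / (2 * A)" using A B by auto
    obtain N where N: "\<And>m n. N \<le> m \<Longrightarrow> N \<le> n \<Longrightarrow> nrm (s m - s n) < e / (2 * B)"
      using assms(1) e unfolding Cauchy_seq_def by meson
    obtain N' where N': "\<And>m n. N' \<le> m \<Longrightarrow> N' \<le> n \<Longrightarrow> nrm (t m - t n) < e / (2 * A)"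
      using assms(2) e unfolding Cauchy_seq_def by meson
    have "cmod (ip (s m) (t m) - ip (s n) (t n)) < e" if "max N N' \<le> m" "max N N' \<le> n" for m n
    proof -
      have "ip (s m) (t m) - ip (s n) (t n) = ip (s m - s n) (t m) + ip (s n) (t m - t n)"
        using V by (simp add: ip_diff_left ip_diff_right)
      then have "cmod (ip (s m) (t m) - ip (s n) (t n)) \<le>
          nrm (s m - s n) * nrm (t m) + nrm (s n) * nrm (t m - t n)"
        using cmod_ip_le[of "s m - s n" "t m"] cmod_ip_le[of "s n" "t m - t n"] V
        by (metis (no_types, lifting) add_mono mem_V(3) norm_triangle_le)
      also have "\<dots> \<le> nrm (s m - s n) * B + A * nrm (t m - t n)"
        using A B V by (intro add_mono mult_mono nrm_nonneg) (auto intro: less_imp_le)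
      also have "\<dots> < e / (2 * B) * B + A * (e / (2 * A))"
        using N[of m n] N'[of m n] that A(1) B(1)
        by (intro add_strict_mono mult_strict_right_mono mult_strict_left_mono) auto
      also have "\<dots> = e" using A(1) B(1) by simp
      finally show ?thesis .
    qed
    then show "\<exists>M. \<forall>m\<ge>M. \<forall>n\<ge>M. cmod (ip (s m) (t m) - ip (s n) (t n)) < e" by blast
  qed
  then show ?thesis by (rule Cauchy_convergent)
qed

text \<open>Since \<open>s\<close> is bounded, \<open>t n\<close> may be replaced by one fixed
  \<open>t N\<close>, so weak convergence to zero suffices. In \<open>moore_aronszajn\<close> this
  shows that the inner product does not depend on the representing sequences.\<close>

lemma Cauchy_seq_ip_null:
  assumes "Cauchy_seq s" "Cauchy_seq t" and null: "\<And>w. w \<in> V \<Longrightarrow> (\<lambda>n. ip (s n) w) \<longlonglongrightarrow> 0"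
  shows "(\<lambda>n. ip (s n) (t n)) \<longlonglongrightarrow> 0"
proof (rule LIMSEQ_I)
  fix e :: real assume "0 < e"
  have V: "s n \<in> V" "t n \<in> V" for n using assms by (simp_all add: Cauchy_seq_def)
  obtain A where A: "0 < A" "\<And>n. nrm (s n) \<le> A" using Cauchy_seq_bounded[OF assms(1)] by blast
  have e: "0 < e / (2 * A)" "0 < e / 2" using A \<open>0 < e\<close> by auto
  obtain N where N: "\<And>m n. N \<le> m \<Longrightarrow> N \<le> n \<Longrightarrow> nrm (t m - t n) < e / (2 * A)"
    using assms(2) e unfolding Cauchy_seq_def by meson
  obtain N' where N': "\<And>n. N' \<le> n \<Longrightarrow> cmod (ip (s n) (t N)) < e / 2"
    using LIMSEQ_D[OF null[OF V(2)[of N]] e(2)] by auto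
  have "cmod (ip (s n) (t n)) < e" if "max N N' \<le> n" for n
  proof -
    have "ip (s n) (t n) = ip (s n) (t n - t N) + ip (s n) (t N)"
      using V by (simp add: ip_diff_right)
    then have "cmod (ip (s n) (t n)) \<le> nrm (s n) * nrm (t n - t N) + cmod (ip (s n) (t N))"
      using cmod_ip_le[of "s n" "t n - t N"] V by (metis add_right_mono mem_V(3) norm_triangle_le)
    also have "\<dots> \<le> A * nrm (t n - t N) + cmod (ip (s n) (t N))"
      using A V by (intro add_mono mult_mono nrm_nonneg) (auto intro: less_imp_le)
    also have "\<dots> < A * (e / (2 * A)) + e / 2"
      using N[of n N] N'[of n] that A(1) by (intro add_strict_mono mult_strict_left_mono) auto
    also have "\<dots> = e" using A(1) by simp
    finally show ?thesis .
  qed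
  then show "\<exists>no. \<forall>n\<ge>no. cmod (ip (s n) (t n) - 0) < e"
    by (intro exI[of _ "max N N'"]) auto
qed

end

locale hspace = semi_ip +
  assumes definite: "x \<in> V \<Longrightarrow> ip x x = 0 \<Longrightarrow> x = 0"
    and complete: "Cauchy_seq s \<Longrightarrow> \<exists>l\<in>V. (\<lambda>n. nrm (s n - l)) \<longlonglongrightarrow> 0"

text \<open>
  The contraction \<open>C\<close>, defined on the subspace \<open>M\<close> of a semi-inner product space, extends to \<open>w0\<close> by
  the limit of its values along a sequence of points of \<open>M\<close> that minimizes the distance to \<open>w0\<close>.
\<close>

lemma (in hspace) contraction_extension:
  assumes W: "semi_ip scaleW VW ipW" and M: "M \<subseteq> VW" "module.subspace scaleW M" and w0: "w0 \<in> VW"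
    and C: "\<And>m. m \<in> M \<Longrightarrow> C m \<in> V"
    and C_add: "\<And>m m'. m \<in> M \<Longrightarrow> m' \<in> M \<Longrightarrow> C (m + m') = C m + C m'"
    and C_scale: "\<And>a m. m \<in> M \<Longrightarrow> C (scaleW a m) = scale a (C m)"
    and contr: "\<And>m. m \<in> M \<Longrightarrow> nrm2 (C m) \<le> semi_ip.nrm2 ipW m"
  obtains y0 where "y0 \<in> V"
    "\<And>m a. m \<in> M \<Longrightarrow> nrm2 (C m + scale a y0) \<le> semi_ip.nrm2 ipW (m + scaleW a w0)"
proof -
  interpret W: semi_ip scaleW VW ipW by fact
  have MV: "m \<in> VW" if "m \<in> M" for m using that M by auto
  have M_mem: "0 \<in> M" "\<And>m m'. m \<in> M \<Longrightarrow> m' \<in> M \<Longrightarrow> m + m' \<in> M"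
    "\<And>m m'. m \<in> M \<Longrightarrow> m' \<in> M \<Longrightarrow> m - m' \<in> M" "\<And>a m. m \<in> M \<Longrightarrow> scaleW a m \<in> M"
    using M(2) by (auto simp: W.subspace_0 W.subspace_add W.subspace_diff W.subspace_scale)
  have C_diff: "C (m - m') = C m - C m'" if "m \<in> M" "m' \<in> M" for m m'
    using C_add[of "m - m'" m'] that M_mem by simp
  define d where "d = (INF m\<in>M. W.nrm2 (w0 - m))"
  have bdd: "bdd_below ((\<lambda>m. W.nrm2 (w0 - m)) ` M)"
    using w0 MV by (intro bdd_belowI2[of _ 0]) (auto intro!: W.nrm2_nonneg)
  have d_le: "d \<le> W.nrm2 (w0 - m)" if "m \<in> M" for m
    unfolding d_def using that bdd by (rule cINF_lower[rotated])
  have "\<exists>m\<in>M. W.nrm2 (w0 - m) < d + 1 / Suc n" for n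
  proof -
    have "d < d + 1 / Suc n" by simp
    then show ?thesis
      using cINF_less_iff[OF _ bdd, of "d + 1 / Suc n"] M_mem(1) unfolding d_def by auto
  qed
  then obtain m where mM: "\<And>n. m n \<in> M" and m: "\<And>n. W.nrm2 (w0 - m n) < d + 1 / Suc n"
    by metis
  have mV: "m n \<in> VW" for n using mM MV by blast
  \<comment> \<open>Parallelogram law: the midpoint of \<open>m i\<close> and \<open>m j\<close> is
    in \<open>M\<close>, hence at squared distance at least \<open>d\<close> from
    \<open>w0\<close>.\<close>
  have par: "W.nrm2 (m i - m j) \<le> 2 / Suc i + 2 / Suc j" for i j
  proof -
    define p q where "p = w0 - m i" and "q = w0 - m j"
    have pq: "p \<in> VW" "q \<in> VW" using w0 mV by (auto simp: p_def q_def)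
    have "4 * d \<le> 4 * W.nrm2 (w0 - scaleW (1/2) (m i + m j))"
      using d_le[of "scaleW (1/2) (m i + m j)"] mM M_mem by simp
    also have "w0 - scaleW (1/2) (m i + m j) = scaleW (1/2) (p + q)"
    proof -
      have "scaleW (1/2) (p + q) = scaleW (1/2 + 1/2) w0 - scaleW (1/2) (m i + m j)"
        unfolding p_def q_def W.scale_left_distrib W.scale_right_diff_distrib W.scale_right_distrib
        by simp
      then show ?thesis by simp
    qed
    also have "4 * W.nrm2 (scaleW (1/2) (p + q)) = W.nrm2 (p + q)"
      using pq by (simp add: W.nrm2_scale power2_eq_square)
    finally have "4 * d \<le> W.nrm2 (p + q)" .
    moreover have "W.nrm2 (p + q) + W.nrm2 (q - p) = 2 * W.nrm2 p + 2 * W.nrm2 q"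
      using pq W.ip_commute[of q p] by (simp add: W.nrm2_add W.nrm2_diff)
    moreover have "q - p = m i - m j" by (simp add: p_def q_def)
    ultimately show ?thesis
      using m[of i] m[of j] by (simp add: p_def q_def)
  qed
  \<comment> \<open>The sequence \<open>m\<close> itself need not converge, as its space need not be
    complete; its images under \<open>C\<close> do.\<close>
  have "Cauchy_seq (\<lambda>n. C (m n))"
    unfolding Cauchy_seq_def
  proof (intro conjI allI impI)
    fix e :: real assume e: "0 < e"
    obtain N :: nat where N: "4 / e\<^sup>2 < real N" using reals_Archimedean2 by blast
    have "nrm (C (m i) - C (m j)) < e" if "N \<le> i" "N \<le> j" for i j
    proof -
      have "0 < real N" using N e by (smt (verit) divide_pos_pos zero_less_power)
      have "nrm2 (C (m i) - C (m j)) \<le> W.nrm2 (m i - m j)"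
        using contr[of "m i - m j"] mM M_mem by (simp add: C_diff)
      also have "\<dots> \<le> 2 / Suc i + 2 / Suc j" by (rule par)
      also have "\<dots> \<le> 2 / real N + 2 / real N"
        using that \<open>0 < real N\<close> by (intro add_mono divide_left_mono) auto
      also have "\<dots> < e\<^sup>2"
        using N e \<open>0 < real N\<close> by (simp add: field_simps)
      finally show ?thesis
        unfolding nrm_def using e by (intro real_less_lsqrt) auto
    qed
    then show "\<exists>N. \<forall>i\<ge>N. \<forall>j\<ge>N. nrm (C (m i) - C (m j)) < e" by blast
  qed (use C mM in auto)
  then obtain y0 where y0: "y0 \<in> V" and lim: "(\<lambda>n. nrm (C (m n) - y0)) \<longlonglongrightarrow> 0"
    using complete by blast
  have main: "nrm2 (C m' + y0) \<le> W.nrm2 (m' + w0)" if m': "m' \<in> M" for m'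
  proof -
    define x where "x n = W.nrm2 (m' + m n)" for n
    have m'V: "m' \<in> VW" using m' MV by blast
    \<comment> \<open>Compare \<open>m n\<close> with the point \<open>m n\<close> minus
      \<open>t\<close> times \<open>u\<close> of \<open>M\<close>: near-minimality makes
      \<open>w0 - m n\<close> almost orthogonal to \<open>u\<close>.\<close>
    have x: "(1 - t) * x n \<le> W.nrm2 (m' + w0) + 1 / Suc n / t" if t: "0 < t" for t n
    proof -
      define e u where "e = w0 - m n" and "u = m' + m n"
      have eu: "e \<in> VW" "u \<in> VW" "u \<in> M"
        using w0 mV m'V mM m' M_mem by (auto simp: e_def u_def)
      have "d \<le> W.nrm2 (w0 - (m n - scaleW (of_real t) u))"
        using eu mM M_mem by (intro d_le) auto
      also have "w0 - (m n - scaleW (of_real t) u) = e + scaleW (of_real t) u"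
        by (simp add: e_def)
      also have "W.nrm2 (e + scaleW (of_real t) u) = W.nrm2 e + t\<^sup>2 * x n + 2 * t * Re (ipW e u)"
        using eu by (simp add: W.nrm2_add W.nrm2_scale W.ip_scale_right x_def u_def)
      finally have "- 2 * t * Re (ipW e u) \<le> 1 / Suc n + t\<^sup>2 * x n"
        using m[of n] by (simp add: e_def)
      then have "t * (- 2 * Re (ipW e u)) \<le> t * (1 / Suc n / t + t * x n)"
      proof -
        have "t * (1 / Suc n / t + t * x n) = 1 / Suc n + t\<^sup>2 * x n"
          using t by (simp add: distrib_left power2_eq_square del: of_nat_Suc)
        then show ?thesis
          using \<open>- 2 * t * Re (ipW e u) \<le> 1 / Suc n + t\<^sup>2 * x n\<close> by simp
      qed
      then have 1: "- 2 * Re (ipW e u) \<le> 1 / Suc n / t + t * x n"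
        using t by (simp only: mult_le_cancel_left_pos)
      have "W.nrm2 (m' + w0) = W.nrm2 e + x n + 2 * Re (ipW e u)"
        using W.nrm2_add[OF eu(1,2)] by (simp add: e_def u_def x_def add.commute)
      then show ?thesis
        using 1 W.nrm2_nonneg[OF eu(1)] by (simp add: algebra_simps)
    qed
    have lim': "(\<lambda>n. nrm2 (C m' + C (m n))) \<longlonglongrightarrow> nrm2 (C m' + y0)"
    proof -
      have "(\<lambda>n. nrm (C m' + C (m n))) \<longlonglongrightarrow> nrm (C m' + y0)"
        using lim C m' mM y0 by (intro tendsto_nrm) (auto simp: algebra_simps)
      then have "(\<lambda>n. (nrm (C m' + C (m n)))\<^sup>2) \<longlonglongrightarrow> (nrm (C m' + y0))\<^sup>2"
        by (rule tendsto_power)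
      then show ?thesis using C m' mM y0 by (simp add: nrm_sq)
    qed
    have t: "(1 - t) * nrm2 (C m' + y0) \<le> W.nrm2 (m' + w0)" if "0 < t" "t < 1" for t
    proof (rule LIMSEQ_le)
      show "(\<lambda>n. (1 - t) * nrm2 (C m' + C (m n))) \<longlonglongrightarrow> (1 - t) * nrm2 (C m' + y0)"
        by (intro tendsto_intros lim')
      have "(\<lambda>n. W.nrm2 (m' + w0) + 1 / Suc n * (1 / t)) \<longlonglongrightarrow> W.nrm2 (m' + w0) + 0 * (1 / t)"
        by (intro tendsto_intros LIMSEQ_inverse_real_of_nat[unfolded inverse_eq_divide])
      then show "(\<lambda>n. W.nrm2 (m' + w0) + 1 / Suc n / t) \<longlonglongrightarrow> W.nrm2 (m' + w0)"
        by simp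
      have "(1 - t) * nrm2 (C m' + C (m n)) \<le> W.nrm2 (m' + w0) + 1 / Suc n / t" for n
      proof -
        have "(1 - t) * nrm2 (C m' + C (m n)) \<le> (1 - t) * x n"
          using contr[of "m' + m n"] m' mM M_mem that
          by (intro mult_left_mono) (auto simp: C_add x_def)
        then show ?thesis using x[OF that(1), of n] by linarith
      qed
      then show "\<exists>N. \<forall>n\<ge>N. (1 - t) * nrm2 (C m' + C (m n)) \<le> W.nrm2 (m' + w0) + 1 / Suc n / t"
        by blast
    qed
    show ?thesis
    proof (rule LIMSEQ_le_const2)
      \<comment> \<open>The shift by two keeps the parameter \<open>1 / Suc (Suc n)\<close> strictly
        below 1 even at \<open>n = 0\<close>.\<close>
      have "(\<lambda>n. (1 - 1 / Suc (Suc n)) * nrm2 (C m' + y0)) \<longlonglongrightarrow> (1 - 0) * nrm2 (C m' + y0)"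
        by (intro tendsto_intros LIMSEQ_Suc[OF LIMSEQ_inverse_real_of_nat[unfolded inverse_eq_divide]])
      then show "(\<lambda>n. (1 - 1 / Suc (Suc n)) * nrm2 (C m' + y0)) \<longlonglongrightarrow> nrm2 (C m' + y0)" by simp
      show "\<exists>N. \<forall>n\<ge>N. (1 - 1 / Suc (Suc n)) * nrm2 (C m' + y0) \<le> W.nrm2 (m' + w0)"
        by (intro exI allI impI t) auto
    qed
  qed
  have "nrm2 (C m' + scale a y0) \<le> W.nrm2 (m' + scaleW a w0)" if m': "m' \<in> M" for m' a
  proof (cases "a = 0")
    case True
    then show ?thesis using contr[OF m'] by simp
  next
    case False
    define u where "u = scaleW (1 / a) m'"
    have u: "u \<in> M" "u \<in> VW" using m' M_mem MV by (auto simp: u_def)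
    have "m' = scaleW a u" using False by (simp add: u_def)
    then have "C m' + scale a y0 = scale a (C u + y0)" "m' + scaleW a w0 = scaleW a (u + w0)"
      using u by (auto simp: C_scale scale_right_distrib W.scale_right_distrib)
    then show ?thesis
      using main[OF u(1)] u w0 y0 C[OF u(1)] by (simp add: nrm2_scale W.nrm2_scale mult_left_mono)
  qed
  then show ?thesis using that y0 by blast
qed

section \<open>Extending families of vectors\<close>

text \<open>The vectors appear in the order \<open>ip (y j) (y i)\<close> since \<open>qform\<close>
  conjugates the coefficient of its first index and \<open>ip\<close> that of its second
  argument.\<close>

lemma (in semi_ip) qform_gram:
  assumes "\<And>i. i \<in> X \<Longrightarrow> y i \<in> V"
  shows "qform X (\<lambda>i j. ip (y j) (y i)) c = of_real (nrm2 (\<Sum>i\<in>X. scale (c i) (y i)))"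
proof -
  let ?s = "\<Sum>i\<in>X. scale (c i) (y i)"
  have V: "scale (c i) (y i) \<in> V" if "i \<in> X" for i using assms that by auto
  have "ip ?s ?s = (\<Sum>i\<in>X. ip ?s (scale (c i) (y i)))"
    using V by (intro ip_sum_right) (auto simp: sum_mem)
  also have "\<dots> = (\<Sum>i\<in>X. \<Sum>j\<in>X. ip (scale (c j) (y j)) (scale (c i) (y i)))"
    using V by (intro sum.cong refl ip_sum_left) auto
  also have "\<dots> = qform X (\<lambda>i j. ip (y j) (y i)) c"
    unfolding qform_def using assms
    by (intro sum.cong refl) (simp add: ip_scale_left ip_scale_right)
  finally show ?thesis
    using ip_self[of ?s] assms by (simp add: sum_mem)
qed

lemma (in semi_ip) kernel_on_gram:
  assumes "\<And>i. i \<in> S \<Longrightarrow> y i \<in> V"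
  shows "kernel_on S (\<lambda>i j. ip (y j) (y i))"
  unfolding kernel_on_def psd_iff_qform
proof (intro allI impI)
  fix X c assume "finite X \<and> X \<subseteq> S"
  then have X: "y i \<in> V" if "i \<in> X" for i using that assms by auto
  show "0 \<le> Re (qform X (\<lambda>i j. ip (y j) (y i)) c) \<and> Im (qform X (\<lambda>i j. ip (y j) (y i)) c) = 0"
    using X by (simp add: qform_gram nrm2_nonneg sum_mem)
qed

section \<open>Coefficient vectors of finite support, and extension by one vector\<close>

definition fsupp :: "'i set \<Rightarrow> ('i \<Rightarrow> complex) set"
  where "fsupp S = {c. finite {i. c i \<noteq> 0} \<and> {i. c i \<noteq> 0} \<subseteq> S}"

definition cscale :: "complex \<Rightarrow> ('i \<Rightarrow> complex) \<Rightarrow> 'i \<Rightarrow> complex"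
  where "cscale a c = (\<lambda>i. a * c i)"

text \<open>The inner product of the formal combinations of kernel functions with coefficients
  \<open>c\<close> and \<open>d\<close>. It may be degenerate, which is why the domain in
  \<open>contraction_extension\<close> is only a semi-inner product space.\<close>

definition kernel_ip :: "('i \<Rightarrow> 'i \<Rightarrow> complex) \<Rightarrow> ('i \<Rightarrow> complex) \<Rightarrow> ('i \<Rightarrow> complex) \<Rightarrow> complex"
  where "kernel_ip K c d = (\<Sum>i | d i \<noteq> 0. \<Sum>j | c j \<noteq> 0. cnj (d i) * K i j * c j)"

lemma kernel_ip_on:
  assumes "finite X" "{i. c i \<noteq> 0} \<subseteq> X" "{i. d i \<noteq> 0} \<subseteq> X"
  shows "kernel_ip K c d = (\<Sum>i\<in>X. \<Sum>j\<in>X. cnj (d i) * K i j * c j)"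
proof -
  have "(\<Sum>j | c j \<noteq> 0. cnj (d i) * K i j * c j) = (\<Sum>j\<in>X. cnj (d i) * K i j * c j)" for i
    using assms by (intro sum.mono_neutral_left) auto
  then have "kernel_ip K c d = (\<Sum>i | d i \<noteq> 0. \<Sum>j\<in>X. cnj (d i) * K i j * c j)"
    by (simp add: kernel_ip_def)
  also have "\<dots> = (\<Sum>i\<in>X. \<Sum>j\<in>X. cnj (d i) * K i j * c j)"
    using assms by (intro sum.mono_neutral_left) auto
  finally show ?thesis .
qed

lemma kernel_ip_self: "finite X \<Longrightarrow> {i. c i \<noteq> 0} \<subseteq> X \<Longrightarrow> kernel_ip K c c = qform X K c"
  by (simp add: kernel_ip_on qform_def)

lemma vector_space_cscale: "vector_space cscale"
  by unfold_locales (auto simp: cscale_def fun_eq_iff algebra_simps)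

lemma subspace_fsupp: "module.subspace cscale (fsupp S)"
proof -
  interpret vector_space cscale by (rule vector_space_cscale)
  show ?thesis
  proof (rule subspaceI)
    fix c d assume "c \<in> fsupp S" "d \<in> fsupp S"
    then show "c + d \<in> fsupp S"
    proof -
      have "{i. (c + d) i \<noteq> 0} \<subseteq> {i. c i \<noteq> 0} \<union> {i. d i \<noteq> 0}" by auto
      then show ?thesis
        using \<open>c \<in> fsupp S\<close> \<open>d \<in> fsupp S\<close> unfolding fsupp_def mem_Collect_eq
        by (meson finite_Un finite_subset le_sup_iff order_trans)
    qed
  next
    fix a c assume "c \<in> fsupp S"
    then show "cscale a c \<in> fsupp S"
      unfolding fsupp_def cscale_def by (auto intro: finite_subset[where B = "{i. c i \<noteq> 0}"])
  qed (simp add: fsupp_def)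
qed

lemma semi_ip_fsupp:
  assumes "kernel_on S K"
  shows "semi_ip cscale (fsupp S) (kernel_ip K)"
proof -
  interpret vector_space cscale by (rule vector_space_cscale)
  show ?thesis
  proof
    show "subspace (fsupp S)" by (rule subspace_fsupp)
  next
    fix c d e :: "'a \<Rightarrow> complex" assume "c \<in> fsupp S" "d \<in> fsupp S" "e \<in> fsupp S"
    define X where "X = {i. c i \<noteq> 0} \<union> {i. d i \<noteq> 0} \<union> {i. e i \<noteq> 0}"
    have fin: "finite X" using \<open>c \<in> _\<close> \<open>d \<in> _\<close> \<open>e \<in> _\<close> by (simp add: X_def fsupp_def)
    have "kernel_ip K b e = (\<Sum>i\<in>X. \<Sum>j\<in>X. cnj (e i) * K i j * b j)" if "b \<in> {c, d, c + d}" for b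
      using that by (intro kernel_ip_on[OF fin]) (auto simp: X_def)
    then show "kernel_ip K (c + d) e = kernel_ip K c e + kernel_ip K d e"
      by (simp add: distrib_left sum.distrib)
  next
    fix a and c d :: "'a \<Rightarrow> complex" assume "c \<in> fsupp S" "d \<in> fsupp S"
    define X where "X = {i. c i \<noteq> 0} \<union> {i. d i \<noteq> 0}"
    have fin: "finite X" using \<open>c \<in> _\<close> \<open>d \<in> _\<close> by (simp add: X_def fsupp_def)
    have "kernel_ip K b d = (\<Sum>i\<in>X. \<Sum>j\<in>X. cnj (d i) * K i j * b j)" if "b \<in> {c, cscale a c}" for b
      using that by (intro kernel_ip_on[OF fin]) (auto simp: X_def cscale_def)
    then show "kernel_ip K (cscale a c) d = a * kernel_ip K c d"
      by (simp add: sum_distrib_left cscale_def mult_ac)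
  next
    fix c d :: "'a \<Rightarrow> complex" assume "c \<in> fsupp S" "d \<in> fsupp S"
    define X where "X = {i. c i \<noteq> 0} \<union> {i. d i \<noteq> 0}"
    have X: "finite X" "X \<subseteq> S" using \<open>c \<in> _\<close> \<open>d \<in> _\<close> by (auto simp: X_def fsupp_def)
    then have "kernel_ip K d c = (\<Sum>i\<in>X. \<Sum>j\<in>X. cnj (c i) * K i j * d j)"
      by (intro kernel_ip_on) (auto simp: X_def)
    then have "cnj (kernel_ip K d c) = (\<Sum>i\<in>X. \<Sum>j\<in>X. cnj (d j) * cnj (K i j) * c i)"
      by (simp add: mult_ac)
    also have "\<dots> = (\<Sum>i\<in>X. \<Sum>j\<in>X. cnj (d j) * K j i * c i)"
      using X kernel_on_hermitian[OF assms]
      by (intro sum.cong refl arg_cong2[where f = "(*)"]) (metis subsetD)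
    also have "\<dots> = (\<Sum>i\<in>X. \<Sum>j\<in>X. cnj (d i) * K i j * c j)"
      by (rule sum.swap)
    also have "\<dots> = kernel_ip K c d"
      using X by (intro kernel_ip_on[symmetric]) (auto simp: X_def)
    finally show "kernel_ip K c d = cnj (kernel_ip K d c)" by simp
  next
    fix c :: "'a \<Rightarrow> complex" assume "c \<in> fsupp S"
    then have X: "finite {i. c i \<noteq> 0}" "{i. c i \<noteq> 0} \<subseteq> S" by (auto simp: fsupp_def)
    then show "0 \<le> Re (kernel_ip K c c)"
      using kernel_onD[OF assms X] by (simp add: kernel_ip_self psd_iff_qform)
  qed
qed

text \<open>That \<open>Q\<close> dominates the Gram matrix of \<open>y\<close> means that sending
  the unit vector at \<open>r\<close> to \<open>y r\<close> is contractive for the form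
  \<open>Q\<close>. The vector \<open>y0\<close> is the value of the extended contraction at the
  unit vector of \<open>z\<close>.\<close>

lemma (in hspace) extend_family:
  assumes Q: "kernel_on (insert z R) Q" and z: "z \<notin> R" and y: "\<And>r. r \<in> R \<Longrightarrow> y r \<in> V"
    and dom: "kernel_on R (\<lambda>i j. Q i j - ip (y j) (y i))"
  obtains y0 where "y0 \<in> V"
    "kernel_on (insert z R) (\<lambda>i j. Q i j - ip ((y(z := y0)) j) ((y(z := y0)) i))"
proof -
  interpret W: semi_ip cscale "fsupp (insert z R)" "kernel_ip Q"
    by (rule semi_ip_fsupp[OF Q])
  define C where "C c = (\<Sum>i | c i \<noteq> 0. scale (c i) (y i))" for c
  have C_on: "C c = (\<Sum>i\<in>X. scale (c i) (y i))" if "finite X" "{i. c i \<noteq> 0} \<subseteq> X" for c X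
    unfolding C_def using that by (intro sum.mono_neutral_left) auto
  define u :: "'b \<Rightarrow> complex" where "u i = of_bool (i = z)" for i
  have u: "u \<in> fsupp (insert z R)" by (simp add: fsupp_def u_def)
  have contr: "nrm2 (C c) \<le> W.nrm2 c" if "c \<in> fsupp R" for c
  proof -
    define X where "X = {i. c i \<noteq> 0}"
    have X: "finite X" "X \<subseteq> R" using that by (auto simp: X_def fsupp_def)
    have yX: "y i \<in> V" if "i \<in> X" for i using that X y by auto
    have "0 \<le> Re (qform X (\<lambda>i j. Q i j - ip (y j) (y i)) c)"
      using kernel_onD[OF dom X] unfolding psd_iff_qform by blast
    also have "\<dots> = W.nrm2 c - nrm2 (C c)"
      unfolding qform_diff using X(1) qform_gram[of X y c] yX
      by (simp add: W.nrm2_def kernel_ip_self[of X c] C_on[of X c] X_def[symmetric])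
    finally show ?thesis by simp
  qed
  obtain y0 where y0: "y0 \<in> V" and le: "\<And>c a. c \<in> fsupp R \<Longrightarrow>
      nrm2 (C c + scale a y0) \<le> W.nrm2 (c + cscale a u)"
  proof (rule contraction_extension[OF W.semi_ip_axioms, of "fsupp R" u C])
    show "fsupp R \<subseteq> fsupp (insert z R)" by (auto simp: fsupp_def)
    show "W.subspace (fsupp R)" by (rule subspace_fsupp)
    fix c d :: "'b \<Rightarrow> complex" and a assume c: "c \<in> fsupp R"
    then show "C c \<in> V" unfolding C_def by (intro sum_mem mem_V y) (auto simp: fsupp_def)
    have fin: "finite {i. c i \<noteq> 0}" using c by (simp add: fsupp_def)
    then have "C (cscale a c) = (\<Sum>i | c i \<noteq> 0. scale (a * c i) (y i))"
      by (subst C_on[of "{i. c i \<noteq> 0}"]) (auto simp: cscale_def)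
    then show "C (cscale a c) = scale a (C c)"
      by (simp add: C_def scale_sum_right)
    show "nrm2 (C c) \<le> W.nrm2 c" by (rule contr[OF c])
    assume "d \<in> fsupp R"
    then have X: "finite ({i. c i \<noteq> 0} \<union> {i. d i \<noteq> 0})" using c by (simp add: fsupp_def)
    have "{i. (c + d) i \<noteq> 0} \<subseteq> {i. c i \<noteq> 0} \<union> {i. d i \<noteq> 0}" by auto
    then show "C (c + d) = C c + C d"
      using C_on[OF X, of c] C_on[OF X, of d] C_on[OF X, of "c + d"]
      by (simp add: scale_left_distrib sum.distrib)
  qed (use u in auto)
  define y' where "y' = y(z := y0)"
  have y'V: "y' i \<in> V" if "i \<in> insert z R" for i using that y y0 by (auto simp: y'_def)
  have "kernel_on (insert z R) (\<lambda>i j. Q i j - ip (y' j) (y' i))"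
    unfolding kernel_on_def
  proof (intro allI impI)
    fix X assume "finite X \<and> X \<subseteq> insert z R"
    then have X: "finite X" "X \<subseteq> insert z R" by auto
    \<comment> \<open>With \<open>z\<close> included, each coefficient vector is one supported in
      \<open>R\<close> plus a multiple of \<open>u\<close>.\<close>
    define Y where "Y = insert z X"
    have Y: "finite Y" "Y \<subseteq> insert z R" "X \<subseteq> Y" using X by (auto simp: Y_def)
    have yY: "y' i \<in> V" if "i \<in> Y" for i using that Y y'V by auto
    have "psd Y (\<lambda>i j. Q i j - ip (y' j) (y' i))"
    proof (rule psdI)
      fix i j assume ij: "i \<in> Y" "j \<in> Y"
      then show "Q j i - ip (y' i) (y' j) = cnj (Q i j - ip (y' j) (y' i))"
        using kernel_on_hermitian[OF Q, of i j] ip_commute[OF yY yY, of i j] Y by auto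
    next
      fix c :: "'b \<Rightarrow> complex"
      define m where "m i = (if i \<in> X - {z} then c i else 0)" for i
      have m: "m \<in> fsupp R" unfolding fsupp_def m_def using X by auto
      have sum: "C m + scale (c z) y0 = (\<Sum>i\<in>Y. scale (c i) (y' i))"
      proof -
        have "C m = (\<Sum>i\<in>X - {z}. scale (m i) (y i))"
          using X by (intro C_on) (auto simp: m_def)
        also have "\<dots> = (\<Sum>i\<in>X - {z}. scale (c i) (y' i))"
          by (intro sum.cong) (auto simp: m_def y'_def)
        finally show ?thesis
          using X unfolding Y_def by (subst sum.insert_remove) (auto simp: y'_def add.commute)
      qed
      have supp: "{i. (m + cscale (c z) u) i \<noteq> 0} \<subseteq> Y"
        by (auto simp: m_def u_def cscale_def Y_def split: if_splits)
      have "W.nrm2 (m + cscale (c z) u) = Re (qform Y Q (m + cscale (c z) u))"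
        unfolding W.nrm2_def by (rule arg_cong[OF kernel_ip_self[OF Y(1) supp]])
      also have "qform Y Q (m + cscale (c z) u) = qform Y Q c"
        by (intro qform_cong) (auto simp: m_def u_def cscale_def Y_def)
      finally have eq: "W.nrm2 (m + cscale (c z) u) = Re (qform Y Q c)" .
      have "nrm2 (\<Sum>i\<in>Y. scale (c i) (y' i)) \<le> Re (qform Y Q c)"
        using le[OF m, of "c z"] unfolding sum eq .
      then show "0 \<le> Re (qform Y (\<lambda>i j. Q i j - ip (y' j) (y' i)) c)"
        using qform_gram[of Y y' c] yY unfolding qform_diff by simp
    qed
    then show "psd X (\<lambda>i j. Q i j - ip (y' j) (y' i))"
      by (rule psd_subset) (use Y in auto)
  qed
  then show ?thesis using that y0 unfolding y'_def by blast
qed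

text \<open>
  Extend the family of all \<open>y r\<close>, whose Gram matrix is \<open>Q\<close> itself, by a row that consists of the
  values of the functional.
\<close>

lemma (in hspace) representing_vector:
  assumes y: "\<And>r. r \<in> R \<Longrightarrow> y r \<in> V"
    and bound: "\<And>X c. finite X \<Longrightarrow> X \<subseteq> R \<Longrightarrow>
      (cmod (\<Sum>r\<in>X. c r * l r))\<^sup>2 \<le> B * nrm2 (\<Sum>r\<in>X. scale (c r) (y r))"
    and "0 \<le> B"
  obtains v where "v \<in> V" "nrm2 v \<le> B" "\<And>r. r \<in> R \<Longrightarrow> ip (y r) v = l r"
proof -
  define S where "S = Some ` R"
  define Q where "Q i j = (case i of None \<Rightarrow> (case j of None \<Rightarrow> of_real B | Some r \<Rightarrow> l r)
    | Some r \<Rightarrow> (case j of None \<Rightarrow> cnj (l r) | Some s \<Rightarrow> ip (y s) (y r)))" for i j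
  define y' where "y' i = (case i of None \<Rightarrow> 0 | Some r \<Rightarrow> y r)" for i
  have Q: "kernel_on (insert None S) Q"
    unfolding kernel_on_def
  proof (intro allI impI)
    fix X assume "finite X \<and> X \<subseteq> insert None S"
    then have X: "finite X" "X \<subseteq> insert None S" by auto
    define Y where "Y = X - {None}"
    have Y: "finite Y" "Y \<subseteq> S" "None \<notin> Y" "X \<subseteq> insert None Y" using X by (auto simp: Y_def)
    have "psd (insert None Y) Q"
    proof (rule psdI)
      fix i j assume "i \<in> insert None Y" "j \<in> insert None Y"
      then show "Q j i = cnj (Q i j)"
        using Y y by (auto simp: Q_def S_def split: option.splits intro!: ip_commute)
    next
      fix c :: "'b option \<Rightarrow> complex"
      define T where "T = {r. Some r \<in> Y}"
      have YT: "Y = Some ` T" using Y by (auto simp: T_def S_def)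
      have T: "finite T" "T \<subseteq> R" using Y(1,2) unfolding YT by (auto simp: S_def finite_image_iff)
      define s where "s = (\<Sum>r\<in>T. scale (c (Some r)) (y r))"
      define p where "p = (\<Sum>r\<in>T. c (Some r) * l r)"
      have sV: "s \<in> V" unfolding s_def using T y by (intro sum_mem) auto
      have 1: "(\<Sum>j\<in>Y. Q None j * c j) = p"
        unfolding YT p_def by (simp add: sum.reindex Q_def mult.commute)
      have 2: "(\<Sum>i\<in>Y. cnj (c i) * Q i None) = cnj p"
        unfolding YT p_def by (simp add: sum.reindex Q_def)
      have 3: "qform Y Q c = of_real (nrm2 s)"
        using qform_gram[of T y "\<lambda>r. c (Some r)"] T y
        unfolding s_def YT qform_def by (auto simp: sum.reindex Q_def)
      have "Re (qform (insert None Y) Q c) = B * (cmod (c None))\<^sup>2 + 2 * Re (cnj (c None) * p) + nrm2 s"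
        unfolding qform_insert[OF Y(1,3)] 1 2 3 cmod_power2
        by (simp add: Q_def power2_eq_square algebra_simps)
      \<comment> \<open>Hence the form is bounded below by the square of
        \<open>sqrt B * cmod (c None) - nrm s\<close>.\<close>
      moreover have "(cmod p)\<^sup>2 \<le> B * nrm2 s"
        unfolding p_def s_def by (rule bound[OF T])
      then have "cmod p \<le> sqrt B * nrm s"
        unfolding nrm_def by (metis real_sqrt_mult real_le_rsqrt)
      then have "cmod (c None) * cmod p \<le> cmod (c None) * (sqrt B * nrm s)"
        by (rule mult_left_mono) simp
      then have "- (cmod (c None) * (sqrt B * nrm s)) \<le> Re (cnj (c None) * p)"
        using complex_Re_le_cmod[of "- (cnj (c None) * p)"] by (simp add: norm_mult)
      moreover have "0 \<le> (sqrt B * cmod (c None) - nrm s)\<^sup>2" by simp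
      then have "0 \<le> B * (cmod (c None))\<^sup>2 - 2 * (cmod (c None) * (sqrt B * nrm s)) + nrm2 s"
        using \<open>0 \<le> B\<close> sV by (simp add: power2_diff power_mult_distrib nrm_sq mult_ac)
      ultimately show "0 \<le> Re (qform (insert None Y) Q c)" by linarith
    qed
    then show "psd X Q" by (rule psd_subset) (use Y in auto)
  qed
  have dom: "kernel_on S (\<lambda>i j. Q i j - ip (y' j) (y' i))"
  proof -
    have "kernel_on S (\<lambda>i j. 0 * cnj 0)" by (rule kernel_on_rank_one)
    then show ?thesis
      by (rule kernel_on_cong[THEN iffD1, rotated]) (auto simp: S_def Q_def y'_def)
  qed
  have notin: "None \<notin> S" by (simp add: S_def image_iff)
  have y'V: "y' i \<in> V" if "i \<in> S" for i
    using that y by (auto simp: S_def y'_def)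
  obtain v where v: "v \<in> V" and
    K: "kernel_on (insert None S) (\<lambda>i j. Q i j - ip ((y'(None := v)) j) ((y'(None := v)) i))"
    using extend_family[OF Q notin y'V dom] by blast
  have "nrm2 v \<le> B"
    using kernel_on_diag[OF K, of None] by (simp add: Q_def nrm2_def)
  moreover have "ip (y r) v = l r" if "r \<in> R" for r
  proof -
    let ?P = "\<lambda>i j. Q i j - ip ((y'(None := v)) j) ((y'(None := v)) i)"
    \<comment> \<open>Over \<open>R\<close> the diagonal of \<open>?P\<close> is zero, so positivity
      annihilates its entries against \<open>None\<close>.\<close>
    have "psd (insert None {Some r}) ?P"
      using that by (intro kernel_onD[OF K]) (auto simp: S_def)
    then have "psd (insert (Some r) {None}) ?P" by (simp add: insert_commute)
    then have "?P None (Some r) = 0"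
      by (rule psd_schur_complement(2)[rotated 2]) (auto simp: Q_def y'_def)
    then show ?thesis by (simp add: Q_def y'_def)
  qed
  ultimately show ?thesis using that v by blast
qed

section \<open>Hilbert space types and their finite powers\<close>

lemma vector_space_scaleC: "vector_space (scaleC :: complex \<Rightarrow> 'a \<Rightarrow> 'a :: complex_normed_vector)"
  by unfold_locales (auto simp: scaleC_add_right scaleC_add_left scaleC_scaleC scaleC_one)

lemma semi_ip_cinner: "semi_ip scaleC UNIV (cinner :: 'a \<Rightarrow> 'a :: chilbert_space \<Rightarrow> complex)"
proof -
  interpret vector_space "scaleC :: complex \<Rightarrow> 'a \<Rightarrow> 'a" by (rule vector_space_scaleC)
  show ?thesis
    by unfold_locales
      (auto simp: cinner_add_left cinner_scaleC_left Re_cinner intro: cinner_commute)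
qed

interpretation cinner: semi_ip scaleC UNIV "cinner :: 'a \<Rightarrow> 'a :: chilbert_space \<Rightarrow> complex"
  by (rule semi_ip_cinner)

lemma cinner_nrm2: "cinner.nrm2 x = (norm x)\<^sup>2"
  by (simp add: cinner.nrm2_def Re_cinner dot_square_norm)

lemma cinner_nrm: "cinner.nrm x = norm x"
  by (simp add: cinner.nrm_def cinner_nrm2)

lemma cinner_self: "cinner x x = of_real ((norm x)\<^sup>2)"
  using cinner.ip_self[of x] by (simp add: cinner_nrm2)

lemma hspace_cinner: "hspace scaleC UNIV (cinner :: 'a \<Rightarrow> 'a :: chilbert_space \<Rightarrow> complex)"
proof
  fix x :: 'a assume "cinner x x = 0"
  then show "x = 0" by (simp add: cinner_self)
next
  fix s :: "nat \<Rightarrow> 'a" assume "cinner.Cauchy_seq s"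
  then have "Cauchy s"
    unfolding cinner.Cauchy_seq_def Cauchy_def dist_norm cinner_nrm by auto
  then obtain l where "s \<longlonglongrightarrow> l" using Cauchy_convergent convergent_def by blast
  then have "(\<lambda>n. cinner.nrm (s n - l)) \<longlonglongrightarrow> 0"
    unfolding cinner_nrm by (simp add: tendsto_norm_zero_iff LIM_zero_iff)
  then show "\<exists>l\<in>UNIV. (\<lambda>n. cinner.nrm (s n - l)) \<longlonglongrightarrow> 0" by blast
qed

text \<open>The padding with zeros beyond \<open>m\<close> makes a tuple of norm zero equal to the
  zero function.\<close>

definition pow_carrier :: "'v :: zero set \<Rightarrow> nat \<Rightarrow> (nat \<Rightarrow> 'v) set"
  where "pow_carrier V m = {h. (\<forall>a<m. h a \<in> V) \<and> (\<forall>a\<ge>m. h a = 0)}"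

definition pow_scale :: "(complex \<Rightarrow> 'v \<Rightarrow> 'v) \<Rightarrow> complex \<Rightarrow> (nat \<Rightarrow> 'v) \<Rightarrow> nat \<Rightarrow> 'v"
  where "pow_scale sc a h = (\<lambda>b. sc a (h b))"

definition pow_ip :: "('v \<Rightarrow> 'v \<Rightarrow> complex) \<Rightarrow> nat \<Rightarrow> (nat \<Rightarrow> 'v) \<Rightarrow> (nat \<Rightarrow> 'v) \<Rightarrow> complex"
  where "pow_ip ip m h k = (\<Sum>a<m. ip (h a) (k a))"

lemma semi_ip_pow:
  assumes "semi_ip sc V ip"
  shows "semi_ip (pow_scale sc) (pow_carrier V m) (pow_ip ip m)"
proof -
  interpret semi_ip sc V ip by fact
  interpret P: vector_space "pow_scale sc"
    by unfold_locales
      (auto simp: pow_scale_def fun_eq_iff scale_right_distrib scale_left_distrib)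
  show ?thesis
  proof
    show "P.subspace (pow_carrier V m)"
      by (rule P.subspaceI) (auto simp: pow_carrier_def pow_scale_def)
    fix h k l :: "nat \<Rightarrow> 'a" and a
    assume h: "h \<in> pow_carrier V m"
    then show "0 \<le> Re (pow_ip ip m h h)"
      by (auto simp: pow_ip_def pow_carrier_def intro!: sum_nonneg ip_nonneg)
    assume k: "k \<in> pow_carrier V m"
    show "pow_ip ip m (pow_scale sc a h) k = a * pow_ip ip m h k"
      using h k by (auto simp: pow_ip_def pow_carrier_def pow_scale_def sum_distrib_left
          ip_scale_left intro!: sum.cong)
    show "pow_ip ip m h k = cnj (pow_ip ip m k h)"
      using h k unfolding pow_ip_def pow_carrier_def cnj_sum
      by (intro sum.cong refl ip_commute) auto
    assume "l \<in> pow_carrier V m"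
    then show "pow_ip ip m (h + k) l = pow_ip ip m h l + pow_ip ip m k l"
      using h k by (auto simp: pow_ip_def pow_carrier_def ip_add_left simp flip: sum.distrib
          intro!: sum.cong)
  qed
qed

lemma hspace_pow:
  assumes "hspace sc V ip"
  shows "hspace (pow_scale sc) (pow_carrier V m) (pow_ip ip m)"
proof -
  interpret hspace sc V ip by fact
  interpret P: semi_ip "pow_scale sc" "pow_carrier V m" "pow_ip ip m"
    by (rule semi_ip_pow) unfold_locales
  have nrm2: "P.nrm2 h = (\<Sum>a<m. nrm2 (h a))" for h
    by (simp add: P.nrm2_def nrm2_def pow_ip_def)
  have comp: "nrm (h a) \<le> P.nrm h" if "h \<in> pow_carrier V m" "a < m" for h a
    unfolding nrm_def P.nrm_def nrm2 using that
    by (intro real_sqrt_le_mono member_le_sum[of a "{..<m}" "\<lambda>a. nrm2 (h a)"])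
      (auto simp: pow_carrier_def intro: nrm2_nonneg)
  show ?thesis
  proof
    fix h assume h: "h \<in> pow_carrier V m" and "pow_ip ip m h h = 0"
    then have "(\<Sum>a<m. nrm2 (h a)) = 0"
      using nrm2[of h] by (simp add: P.nrm2_def)
    moreover have "0 \<le> nrm2 (h a)" if "a < m" for a
      using h that by (auto simp: pow_carrier_def intro: nrm2_nonneg)
    ultimately have "nrm2 (h a) = 0" if "a < m" for a
      using that by (subst (asm) sum_nonneg_eq_0_iff) auto
    then have "h a = 0" if "a < m" for a
      using that h by (intro definite) (auto simp: ip_self pow_carrier_def)
    then show "h = 0"
      using h by (auto simp: fun_eq_iff pow_carrier_def) (metis not_le)
  next
    fix s assume s: "P.Cauchy_seq s"
    then have sP: "s n \<in> pow_carrier V m" for n by (simp add: P.Cauchy_seq_def)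
    then have sV: "s n a \<in> V" if "a < m" for n a using that by (auto simp: pow_carrier_def)
    have "\<exists>l\<in>V. (\<lambda>n. nrm (s n a - l)) \<longlonglongrightarrow> 0" if a: "a < m" for a
    proof (rule complete)
      show "Cauchy_seq (\<lambda>n. s n a)"
        unfolding Cauchy_seq_def
      proof (intro conjI allI impI)
        fix e :: real assume "0 < e"
        then obtain N where "\<And>i j. N \<le> i \<Longrightarrow> N \<le> j \<Longrightarrow> P.nrm (s i - s j) < e"
          using s unfolding P.Cauchy_seq_def by meson
        moreover have "nrm (s i a - s j a) \<le> P.nrm (s i - s j)" for i j
          using comp[of "s i - s j" a] sP a by simp
        ultimately show "\<exists>N. \<forall>i\<ge>N. \<forall>j\<ge>N. nrm (s i a - s j a) < e"
          by (meson le_less_trans)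
      qed (use sV a in auto)
    qed
    then obtain l where l: "\<And>a. a < m \<Longrightarrow> l a \<in> V"
      and lim: "\<And>a. a < m \<Longrightarrow> (\<lambda>n. nrm (s n a - l a)) \<longlonglongrightarrow> 0"
      by metis
    define l' where "l' a = (if a < m then l a else 0)" for a
    have l': "l' \<in> pow_carrier V m" using l by (auto simp: pow_carrier_def l'_def)
    have "(\<lambda>n. \<Sum>a<m. (nrm (s n a - l a))\<^sup>2) \<longlonglongrightarrow> (\<Sum>a<m. 0\<^sup>2)"
      by (intro tendsto_intros lim) auto
    moreover have "P.nrm2 (s n - l') = (\<Sum>a<m. (nrm (s n a - l a))\<^sup>2)" for n
      unfolding nrm2 using l sV by (intro sum.cong) (auto simp: l'_def nrm_sq)
    ultimately have "(\<lambda>n. sqrt (P.nrm2 (s n - l'))) \<longlonglongrightarrow> sqrt 0"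
      by (intro tendsto_real_sqrt) simp
    then show "\<exists>l\<in>pow_carrier V m. (\<lambda>n. P.nrm (s n - l)) \<longlonglongrightarrow> 0"
      using l' by (auto simp: P.nrm_def)
  qed
qed

section \<open>Extension of Pick data\<close>

text \<open>
  Parrott's lemma for one new point \<open>i0\<close>. With \<open>F0 i j = 1 - k i i0 * k i0 j / (k i0 i0 * k i j)\<close>,
  the kernel \<open>Q = (G - \<langle>v, v\<rangle>) k F0 + G k i i0 k i0 j / k i0 i0\<close> dominates the Gram matrix of the
  multiples \<open>k i0 i / sqrt (k i0 i0)\<close> of the given vectors, and \<open>Q - \<langle>y, y\<rangle> = (G - \<langle>v, v\<rangle>) k\<close>.
\<close>

lemma (in hspace) pick_extend_one:
  fixes G k :: "'i \<Rightarrow> 'i \<Rightarrow> complex"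
  defines "N \<equiv> \<lambda>p q. (G (fst p) (fst q) - ip (snd q) (snd p)) * k (fst p) (fst q)"
  assumes G: "kernel_on I G" and F: "kernel_on I (\<lambda>i j. 1 - 1 / k i j)"
    and nz: "\<And>i j. i \<in> I \<Longrightarrow> j \<in> I \<Longrightarrow> k i j \<noteq> 0" and pos: "\<And>i. i \<in> I \<Longrightarrow> 0 < Re (k i i)"
    and R: "R \<subseteq> I \<times> V" "kernel_on R N" and i0: "i0 \<in> I" "i0 \<notin> fst ` R"
  obtains v0 where "v0 \<in> V" "kernel_on (insert (i0, v0) R) N"
proof -
  have herm: "k j i = cnj (k i j)" if "i \<in> I" "j \<in> I" for i j
    using kernel_on_hermitian[OF F that] by simp
  define b where "b = complex_of_real (sqrt (Re (k i0 i0)))"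
  have b: "b \<noteq> 0" "b * b = k i0 i0" "cnj b = b"
    using pos[OF i0(1)] herm[OF i0(1) i0(1)]
    by (auto simp: b_def complex_eq_iff simp flip: of_real_mult)
  define F0 where "F0 i j = 1 - k i i0 * k i0 j / (k i0 i0 * k i j)" for i j
  \<comment> \<open>The zero vector is a placeholder for the vector to be found;
    \<open>\<rho>\<close> replaces it below.\<close>
  define z :: "'i \<times> 'a" where "z = (i0, 0)"
  define Q where "Q p q = N p q * F0 (fst p) (fst q)
    + G (fst p) (fst q) * (k (fst p) i0 / b * cnj (k (fst q) i0 / b))" for p q
  define y where "y p = scale (k i0 (fst p) / b) (snd p)" for p :: "'i \<times> 'a"
  have z: "z \<notin> R" using i0(2) by (force simp: z_def)
  have fstI: "fst p \<in> I" if "p \<in> insert z R" for p using that R i0 by (auto simp: z_def)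
  have sndV: "snd p \<in> V" if "p \<in> insert z R" for p using that R i0 by (auto simp: z_def)
  have Q: "kernel_on (insert z R) Q"
    unfolding Q_def
  proof (rule kernel_on_add[OF kernel_on_insert_zero kernel_on_schur])
    have "kernel_on I F0"
      unfolding F0_def using F nz i0(1) pos[OF i0(1)] by (rule kernel_on_change_base)
    then have "kernel_on R (\<lambda>p q. F0 (fst p) (fst q))"
      by (rule kernel_on_pullback) (use fstI in auto)
    then show "kernel_on R (\<lambda>p q. N p q * F0 (fst p) (fst q))"
      by (rule kernel_on_schur[OF R(2)])
    show "z \<notin> R" by (rule z)
    \<comment> \<open>\<open>F0\<close> is zero on the row and column of \<open>i0\<close>, so the
      unknown vector at \<open>i0\<close> does not enter this summand.\<close>
    show "N z p * F0 (fst z) (fst p) = 0 \<and> N p z * F0 (fst p) (fst z) = 0" if "p \<in> insert z R" for p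
      using fstI[OF that] nz i0(1) by (simp add: F0_def z_def)
    show "kernel_on (insert z R) (\<lambda>p q. G (fst p) (fst q))"
      by (rule kernel_on_pullback[OF G]) (use fstI in auto)
    show "kernel_on (insert z R) (\<lambda>p q. k (fst p) i0 / b * cnj (k (fst q) i0 / b))"
      by (rule kernel_on_rank_one)
  qed
  have Q': "Q p q = N p q + ip (snd q) (snd p) * (k (fst p) i0 * k i0 (fst q) / k i0 i0)"
    if "p \<in> insert z R" "q \<in> insert z R" for p q
  proof -
    have 1: "k (fst p) i0 / b * cnj (k (fst q) i0 / b) = k (fst p) i0 * k i0 (fst q) / k i0 i0"
      using herm[OF fstI[OF that(2)] i0(1)] b by (simp flip: b(2))
    have 2: "N p q * F0 (fst p) (fst q) = N p q - (G (fst p) (fst q) - ip (snd q) (snd p))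
        * (k (fst p) i0 * k i0 (fst q) / k i0 i0)"
      using nz[OF fstI[OF that(1)] fstI[OF that(2)]] nz[OF i0(1) i0(1)]
      by (simp add: N_def F0_def field_simps)
    show ?thesis unfolding Q_def 1 2 by (simp only: left_diff_distrib) simp
  qed
  have ip_y: "ip (scale (k i0 (fst q) / b) u) (scale (k i0 (fst p) / b) v) =
      ip u v * (k (fst p) i0 * k i0 (fst q) / k i0 i0)"
    if "p \<in> insert z R" "q \<in> insert z R" "u \<in> V" "v \<in> V" for p q u v
    using that herm[OF i0(1) fstI[OF that(1)]] b
    by (simp add: ip_scale_left ip_scale_right flip: b(2))
  have "kernel_on R (\<lambda>p q. Q p q - ip (y q) (y p))"
    using R(2) by (rule kernel_on_cong[THEN iffD1, rotated]) (simp add: Q' y_def ip_y sndV)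
  moreover have "y p \<in> V" if "p \<in> R" for p using sndV that by (auto simp: y_def)
  ultimately obtain y0 where y0: "y0 \<in> V" and
    K: "kernel_on (insert z R) (\<lambda>p q. Q p q - ip ((y(z := y0)) q) ((y(z := y0)) p))"
    using extend_family[OF Q z, of y] by blast
  \<comment> \<open>Undoes the factor \<open>k i0 i0 / b\<close>, which is \<open>b\<close>, that
    \<open>y\<close> puts in front of a vector at \<open>i0\<close>.\<close>
  define v0 where "v0 = scale (1 / b) y0"
  have v0: "v0 \<in> V" using y0 by (simp add: v0_def)
  define \<rho> where "\<rho> p = (if p = z then (i0, v0) else p)" for p
  have y0_eq: "y0 = scale (k i0 i0 / b) v0"
    using b by (simp add: v0_def flip: b(2))
  have y': "(y(z := y0)) p = scale (k i0 (fst p) / b) (snd (\<rho> p))" for p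
    by (auto simp: y0_eq y_def \<rho>_def) (simp add: z_def)
  have fst_\<rho>: "fst (\<rho> p) = fst p" for p by (simp add: \<rho>_def z_def)
  have "kernel_on (insert z R) (\<lambda>p q. N (\<rho> p) (\<rho> q))"
  proof (rule kernel_on_cong[THEN iffD1, OF _ K])
    fix p q assume pq: "p \<in> insert z R" "q \<in> insert z R"
    have V: "snd (\<rho> p) \<in> V" "snd (\<rho> q) \<in> V" using sndV[OF pq(1)] sndV[OF pq(2)] v0 by (auto simp: \<rho>_def simp del: split_paired_All)
    \<comment> \<open>If \<open>p\<close> or \<open>q\<close> is the placeholder, its zero vector
      leaves only the term with \<open>G\<close>.\<close>
    have mixed: "Q p q = G (fst p) (fst q) * (k (fst p) i0 * k i0 (fst q) / k i0 i0)"
      if "p = z \<or> q = z"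
      using that pq nz[OF fstI[OF pq(1)] fstI[OF pq(2)]] Q'[OF pq]
      by (auto simp: N_def z_def ip_zero_left ip_zero_right sndV nz i0)
    show "Q p q - ip ((y(z := y0)) q) ((y(z := y0)) p) = N (\<rho> p) (\<rho> q)"
    proof (cases "p = z \<or> q = z")
      case True
      have "k (fst p) i0 * k i0 (fst q) / k i0 i0 = k (fst p) (fst q)"
        using True nz[OF i0(1) i0(1)] by (auto simp: z_def)
      then show ?thesis
        unfolding y' ip_y[OF pq V(2) V(1)] mixed[OF True] N_def fst_\<rho>
        by (simp add: algebra_simps)
    next
      case False
      then show ?thesis
        unfolding y' ip_y[OF pq V(2) V(1)] Q'[OF pq] by (simp add: \<rho>_def)
    qed
  qed
  then have "kernel_on (\<rho> ` insert z R) N" by (rule kernel_on_image)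
  moreover have "\<rho> ` insert z R = insert (i0, v0) R"
    using z by (auto simp: \<rho>_def image_iff)
  ultimately show ?thesis using that v0 by simp
qed

text \<open>Partial solutions are relations between indices and vectors: positivity concerns finite
  subsets, hence passes to unions of chains, and it also forces a relation to be a function, since
  two vectors at one index must coincide.\<close>

theorem (in hspace) pick_extension:
  fixes G k :: "'i \<Rightarrow> 'i \<Rightarrow> complex"
  assumes G: "kernel_on I G" and F: "kernel_on I (\<lambda>i j. 1 - 1 / k i j)"
    and nz: "\<And>i j. i \<in> I \<Longrightarrow> j \<in> I \<Longrightarrow> k i j \<noteq> 0" and pos: "\<And>i. i \<in> I \<Longrightarrow> 0 < Re (k i i)"
    and R: "R \<subseteq> I \<times> V"
      "kernel_on R (\<lambda>p q. (G (fst p) (fst q) - ip (snd q) (snd p)) * k (fst p) (fst q))"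
  obtains \<Phi> where "\<And>i. i \<in> I \<Longrightarrow> \<Phi> i \<in> V"
    "kernel_on I (\<lambda>i j. (G i j - ip (\<Phi> j) (\<Phi> i)) * k i j)" "\<And>i v. (i, v) \<in> R \<Longrightarrow> \<Phi> i = v"
proof -
  define N where "N = (\<lambda>p q. (G (fst p) (fst q) - ip (snd q) (snd p)) * k (fst p) (fst q))"
  define A where "A = {S. R \<subseteq> S \<and> S \<subseteq> I \<times> V \<and> kernel_on S N}"
  have "\<Union>C \<in> A" if "C \<noteq> {}" "subset.chain A C" for C
  proof -
    have CA: "S \<in> A" if "S \<in> C" for S using \<open>subset.chain A C\<close> that by (auto simp: subset.chain_def)
    have "kernel_on (\<Union>C) N"
      unfolding kernel_on_def
    proof (intro allI impI)
      fix X assume "finite X \<and> X \<subseteq> \<Union>C"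
      then obtain S where "S \<in> C" "X \<subseteq> S"
        using finite_subset_Union_chain[OF _ _ \<open>C \<noteq> {}\<close> \<open>subset.chain A C\<close>] by blast
      then show "psd X N" using CA[of S] \<open>finite X \<and> X \<subseteq> \<Union>C\<close> by (auto simp: A_def kernel_on_def)
    qed
    then show ?thesis using CA \<open>C \<noteq> {}\<close> unfolding A_def by blast
  qed
  moreover have "R \<in> A" using R by (simp add: A_def N_def)
  ultimately obtain M where M: "M \<in> A" and max: "\<And>S. S \<in> A \<Longrightarrow> M \<subseteq> S \<Longrightarrow> S = M"
    using subset_Zorn_nonempty[of A] by blast
  have M': "R \<subseteq> M" "M \<subseteq> I \<times> V" "kernel_on M N" using M by (auto simp: A_def)
  have "\<exists>v. (i, v) \<in> M" if "i \<in> I" for i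
  proof (rule ccontr)
    assume no: "\<nexists>v. (i, v) \<in> M"
    then have "i \<notin> fst ` M" by force
    then obtain v where "v \<in> V" "kernel_on (insert (i, v) M) N"
      using pick_extend_one[OF G F nz pos M'(2) M'(3)[unfolded N_def] \<open>i \<in> I\<close>] unfolding N_def by blast
    then have "insert (i, v) M \<in> A" using M' that by (auto simp: A_def)
    then show False using max[of "insert (i, v) M"] no by blast
  qed
  then obtain \<Phi> where \<Phi>: "\<And>i. i \<in> I \<Longrightarrow> (i, \<Phi> i) \<in> M" by metis
  have "kernel_on I (\<lambda>i j. N (i, \<Phi> i) (j, \<Phi> j))"
    by (rule kernel_on_pullback[OF M'(3)]) (use \<Phi> in auto)
  moreover have "\<Phi> i = v" if "(i, v) \<in> R" for i v
  proof -
    have i: "i \<in> I" "v \<in> V" "\<Phi> i \<in> V" "(i, v) \<in> M" using that R(1) M' \<Phi> by auto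
    \<comment> \<open>Indexing by \<open>bool\<close> spares the case distinction whether the two
      pairs coincide.\<close>
    define u where "u b = (if b then v else \<Phi> i)" for b
    have "kernel_on (UNIV :: bool set) (\<lambda>a b. N (i, u a) (i, u b))"
      by (rule kernel_on_pullback[OF M'(3)]) (use i \<Phi> in \<open>auto simp: u_def\<close>)
    then have "psd (UNIV :: bool set) (\<lambda>a b. N (i, u a) (i, u b))"
      by (rule kernel_onD) auto
    \<comment> \<open>The coefficients 1 and -1 cancel \<open>G\<close> and leave minus the squared
      distance of \<open>v\<close> and \<open>\<Phi> i\<close>, times \<open>k i i\<close>.\<close>
    then have "0 \<le> Re (qform UNIV (\<lambda>a b. N (i, u a) (i, u b)) (\<lambda>b. if b then 1 else - 1))"
      unfolding psd_iff_qform by blast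
    also have "qform UNIV (\<lambda>a b. N (i, u a) (i, u b)) (\<lambda>b. if b then 1 else - 1) =
        - (ip (v - \<Phi> i) (v - \<Phi> i)) * k i i"
      using i by (simp add: qform_def UNIV_bool N_def u_def ip_diff_left ip_diff_right algebra_simps)
    also have "Re \<dots> = - nrm2 (v - \<Phi> i) * Re (k i i)"
      using i by (simp add: ip_self)
    finally have "nrm2 (v - \<Phi> i) \<le> 0"
      using pos[OF i(1)] by (simp add: mult_le_0_iff)
    then have "ip (v - \<Phi> i) (v - \<Phi> i) = 0"
      using nrm2_nonneg[of "v - \<Phi> i"] i by (simp add: ip_self)
    then show ?thesis using definite[of "v - \<Phi> i"] i by auto
  qed
  ultimately show ?thesis
    using that[of \<Phi>] \<Phi> M'(2) unfolding N_def by auto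
qed

section \<open>Adjoints\<close>

lemma cinner_right_eqI:
  fixes u v :: "'a :: chilbert_space"
  assumes "\<And>x. cinner x u = cinner x v"
  shows "u = v"
proof -
  have "cinner (u - v) (u - v) = 0"
    using assms[of "u - v"] by (simp add: cinner.ip_diff_right)
  then show ?thesis by (simp add: cinner_self)
qed

text \<open>Riesz representation of each functional \<open>\<lambda>x. cinner (T x) y\<close>;
  uniqueness of the representing vectors makes \<open>S\<close> linear. \<open>T\<close> is a plain
  function because \<open>schur_interpolation\<close> supplies it pointwise, and
  \<open>norm S \<le> B\<close> becomes the bound on \<open>\<Psi>\<close> there.\<close>

lemma adjoint_exists:
  fixes T :: "'a :: chilbert_space \<Rightarrow> 'b :: chilbert_space"
  assumes add: "\<And>x y. T (x + y) = T x + T y" and scale: "\<And>a x. T (a *\<^sub>C x) = a *\<^sub>C T x"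
    and bound: "\<And>x. norm (T x) \<le> B * norm x" and "0 \<le> B"
  obtains S where "S \<in> bounded_ops" "\<And>x y. cinner (T x) y = cinner x (blinfun_apply S y)" "norm S \<le> B"
proof -
  interpret A: hspace scaleC UNIV "cinner :: 'a \<Rightarrow> 'a \<Rightarrow> complex" by (rule hspace_cinner)
  have T0: "T 0 = 0" using add[of 0 0] by simp
  have T_sum: "T (\<Sum>r\<in>X. c r *\<^sub>C r) = (\<Sum>r\<in>X. c r *\<^sub>C T r)" for X c
    by (induction X rule: infinite_finite_induct) (simp_all add: T0 add scale)
  have "\<exists>v. (norm v)\<^sup>2 \<le> (B * norm y)\<^sup>2 \<and> (\<forall>x. cinner x v = cinner (T x) y)" for y
  proof -
    have "(cmod (\<Sum>r\<in>X. c r * cinner (T r) y))\<^sup>2 \<le>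
        (B * norm y)\<^sup>2 * cinner.nrm2 (\<Sum>r\<in>X. c r *\<^sub>C r)" for X c
    proof -
      have "(\<Sum>r\<in>X. c r * cinner (T r) y) = cinner (T (\<Sum>r\<in>X. c r *\<^sub>C r)) y"
        unfolding T_sum by (simp add: cinner.ip_sum_left cinner_scaleC_left)
      then have "(cmod (\<Sum>r\<in>X. c r * cinner (T r) y))\<^sup>2 \<le>
          (norm (T (\<Sum>r\<in>X. c r *\<^sub>C r)))\<^sup>2 * (norm y)\<^sup>2"
        using cinner.Cauchy_Schwarz[of "T (\<Sum>r\<in>X. c r *\<^sub>C r)" y] by (simp add: cinner_nrm2)
      also have "\<dots> \<le> (B * norm (\<Sum>r\<in>X. c r *\<^sub>C r))\<^sup>2 * (norm y)\<^sup>2"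
        by (intro mult_right_mono power_mono bound) auto
      finally show ?thesis by (simp add: cinner_nrm2 power_mult_distrib mult_ac)
    qed
    then obtain v where "cinner.nrm2 v \<le> (B * norm y)\<^sup>2" "\<And>x. cinner x v = cinner (T x) y"
      using A.representing_vector[of UNIV "\<lambda>x. x" "\<lambda>x. cinner (T x) y" "(B * norm y)\<^sup>2"] by auto
    then show ?thesis by (auto simp: cinner_nrm2)
  qed
  then obtain S where S: "\<And>y. (norm (S y))\<^sup>2 \<le> (B * norm y)\<^sup>2" "\<And>x y. cinner x (S y) = cinner (T x) y"
    by metis
  have S_norm: "norm (S y) \<le> B * norm y" for y
    using S(1)[of y] \<open>0 \<le> B\<close> by (rule power2_le_imp_le[OF _ mult_nonneg_nonneg]) simp
  have S_add: "S (y + z) = S y + S z" for y z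
    by (rule cinner_right_eqI) (simp add: cinner.ip_add_right S(2))
  have S_scale: "S (a *\<^sub>C y) = a *\<^sub>C S y" for a y
    by (rule cinner_right_eqI) (simp add: cinner.ip_scale_right S(2))
  have bl: "bounded_linear S"
  proof (rule bounded_linear_intro[where K = B])
    show "S (r *\<^sub>R y) = r *\<^sub>R S y" for r y
      using S_scale[of "of_real r" y] by (simp add: scaleC_of_real)
  qed (use S_add S_norm in \<open>auto simp: mult.commute\<close>)
  show ?thesis
  proof (rule that[of "Blinfun S"])
    show "Blinfun S \<in> bounded_ops"
      by (simp add: bounded_ops_def bounded_linear_Blinfun_apply[OF bl] S_scale)
    show "cinner (T x) y = cinner x (blinfun_apply (Blinfun S) y)" for x y
      by (simp add: bounded_linear_Blinfun_apply[OF bl] S(2))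
    show "norm (Blinfun S) \<le> B"
      using S_norm \<open>0 \<le> B\<close> by (intro norm_blinfun_bound) (auto simp: bounded_linear_Blinfun_apply[OF bl])
  qed
qed

lemma adjoint_op_eqI:
  assumes "S \<in> bounded_ops" "\<And>x y. cinner (blinfun_apply T x) y = cinner x (blinfun_apply S y)"
  shows "adjoint_op T = S"
  unfolding adjoint_op_def
proof (rule the_equality)
  fix S' assume S': "S' \<in> bounded_ops \<and> (\<forall>x y. cinner (blinfun_apply T x) y = cinner x (blinfun_apply S' y))"
  show "S' = S"
  proof (rule blinfun_eqI, rule cinner_right_eqI)
    fix y x
    show "cinner x (blinfun_apply S' y) = cinner x (blinfun_apply S y)"
      using S' assms(2) by metis
  qed
qed (use assms in auto)

text \<open>The definite description in \<open>adjoint_op\<close> is resolved once an adjoint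
  exists; the Riesz vector of \<open>g\<close> is its adjoint at 1.\<close>

lemma functional_adjoint:
  fixes g :: "'a :: chilbert_space \<Rightarrow>\<^sub>L complex"
  assumes "g \<in> bounded_ops"
  shows "blinfun_apply g u = cinner u (blinfun_apply (adjoint_op g) 1)"
proof -
  obtain S where S: "S \<in> bounded_ops" "\<And>x y. cinner (blinfun_apply g x) y = cinner x (blinfun_apply S y)"
  proof (rule adjoint_exists[of "blinfun_apply g" "norm g"])
    show "blinfun_apply g (a *\<^sub>C x) = a *\<^sub>C blinfun_apply g x" for a x
      using assms by (simp add: bounded_ops_def)
  qed (auto simp: blinfun.add_right norm_blinfun)
  then have "adjoint_op g = S" by (rule adjoint_op_eqI)
  then show ?thesis using S(2)[of u 1] by (simp add: cinner_complex_def)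
qed

section \<open>Reproducing kernel Hilbert spaces\<close>

lemma is_rkhs_hspace:
  assumes "is_rkhs \<Omega> K H ip"
  shows "hspace cscale H ip"
proof -
  interpret is_rkhs \<Omega> K H ip by fact
  interpret vector_space "cscale :: complex \<Rightarrow> ('a \<Rightarrow> complex) \<Rightarrow> _" by (rule vector_space_cscale)
  have sub: "subspace H"
    using zero_mem add_mem scale_mem
    by (intro subspaceI) (auto simp: zero_fun_def plus_fun_def cscale_def)
  interpret semi_ip cscale H ip
  proof
    show "ip h k = cnj (ip k h)" if "h \<in> H" "k \<in> H" for h k by (rule ip_commute[OF that])
  qed (use sub ip_add ip_scale ip_nonneg in
      \<open>auto simp: plus_fun_def cscale_def complex_nonneg_Reals_iff\<close>)
  show ?thesis
  proof
    show "h = 0" if "h \<in> H" "ip h h = 0" for h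
      using ip_definite[OF that] by (simp add: zero_fun_def)
    fix s assume s: "Cauchy_seq s"
    have "\<exists>h\<in>H. (\<lambda>n. sqrt (Re (ip (\<lambda>x. s n x - h x) (\<lambda>x. s n x - h x)))) \<longlonglongrightarrow> 0"
    proof (rule complete)
      show "s n \<in> H" for n using s by (rule Cauchy_seq_mem)
      show "\<exists>N. \<forall>m\<ge>N. \<forall>n\<ge>N. sqrt (Re (ip (\<lambda>x. s m x - s n x) (\<lambda>x. s m x - s n x))) < e"
        if "0 < e" for e
        using s that unfolding Cauchy_seq_def nrm_def nrm2_def fun_diff_def by blast
    qed
    then show "\<exists>l\<in>H. (\<lambda>n. nrm (s n - l)) \<longlonglongrightarrow> 0"
      by (simp add: nrm_def nrm2_def fun_diff_def)
  qed
qed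

definition unit_coeff :: "'i \<Rightarrow> 'i \<Rightarrow> complex" where "unit_coeff y = (\<lambda>i. of_bool (i = y))"

lemma unit_coeff_mem: "y \<in> S \<Longrightarrow> unit_coeff y \<in> fsupp S"
  by (simp add: unit_coeff_def fsupp_def)

lemma kernel_ip_unit_right: "kernel_ip K c (unit_coeff x) = (\<Sum>j | c j \<noteq> 0. K x j * c j)"
  by (simp add: kernel_ip_def unit_coeff_def)

lemma kernel_ip_unit: "kernel_ip K (unit_coeff y) (unit_coeff x) = K x y"
  unfolding kernel_ip_unit_right by (simp add: unit_coeff_def)

text \<open>Reduces the pairing with a finitely supported vector to point evaluations, so that
  pointwise convergence implies convergence against every such vector.\<close>

lemma kernel_ip_expand_right:
  "kernel_ip K c w = (\<Sum>i | w i \<noteq> 0. cnj (w i) * kernel_ip K c (unit_coeff i))"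
  unfolding kernel_ip_unit_right by (simp add: kernel_ip_def sum_distrib_left mult.assoc)

text \<open>
  The space consists of the pointwise limits of Cauchy sequences of finitely supported coefficient
  vectors.
\<close>

theorem moore_aronszajn:
  assumes K: "kernel_on \<Omega> K"
  shows "\<exists>H ip. is_rkhs \<Omega> K H ip"
proof -
  interpret W: semi_ip cscale "fsupp \<Omega>" "kernel_ip K" by (rule semi_ip_fsupp[OF K])
  let ?k = "kernel_ip K"
  let ?e = "unit_coeff"
  define rep where "rep h s \<longleftrightarrow> W.Cauchy_seq s \<and>
    (\<forall>x\<in>\<Omega>. (\<lambda>n. ?k (s n) (?e x)) \<longlonglongrightarrow> h x) \<and> (\<forall>x. x \<notin> \<Omega> \<longrightarrow> h x = 0)" for h s
  define H where "H = {h. \<exists>s. rep h s}"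
  \<comment> \<open>\<open>SOME\<close> picks representing sequences; \<open>ip_rep\<close> removes
    the dependence on them.\<close>
  define ip where "ip h k = lim (\<lambda>n. ?k ((SOME s. rep h s) n) ((SOME s. rep k s) n))" for h k
  \<comment> \<open>The difference of two representing sequences of \<open>h\<close> tends to zero
    at each point, hence against all finitely supported vectors, hence against Cauchy
    sequences.\<close>
  have null: "(\<lambda>n. ?k (s n - s' n) (t n)) \<longlonglongrightarrow> 0" if "rep h s" "rep h s'" "W.Cauchy_seq t" for h s s' t
  proof (rule W.Cauchy_seq_ip_null)
    have C: "W.Cauchy_seq s" "W.Cauchy_seq s'" using that by (auto simp: rep_def)
    then show "W.Cauchy_seq (\<lambda>n. s n - s' n)" by (rule W.Cauchy_seq_diff)
    show "W.Cauchy_seq t" by fact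
    fix w assume w: "w \<in> fsupp \<Omega>"
    have "(\<lambda>n. \<Sum>i | w i \<noteq> 0. cnj (w i) *
        (?k (s n) (?e i) - ?k (s' n) (?e i)))
        \<longlonglongrightarrow> (\<Sum>i | w i \<noteq> 0. cnj (w i) * (h i - h i))"
      using that w by (intro tendsto_intros) (auto simp: rep_def fsupp_def)
    moreover have "?k (s n - s' n) w = (\<Sum>i | w i \<noteq> 0. cnj (w i) *
        (?k (s n) (?e i) - ?k (s' n) (?e i)))" for n
      unfolding kernel_ip_expand_right[of K _ w]
    proof (intro sum.cong refl)
      fix i assume "i \<in> {i. w i \<noteq> 0}"
      with w have "?e i \<in> fsupp \<Omega>" by (intro unit_coeff_mem) (auto simp: fsupp_def)
      then show "cnj (w i) * ?k (s n - s' n) (?e i) = cnj (w i) *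
          (?k (s n) (?e i) - ?k (s' n) (?e i))"
        using W.Cauchy_seq_mem[OF C(1), of n] W.Cauchy_seq_mem[OF C(2), of n]
        by (simp add: W.ip_diff_left)
    qed
    ultimately show "(\<lambda>n. ?k (s n - s' n) w) \<longlonglongrightarrow> 0" by simp
  qed
  have ip_rep: "(\<lambda>n. ?k (s n) (t n)) \<longlonglongrightarrow> ip h k" if st: "rep h s" "rep k t" for h k s t
  proof -
    define s' t' where "s' = (SOME s. rep h s)" and "t' = (SOME s. rep k s)"
    have st': "rep h s'" "rep k t'" unfolding s'_def t'_def using someI[of "rep h", OF st(1)] someI[of "rep k", OF st(2)] by simp_all
    have C: "W.Cauchy_seq s" "W.Cauchy_seq t" "W.Cauchy_seq s'" "W.Cauchy_seq t'"
      using st st' by (auto simp: rep_def)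
    note mem = C[THEN W.Cauchy_seq_mem]
    have lim: "(\<lambda>n. ?k (s' n) (t' n)) \<longlonglongrightarrow> ip h k"
      using W.Cauchy_seq_ip_convergent[OF C(3,4)]
      unfolding ip_def s'_def[symmetric] t'_def[symmetric] by (simp add: convergent_LIMSEQ_iff)
    have "(\<lambda>n. cnj (?k (t n - t' n) (s' n))) \<longlonglongrightarrow> cnj 0"
      by (intro tendsto_intros null[OF st(2) st'(2) C(3)])
    moreover have "cnj (?k (t n - t' n) (s' n)) = ?k (s' n) (t n - t' n)" for n
      using W.ip_commute[of "s' n" "t n - t' n"] mem by auto
    ultimately have "(\<lambda>n. ?k (s n - s' n) (t n) + ?k (s' n) (t n - t' n)
        + ?k (s' n) (t' n)) \<longlonglongrightarrow> 0 + 0 + ip h k"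
      using null[OF st(1) st'(1) C(2)] lim by (intro tendsto_intros) auto
    moreover have "?k (s n - s' n) (t n) + ?k (s' n) (t n - t' n)
        + ?k (s' n) (t' n) = ?k (s n) (t n)" for n
      using mem by (simp add: W.ip_diff_left W.ip_diff_right)
    ultimately show ?thesis by simp
  qed
  have rep_add: "rep (\<lambda>x. h x + k x) (\<lambda>n. s n + t n)" if "rep h s" "rep k t" for h k s t
    unfolding rep_def
  proof (intro conjI ballI allI impI)
    have C: "W.Cauchy_seq s" "W.Cauchy_seq t" using that by (auto simp: rep_def)
    then show "W.Cauchy_seq (\<lambda>n. s n + t n)" by (rule W.Cauchy_seq_add)
    fix x assume x: "x \<in> \<Omega>"
    have "(\<lambda>n. ?k (s n) (?e x) + ?k (t n) (?e x)) \<longlonglongrightarrow> h x + k x"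
      using that x by (intro tendsto_intros) (auto simp: rep_def)
    then show "(\<lambda>n. ?k (s n + t n) (?e x)) \<longlonglongrightarrow> h x + k x"
      using W.Cauchy_seq_mem[OF C(1)] W.Cauchy_seq_mem[OF C(2)] unit_coeff_mem[OF x]
      by (simp add: W.ip_add_left)
  qed (use that in \<open>auto simp: rep_def\<close>)
  have rep_scale: "rep (\<lambda>x. a * h x) (\<lambda>n. cscale a (s n))" if "rep h s" for h a s
    unfolding rep_def
  proof (intro conjI ballI allI impI)
    have C: "W.Cauchy_seq s" using that by (auto simp: rep_def)
    then show "W.Cauchy_seq (\<lambda>n. cscale a (s n))" by (rule W.Cauchy_seq_scale)
    fix x assume x: "x \<in> \<Omega>"
    have "(\<lambda>n. a * ?k (s n) (?e x)) \<longlonglongrightarrow> a * h x"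
      using that x by (intro tendsto_intros) (auto simp: rep_def)
    then show "(\<lambda>n. ?k (cscale a (s n)) (?e x)) \<longlonglongrightarrow> a * h x"
      using W.Cauchy_seq_mem[OF C(1)] unit_coeff_mem[OF x] by (simp add: W.ip_scale_left)
  qed (use that in \<open>auto simp: rep_def\<close>)
  define T where "T c = (\<lambda>x. if x \<in> \<Omega> then ?k c (?e x) else 0)" for c
  have rep_T: "rep (T c) (\<lambda>_. c)" if "c \<in> fsupp \<Omega>" for c
    using that by (auto simp: rep_def T_def W.Cauchy_seq_const)
  have T_unit: "T (?e y) = kernel_fun \<Omega> K y" for y
    by (auto simp: T_def kernel_fun_def kernel_ip_unit)
  have H_I: "h \<in> H" if "rep h s" for h s using that by (auto simp: H_def)
  have ip_eq: "ip h k = l" if "rep h s" "rep k t" "(\<lambda>n. ?k (s n) (t n)) \<longlonglongrightarrow> l" for h k s t l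
    using LIMSEQ_unique[OF ip_rep that(3)] that by blast
  have rep_diff: "rep (\<lambda>x. h x - k x) (\<lambda>n. s n - t n)" if "rep h s" "rep k t" for h k s t
    using rep_add[OF that(1) rep_scale[OF that(2), of "-1"]] by (simp add: fun_diff_def plus_fun_def cscale_def)
  have sub: "module.subspace cscale H"
  proof -
    have "rep (T 0) (\<lambda>_. 0)" by (rule rep_T) simp
    moreover have "T 0 = 0" by (auto simp: T_def fun_eq_iff kernel_ip_def)
    ultimately have "0 \<in> H" by (auto simp: H_def)
    then show ?thesis
    proof (rule W.subspaceI)
      fix h k assume "h \<in> H" "k \<in> H"
      then obtain s t where "rep h s" "rep k t" by (auto simp: H_def)
      then show "h + k \<in> H" unfolding plus_fun_def by (rule H_I[OF rep_add])
    next
      fix a h assume "h \<in> H"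
      then obtain s where "rep h s" by (auto simp: H_def)
      then show "cscale a h \<in> H" unfolding cscale_def by (rule H_I[OF rep_scale])
    qed
  qed
  have ip_self_lim: "(\<lambda>n. W.nrm2 (s n)) \<longlonglongrightarrow> Re (ip h h)" if "rep h s" for h s
    using tendsto_Re[OF ip_rep[OF that that]] by (simp add: W.nrm2_def)
  interpret HH: semi_ip cscale H ip
  proof (rule semi_ip.intro[OF vector_space_cscale], unfold_locales)
    show "module.subspace cscale H" by (rule sub)
  next
    fix h k l assume "h \<in> H" "k \<in> H" "l \<in> H"
    then obtain s t u where r: "rep h s" "rep k t" "rep l u" by (auto simp: H_def)
    then have mem: "s n \<in> fsupp \<Omega>" "t n \<in> fsupp \<Omega>" "u n \<in> fsupp \<Omega>" for n
      by (auto simp: rep_def W.Cauchy_seq_mem)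
    have "(\<lambda>n. ?k (s n) (u n) + ?k (t n) (u n)) \<longlonglongrightarrow> ip h l + ip k l"
      by (intro tendsto_intros ip_rep r)
    then show "ip (h + k) l = ip h l + ip k l"
      using ip_eq[OF rep_add[OF r(1,2)] r(3)] mem by (simp add: plus_fun_def W.ip_add_left[unfolded plus_fun_def])
  next
    fix h k a assume "h \<in> H" "k \<in> H"
    then obtain s t where r: "rep h s" "rep k t" by (auto simp: H_def)
    then have mem: "s n \<in> fsupp \<Omega>" "t n \<in> fsupp \<Omega>" for n
      by (auto simp: rep_def W.Cauchy_seq_mem)
    have "(\<lambda>n. a * ?k (s n) (t n)) \<longlonglongrightarrow> a * ip h k"
      by (intro tendsto_intros ip_rep r)
    then show "ip (cscale a h) k = a * ip h k"
      using ip_eq[OF rep_scale[OF r(1)] r(2)] mem by (simp add: cscale_def W.ip_scale_left[unfolded cscale_def])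
    have "(\<lambda>n. cnj (?k (t n) (s n))) \<longlonglongrightarrow> cnj (ip k h)"
      by (intro tendsto_intros ip_rep r)
    moreover have "cnj (?k (t n) (s n)) = ?k (s n) (t n)" for n
      using W.ip_commute mem by metis
    ultimately show "ip h k = cnj (ip k h)"
      using ip_eq[OF r] by simp
  next
    fix h assume "h \<in> H"
    then obtain s where r: "rep h s" by (auto simp: H_def)
    then have mem: "s n \<in> fsupp \<Omega>" for n by (auto simp: rep_def W.Cauchy_seq_mem)
    show "0 \<le> Re (ip h h)"
      using ip_self_lim[OF r] by (rule LIMSEQ_le_const) (use W.nrm2_nonneg mem in auto)
  qed
  have nrm_lim: "(\<lambda>n. W.nrm (s n)) \<longlonglongrightarrow> HH.nrm h" if "rep h s" for h s
    unfolding W.nrm_def HH.nrm_def HH.nrm2_def by (intro tendsto_real_sqrt ip_self_lim that)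
  have repro: "ip h (kernel_fun \<Omega> K y) = h y" if "h \<in> H" "y \<in> \<Omega>" for h y
  proof -
    obtain s where r: "rep h s" using \<open>h \<in> H\<close> by (auto simp: H_def)
    show ?thesis
      using r rep_T[OF unit_coeff_mem[OF \<open>y \<in> \<Omega>\<close>]] unfolding T_unit
      by (rule ip_eq) (use r \<open>y \<in> \<Omega>\<close> in \<open>auto simp: rep_def\<close>)
  qed
  have kmem: "kernel_fun \<Omega> K y \<in> H" if "y \<in> \<Omega>" for y
    using rep_T[OF unit_coeff_mem[OF that]] unfolding T_unit by (rule H_I)
  have "is_rkhs \<Omega> K H ip"
  proof
    show "h x = 0" if "h \<in> H" "x \<notin> \<Omega>" for h x using that by (auto simp: H_def rep_def)
    show "(\<lambda>x. 0) \<in> H" using HH.mem_V(1) by (simp add: zero_fun_def)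
    show "kernel_fun \<Omega> K y \<in> H" if "y \<in> \<Omega>" for y by (rule kmem[OF that])
    show "h y = ip h (kernel_fun \<Omega> K y)" if "h \<in> H" "y \<in> \<Omega>" for h y using repro[OF that] by simp
    show "(\<lambda>x. h x + k x) \<in> H" if "h \<in> H" "k \<in> H" for h k
      using HH.mem_V(2)[OF that] by (simp add: plus_fun_def)
    show "(\<lambda>x. a * h x) \<in> H" if "h \<in> H" for h a
      using HH.mem_V(4)[OF that] by (simp add: cscale_def)
    show "ip (\<lambda>x. h x + k x) l = ip h l + ip k l" if "h \<in> H" "k \<in> H" "l \<in> H" for h k l
      using HH.ip_add_left[OF that] by (simp add: plus_fun_def)
    show "ip (\<lambda>x. a * h x) l = a * ip h l" if "h \<in> H" "l \<in> H" for h l a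
      using HH.ip_scale_left[OF that] by (simp add: cscale_def)
    show "ip h k = cnj (ip k h)" if "h \<in> H" "k \<in> H" for h k
      by (rule HH.ip_commute[OF that])
    show "ip h h \<in> \<real>\<^sub>\<ge>\<^sub>0" if "h \<in> H" for h
      using HH.ip_self[OF that] HH.nrm2_nonneg[OF that] by simp
    \<comment> \<open>By Cauchy-Schwarz against the kernel functions, a function of norm zero
      vanishes at every point of \<open>\<Omega>\<close>.\<close>
    show "h = (\<lambda>x. 0)" if "h \<in> H" "ip h h = 0" for h
    proof
      fix x
      show "h x = 0"
      proof (cases "x \<in> \<Omega>")
        case True
        then show ?thesis
          using HH.Cauchy_Schwarz[OF that(1) kmem[OF True]] that(2) repro[OF that(1) True]
          by (simp add: HH.nrm2_def)
      qed (use that(1) in \<open>auto simp: H_def rep_def\<close>)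
    qed
  next
    fix hs assume hH: "\<And>n :: nat. hs n \<in> H"
      and cau: "\<And>e. 0 < e \<Longrightarrow> \<exists>N. \<forall>m\<ge>N. \<forall>n\<ge>N.
        sqrt (Re (ip (\<lambda>x. hs m x - hs n x) (\<lambda>x. hs m x - hs n x))) < e"
    have hC: "HH.Cauchy_seq hs"
      unfolding HH.Cauchy_seq_def HH.nrm_def HH.nrm2_def fun_diff_def using hH cau by blast
    \<comment> \<open>The functions with a constant representing sequence are dense. Approximating
      each \<open>hs n\<close> by such a function yields one Cauchy sequence \<open>t\<close> of
      coefficient vectors, and the function that \<open>t\<close> represents is the limit.\<close>
    have "\<exists>c\<in>fsupp \<Omega>. HH.nrm (h - T c) < e" if "h \<in> H" "0 < e" for h e
    proof -
      obtain s where r: "rep h s" using \<open>h \<in> H\<close> by (auto simp: H_def)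
      then have s: "W.Cauchy_seq s" by (simp add: rep_def)
      then obtain N where N: "\<And>m n. N \<le> m \<Longrightarrow> N \<le> n \<Longrightarrow> W.nrm (s m - s n) < e / 2"
        using \<open>0 < e\<close> unfolding W.Cauchy_seq_def by (meson half_gt_zero)
      have sN: "s N \<in> fsupp \<Omega>" using s by (rule W.Cauchy_seq_mem)
      have "(\<lambda>n. W.nrm (s n - s N)) \<longlonglongrightarrow> HH.nrm (h - T (s N))"
        using nrm_lim[OF rep_diff[OF r rep_T[OF sN]]] by (simp add: fun_diff_def)
      then have "HH.nrm (h - T (s N)) \<le> e / 2"
        by (rule LIMSEQ_le_const2) (use N in \<open>auto intro!: exI[of _ N] less_imp_le\<close>)
      then show ?thesis using sN \<open>0 < e\<close> by (intro bexI[of _ "s N"]) auto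
    qed
    then have "\<forall>n. \<exists>c\<in>fsupp \<Omega>. HH.nrm (hs n - T c) < 1 / Suc n" using hH by simp
    then obtain t where t: "\<And>n. t n \<in> fsupp \<Omega>" and near: "\<And>n. HH.nrm (hs n - T (t n)) < 1 / Suc n"
      by metis
    have TH: "T (t n) \<in> H" for n using rep_T[OF t] by (rule H_I)
    have small: "\<exists>N. \<forall>n\<ge>N. 1 / Suc n < e" if "0 < e" for e :: real
    proof -
      obtain N where "1 / Suc N < e" using nat_approx_posE[OF \<open>0 < e\<close>] by blast
      then show ?thesis
        by (intro exI[of _ N] allI impI) (smt (verit) frac_le of_nat_0_less_iff of_nat_le_iff Suc_le_mono zero_less_Suc)
    qed
    have nrm_T: "HH.nrm (T (t m) - T (t n)) = W.nrm (t m - t n)" for m n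
      using nrm_lim[OF rep_diff[OF rep_T rep_T], OF t t, of m n]
      by (simp add: LIMSEQ_const_iff fun_diff_def)
    have tC: "W.Cauchy_seq t"
      unfolding W.Cauchy_seq_def
    proof (intro conjI allI impI)
      fix e :: real assume "0 < e"
      then have e: "0 < e / 3" by simp
      obtain N where N: "\<And>m n. N \<le> m \<Longrightarrow> N \<le> n \<Longrightarrow> HH.nrm (hs m - hs n) < e / 3"
        using hC e unfolding HH.Cauchy_seq_def by meson
      obtain N' where N': "\<And>n. N' \<le> n \<Longrightarrow> 1 / Suc n < e / 3" using small[OF e] by blast
      have "W.nrm (t m - t n) < e" if "max N N' \<le> m" "max N N' \<le> n" for m n
      proof -
        have "W.nrm (t m - t n) \<le> HH.nrm (T (t m) - hs m) + (HH.nrm (hs m - hs n) + HH.nrm (hs n - T (t n)))"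
          unfolding nrm_T[symmetric]
          using HH.nrm_triangle_diff[OF TH[of m] hH[of m] TH[of n]]
            HH.nrm_triangle_diff[OF hH[of m] hH[of n] TH[of n]]
          by linarith
        also have "\<dots> < e / 3 + (e / 3 + e / 3)"
          using N[of m n] N'[of m] N'[of n] near[of m] near[of n] that
            HH.nrm_diff_commute[OF TH[of m] hH[of m]] by (intro add_strict_mono) auto
        finally show ?thesis by simp
      qed
      then show "\<exists>N. \<forall>m\<ge>N. \<forall>n\<ge>N. W.nrm (t m - t n) < e" by blast
    qed (rule t)
    have "convergent (\<lambda>n. ?k (t n) (?e x))" if "x \<in> \<Omega>" for x
      using W.Cauchy_seq_ip_convergent[OF tC W.Cauchy_seq_const[OF unit_coeff_mem[OF that]]] .
    then obtain h0 where h0: "\<And>x. x \<in> \<Omega> \<Longrightarrow> (\<lambda>n. ?k (t n) (?e x)) \<longlonglongrightarrow> h0 x"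
      unfolding convergent_def by metis
    define h where "h x = (if x \<in> \<Omega> then h0 x else 0)" for x
    have r: "rep h t" using tC h0 by (auto simp: rep_def h_def)
    have hH': "h \<in> H" using r by (rule H_I)
    have "(\<lambda>n. HH.nrm (hs n - h)) \<longlonglongrightarrow> 0"
    proof (rule LIMSEQ_I)
      fix e :: real assume "0 < e"
      then have e: "0 < e / 2" by simp
      obtain N where N: "\<And>m n. N \<le> m \<Longrightarrow> N \<le> n \<Longrightarrow> W.nrm (t m - t n) < e / 2"
        using tC e unfolding W.Cauchy_seq_def by meson
      obtain N' where N': "\<And>n. N' \<le> n \<Longrightarrow> 1 / Suc n < e / 2" using small[OF e] by blast
      have "HH.nrm (hs n - h) < e" if "max N N' \<le> n" for n
      proof -
        have "(\<lambda>k. W.nrm (t n - t k)) \<longlonglongrightarrow> HH.nrm (T (t n) - h)"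
          using nrm_lim[OF rep_diff[OF rep_T[OF t] r], of n] by (simp add: fun_diff_def)
        then have "HH.nrm (T (t n) - h) \<le> e / 2"
          by (rule LIMSEQ_le_const2) (use N that in \<open>auto intro!: exI[of _ N] less_imp_le\<close>)
        then show ?thesis
          using HH.nrm_triangle_diff[OF hH[of n] TH[of n] hH'] near[of n] N'[of n] that by simp
      qed
      then show "\<exists>no. \<forall>n\<ge>no. norm (HH.nrm (hs n - h) - 0) < e"
        using HH.nrm_nonneg[OF HH.mem_V(3)[OF hH hH']] by (intro exI[of _ "max N N'"]) auto
    qed
    then show "\<exists>h\<in>H. (\<lambda>n. sqrt (Re (ip (\<lambda>x. hs n x - h x) (\<lambda>x. hs n x - h x)))) \<longlonglongrightarrow> 0"
      using hH' unfolding HH.nrm_def HH.nrm2_def fun_diff_def by blast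
  qed
  then show ?thesis by blast
qed

section \<open>Multipliers\<close>

lemma is_rkhs_rkhs:
  assumes "kernel_on \<Omega> K"
  shows "is_rkhs \<Omega> K (rkhs_space \<Omega> K) (snd (rkhs \<Omega> K))"
proof -
  obtain H ip where "is_rkhs \<Omega> K H ip" using moore_aronszajn[OF assms] by blast
  then have "is_rkhs \<Omega> K (fst (H, ip)) (snd (H, ip))" by simp
  then show ?thesis
    unfolding rkhs_space_def rkhs_def by (rule someI)
qed

lemma qform_sum: "qform I (\<lambda>i j. \<Sum>l\<in>L. M l i j) c = (\<Sum>l\<in>L. qform I (M l) c)"
proof -
  have "qform I (\<lambda>i j. \<Sum>l\<in>L. M l i j) c = (\<Sum>i\<in>I. \<Sum>l\<in>L. \<Sum>j\<in>I. cnj (c i) * M l i j * c j)"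
    unfolding qform_def
    by (intro sum.cong refl, subst sum.swap) (simp add: sum_distrib_left sum_distrib_right)
  then show ?thesis unfolding qform_def by (subst sum.swap)
qed

lemma psd_gram_sum: "psd I (\<lambda>i j. \<Sum>l\<in>L. v i l * cnj (v j l))"
proof -
  have "psd I (\<lambda>i j. v i l * cnj (v j l))" for l by (rule psd_rank_one)
  then show ?thesis unfolding psd_iff_qform qform_sum by (auto intro: sum_nonneg)
qed

lemma qform_diag_scale: "qform I (\<lambda>i j. a i * cnj (a j) * M i j) c = qform I M (\<lambda>i. c i * cnj (a i))"
  unfolding qform_def by (intro sum.cong refl) (simp add: mult_ac)

text \<open>
  With \<open>p = \<Sum> c y k_y\<close> and \<open>h b = \<Sum> c y cnj (\<Phi> y b) k_y\<close>, one has \<open>\<langle>\<Phi> h, p\<rangle> = \<parallel>h\<parallel>\<^sup>2\<close>, so that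
  \<open>\<parallel>h\<parallel> \<le> \<parallel>p\<parallel>\<close>.
\<close>

lemma row_multiplier_kernel:
  assumes rk: "is_rkhs \<Omega> K H ip" and K: "kernel_on \<Omega> K"
    and mult: "\<And>h. (\<And>b. b < n \<Longrightarrow> h b \<in> H) \<Longrightarrow> (\<lambda>x. \<Sum>b<n. \<Phi> x b * h b x) \<in> H \<and>
      semi_ip.nrm2 ip (\<lambda>x. \<Sum>b<n. \<Phi> x b * h b x) \<le> (\<Sum>b<n. semi_ip.nrm2 ip (h b))"
  shows "kernel_on \<Omega> (\<lambda>x y. (1 - (\<Sum>b<n. \<Phi> x b * cnj (\<Phi> y b))) * K x y)"
  unfolding kernel_on_def
proof (intro allI impI)
  let ?s = "\<lambda>x y. \<Sum>b<n. \<Phi> x b * cnj (\<Phi> y b)"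
  let ?k = "kernel_fun \<Omega> K"
  interpret hspace cscale H ip by (rule is_rkhs_hspace[OF rk])
  interpret R: is_rkhs \<Omega> K H ip by (rule rk)
  fix X assume "finite X \<and> X \<subseteq> \<Omega>"
  then have X: "finite X" "X \<subseteq> \<Omega>" by auto
  have kH: "?k x \<in> H" if "x \<in> X" for x using that X R.kernel_fun_mem by auto
  have repro: "ip h (?k x) = h x" if "h \<in> H" "x \<in> X" for h x
    using that X R.reproducing[of h x] by auto
  have gram: "qform X K c = qform X (\<lambda>x y. ip (?k y) (?k x)) c" for c
    using X R.reproducing[OF kH]
    by (intro qform_cong) (auto simp: kernel_fun_def subset_iff)
  show "psd X (\<lambda>x y. (1 - ?s x y) * K x y)"
  proof (rule psdI)
    fix x y assume "x \<in> X" "y \<in> X"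
    then show "(1 - ?s y x) * K y x = cnj ((1 - ?s x y) * K x y)"
      using kernel_on_hermitian[OF K, of x y] X by (auto simp: mult.commute)
  next
    fix c :: "'a \<Rightarrow> complex"
    define p where "p = (\<Sum>y\<in>X. cscale (c y) (?k y))"
    define h where "h b = (\<Sum>y\<in>X. cscale (c y * cnj (\<Phi> y b)) (?k y))" for b
    define F where "F = (\<lambda>x. \<Sum>b<n. \<Phi> x b * h b x)"
    define S where "S = (\<Sum>b<n. nrm2 (h b))"
    have p: "p \<in> H" unfolding p_def using kH by (intro sum_mem) auto
    have h: "h b \<in> H" for b unfolding h_def using kH by (intro sum_mem) auto
    have F: "F \<in> H" "nrm2 F \<le> S" using mult[of h] h by (auto simp: F_def S_def)
    have S0: "0 \<le> S" unfolding S_def using h by (intro sum_nonneg nrm2_nonneg)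
    have np: "qform X K c = of_real (nrm2 p)"
      unfolding gram p_def by (rule qform_gram[OF kH])
    have nh: "qform X K (\<lambda>y. c y * cnj (\<Phi> y b)) = of_real (nrm2 (h b))" for b
      unfolding gram h_def by (rule qform_gram[OF kH])
    have "ip F p = (\<Sum>y\<in>X. cnj (c y) * F y)"
      unfolding p_def using kH F by (subst ip_sum_right) (auto simp: ip_scale_right repro)
    also have "\<dots> = (\<Sum>y\<in>X. \<Sum>b<n. cnj (c y) * \<Phi> y b * h b y)"
      by (simp add: F_def sum_distrib_left mult.assoc)
    also have "\<dots> = (\<Sum>b<n. \<Sum>y\<in>X. cnj (c y) * \<Phi> y b * h b y)"
      by (rule sum.swap)
    also have "\<dots> = (\<Sum>b<n. ip (h b) (h b))"
    proof (intro sum.cong refl)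
      fix b
      have "ip (h b) (h b) = ip (h b) (\<Sum>y\<in>X. cscale (c y * cnj (\<Phi> y b)) (?k y))"
        by (simp add: h_def)
      also have "\<dots> = (\<Sum>y\<in>X. cnj (c y) * \<Phi> y b * h b y)"
        using kH h by (subst ip_sum_right) (auto simp: ip_scale_right repro)
      finally show "(\<Sum>y\<in>X. cnj (c y) * \<Phi> y b * h b y) = ip (h b) (h b)" by simp
    qed
    also have "\<dots> = of_real S" using h by (simp add: S_def ip_self)
    finally have "S\<^sup>2 \<le> nrm2 F * nrm2 p" using Cauchy_Schwarz[OF F(1) p] by simp
    also have "\<dots> \<le> S * nrm2 p" using F p by (intro mult_right_mono nrm2_nonneg)
    finally have "S \<le> nrm2 p"
      using S0 nrm2_nonneg[OF p] by (cases "S = 0") (auto simp: power2_eq_square)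
    moreover have "qform X (\<lambda>x y. (1 - ?s x y) * K x y) c = of_real (nrm2 p - S)"
    proof -
      have "(\<lambda>x y. (1 - ?s x y) * K x y) =
          (\<lambda>x y. K x y - (\<Sum>b<n. \<Phi> x b * cnj (\<Phi> y b) * K x y))"
        by (simp add: left_diff_distrib sum_distrib_right)
      then show ?thesis
        by (simp only: qform_diff qform_sum qform_diag_scale np nh S_def of_real_diff of_real_sum)
    qed
    ultimately show "0 \<le> Re (qform X (\<lambda>x y. (1 - ?s x y) * K x y) c)"
      by simp
  qed
qed

lemma rkhs_norm_sq:
  assumes "kernel_on \<Omega> K" "h \<in> rkhs_space \<Omega> K"
  shows "(rkhs_norm \<Omega> K h)\<^sup>2 = semi_ip.nrm2 (snd (rkhs \<Omega> K)) h" "0 \<le> rkhs_norm \<Omega> K h"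
proof -
  interpret hspace cscale "rkhs_space \<Omega> K" "snd (rkhs \<Omega> K)"
    by (rule is_rkhs_hspace[OF is_rkhs_rkhs[OF assms(1)]])
  show "(rkhs_norm \<Omega> K h)\<^sup>2 = nrm2 h" "0 \<le> rkhs_norm \<Omega> K h"
    using nrm2_nonneg[OF assms(2)] by (simp_all add: rkhs_norm_def nrm2_def)
qed

lemma contractive_multiplier_kernel:
  assumes K: "kernel_on \<Omega> K" and \<phi>: "\<phi> \<in> contractive_multipliers \<Omega> K"
  shows "kernel_on \<Omega> (dbr_kernel K \<phi>)"
proof -
  have "kernel_on \<Omega> (\<lambda>x y. (1 - (\<Sum>b<(1::nat). \<phi> x * cnj (\<phi> y))) * K x y)"
  proof (rule row_multiplier_kernel[OF is_rkhs_rkhs[OF K] K])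
    fix h :: "nat \<Rightarrow> 'a \<Rightarrow> complex" assume "\<And>b. b < 1 \<Longrightarrow> h b \<in> rkhs_space \<Omega> K"
    then have h: "h 0 \<in> rkhs_space \<Omega> K" by simp
    then have "(\<lambda>x. \<phi> x * h 0 x) \<in> rkhs_space \<Omega> K"
      "rkhs_norm \<Omega> K (\<lambda>x. \<phi> x * h 0 x) \<le> rkhs_norm \<Omega> K (h 0)"
      using \<phi> by (auto simp: contractive_multipliers_def)
    then have "(\<lambda>x. \<phi> x * h 0 x) \<in> rkhs_space \<Omega> K"
      "(rkhs_norm \<Omega> K (\<lambda>x. \<phi> x * h 0 x))\<^sup>2 \<le> (rkhs_norm \<Omega> K (h 0))\<^sup>2"
      using rkhs_norm_sq(2)[OF K] by (auto intro: power_mono)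
    then show "(\<lambda>x. \<Sum>b<1. \<phi> x * h b x) \<in> rkhs_space \<Omega> K \<and>
      semi_ip.nrm2 (snd (rkhs \<Omega> K)) (\<lambda>x. \<Sum>b<1. \<phi> x * h b x)
        \<le> (\<Sum>b<1. semi_ip.nrm2 (snd (rkhs \<Omega> K)) (h b))"
      using h by (simp add: rkhs_norm_sq[OF K])
  qed
  then show ?thesis by (simp add: dbr_kernel_def[abs_def])
qed

lemma contractive_matrix_multiplier_kernel:
  assumes K: "kernel_on \<Omega> K" and \<Phi>: "contractive_matrix_multiplier \<Omega> K 1 n \<Phi>"
  shows "kernel_on \<Omega> (\<lambda>x y. (1 - (\<Sum>b<n. \<Phi> x 0 b * cnj (\<Phi> y 0 b))) * K x y)"
proof (rule row_multiplier_kernel[OF is_rkhs_rkhs[OF K] K])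
  fix h :: "nat \<Rightarrow> 'a \<Rightarrow> complex" assume h: "\<And>b. b < n \<Longrightarrow> h b \<in> rkhs_space \<Omega> K"
  define F where "F = (\<lambda>x. \<Sum>b<n. \<Phi> x 0 b * h b x)"
  have "matrix_mult_op n \<Phi> h 0 = F" by (simp add: matrix_mult_op_def F_def)
  then have F: "F \<in> rkhs_space \<Omega> K"
    and le: "sqrt ((rkhs_norm \<Omega> K F)\<^sup>2) \<le> sqrt (\<Sum>b<n. (rkhs_norm \<Omega> K (h b))\<^sup>2)"
    using \<Phi> h by (auto simp: contractive_matrix_multiplier_def tuple_norm_def)
  have "(rkhs_norm \<Omega> K F)\<^sup>2 \<le> (\<Sum>b<n. (rkhs_norm \<Omega> K (h b))\<^sup>2)"
    using le unfolding real_sqrt_le_iff .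
  also have "\<dots> = (\<Sum>b<n. semi_ip.nrm2 (snd (rkhs \<Omega> K)) (h b))"
    using h by (intro sum.cong) (auto simp: rkhs_norm_sq[OF K])
  finally show "F \<in> rkhs_space \<Omega> K \<and>
      semi_ip.nrm2 (snd (rkhs \<Omega> K)) F \<le> (\<Sum>b<n. semi_ip.nrm2 (snd (rkhs \<Omega> K)) (h b))"
    using F by (simp add: rkhs_norm_sq[OF K])
qed

text \<open>The adjoint of multiplication by \<open>\<Phi>\<close> sends \<open>e (x, a)\<close>,
  the kernel function at \<open>x\<close> in component \<open>a\<close>, to the tuple of its
  multiples by \<open>cnj (\<Phi> x a b)\<close>; positivity of the Pick matrix says that this is
  contractive. Pairing the image with \<open>h\<close> is then a bounded functional, and the vector
  that represents it has the values of the product of \<open>\<Phi>\<close> and \<open>h\<close> at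
  all points.\<close>

lemma contractive_matrix_multiplier_of_kernel:
  assumes K: "kernel_on \<Omega> K" and pick: "kernel_on (\<Omega> \<times> {..<m}) (pick_matrix K n \<Phi>)"
  shows "contractive_matrix_multiplier \<Omega> K m n \<Phi>"
  unfolding contractive_matrix_multiplier_def
proof (intro allI impI)
  let ?\<Phi> = "\<lambda>r. \<Phi> (fst r) (snd r)"
  fix h assume h: "\<forall>b<n. h b \<in> rkhs_space \<Omega> K"
  define H where "H = rkhs_space \<Omega> K"
  define ip where "ip = snd (rkhs \<Omega> K)"
  have rk: "is_rkhs \<Omega> K H ip" unfolding H_def ip_def by (rule is_rkhs_rkhs[OF K])
  interpret hspace cscale H ip by (rule is_rkhs_hspace[OF rk])
  interpret R: is_rkhs \<Omega> K H ip by (rule rk)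
  interpret Pm: hspace "pow_scale cscale" "pow_carrier H m" "pow_ip ip m"
    by (rule hspace_pow) unfold_locales
  interpret Pn: hspace "pow_scale cscale" "pow_carrier H n" "pow_ip ip n"
    by (rule hspace_pow) unfold_locales
  have hH: "h b \<in> H" if "b < n" for b using h that by (simp add: H_def)
  define I where "I = \<Omega> \<times> {..<m}"
  define kf where "kf = kernel_fun \<Omega> K"
  have kH: "kf x \<in> H" if "x \<in> \<Omega>" for x unfolding kf_def using that by (rule R.kernel_fun_mem)
  have ip_kf: "ip (kf y) (kf x) = K x y" if "x \<in> \<Omega>" "y \<in> \<Omega>" for x y
    using R.reproducing[OF kH[OF that(2)] that(1)] that by (simp add: kf_def kernel_fun_def)
  define g where "g = matrix_mult_op n \<Phi> h"
  let ?g = "\<lambda>r. cnj (g (snd r) (fst r))"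
  define e where "e r = (\<lambda>a. if a = snd r then kf (fst r) else 0)" for r :: "'a \<times> nat"
  define B where "B = (\<Sum>b<n. nrm2 (h b))"
  have B0: "0 \<le> B" unfolding B_def using hH by (intro sum_nonneg nrm2_nonneg) auto
  have e: "e r \<in> pow_carrier H m" if "r \<in> I" for r
    using that kH by (auto simp: e_def pow_carrier_def I_def)
  have ip_e: "pow_ip ip m (e s) (e r) = of_bool (snd r = snd s) * K (fst r) (fst s)"
    if "r \<in> I" "s \<in> I" for r s
  proof -
    have "pow_ip ip m (e s) (e r) = (\<Sum>a<m. if a = snd r then ip (e s a) (kf (fst r)) else 0)"
      unfolding pow_ip_def using that kH
      by (intro sum.cong) (auto simp: e_def I_def ip_zero_right)
    also have "\<dots> = ip (e s (snd r)) (kf (fst r))"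
      using that by (auto simp: sum.delta I_def)
    also have "\<dots> = of_bool (snd r = snd s) * K (fst r) (fst s)"
      using that by (auto simp: e_def I_def ip_kf ip_zero_left kH)
    finally show ?thesis .
  qed
  have bound: "(cmod (\<Sum>r\<in>X. c r * ?g r))\<^sup>2
      \<le> B * Pm.nrm2 (\<Sum>r\<in>X. pow_scale cscale (c r) (e r))" if X: "finite X" "X \<subseteq> I" for X c
  proof -
    let ?D = "\<lambda>r s. of_bool (snd r = snd s) * K (fst r) (fst s)"
    let ?n = "Pm.nrm2 (\<Sum>r\<in>X. pow_scale cscale (c r) (e r))"
    \<comment> \<open>The tuple \<open>q\<close> is the image of the combination of the
      \<open>e r\<close> under the adjoint, so its pairing with \<open>h'\<close> is the value of
      the functional.\<close>
    define q where "q b = (if b < n then \<Sum>r\<in>X. cscale (c r * cnj (?\<Phi> r b)) (kf (fst r)) else 0)" for b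
    define h' where "h' b = (if b < n then h b else 0)" for b
    have xO: "fst r \<in> \<Omega>" if "r \<in> X" for r using that X by (auto simp: I_def)
    have qH: "q b \<in> H" for b unfolding q_def using kH xO by (auto intro!: sum_mem)
    have "q b = 0" if "n \<le> b" for b using that by (simp add: q_def)
    with qH have q: "q \<in> pow_carrier H n" by (simp add: pow_carrier_def)
    have h': "h' \<in> pow_carrier H n" using hH by (auto simp: pow_carrier_def h'_def)
    have "(\<Sum>r\<in>X. c r * ?g r) =
        (\<Sum>r\<in>X. \<Sum>b<n. c r * cnj (?\<Phi> r b) * cnj (h b (fst r)))"
      by (simp add: g_def matrix_mult_op_def sum_distrib_left mult.assoc)
    also have "\<dots> = (\<Sum>b<n. \<Sum>r\<in>X. c r * cnj (?\<Phi> r b) * cnj (h b (fst r)))"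
      by (rule sum.swap)
    also have "\<dots> = pow_ip ip n q h'"
      unfolding pow_ip_def
    proof (intro sum.cong refl)
      fix b assume "b \<in> {..<n}"
      then have b: "b < n" by simp
      have "ip (q b) (h' b) = (\<Sum>r\<in>X. c r * cnj (?\<Phi> r b) * ip (kf (fst r)) (h b))"
        using b kH xO hH by (simp add: q_def h'_def ip_sum_left ip_scale_left)
      also have "\<dots> = (\<Sum>r\<in>X. c r * cnj (?\<Phi> r b) * cnj (h b (fst r)))"
        using ip_commute[OF kH[OF xO] hH[OF b]] R.reproducing[OF hH[OF b] xO]
        by (intro sum.cong) (auto simp: kf_def)
      finally show "(\<Sum>r\<in>X. c r * cnj (?\<Phi> r b) * cnj (h b (fst r))) = ip (q b) (h' b)"
        by simp
    qed
    finally have "(cmod (\<Sum>r\<in>X. c r * ?g r))\<^sup>2 \<le> Pn.nrm2 q * Pn.nrm2 h'"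
      using Pn.Cauchy_Schwarz[OF q h'] by simp
    also have "Pn.nrm2 h' = B"
      by (simp add: Pn.nrm2_def pow_ip_def B_def nrm2_def h'_def)
    also have "Pn.nrm2 q \<le> ?n"
    proof -
      have 1: "qform X ?D c =
          of_real (?n)"
      proof -
        have "qform X ?D c =
            qform X (\<lambda>r s. pow_ip ip m (e s) (e r)) c"
          using X ip_e by (intro qform_cong) (auto simp: subset_iff)
        also have "\<dots> = of_real (?n)"
          using X e by (intro Pm.qform_gram) auto
        finally show ?thesis .
      qed
      have 2: "qform X (\<lambda>r s. ?\<Phi> r b * cnj (?\<Phi> s b) * K (fst r) (fst s)) c
          = of_real (nrm2 (q b))" if "b < n" for b
      proof -
        have "qform X (\<lambda>r s. K (fst r) (fst s)) (\<lambda>r. c r * cnj (?\<Phi> r b)) =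
            qform X (\<lambda>r s. ip (kf (fst s)) (kf (fst r))) (\<lambda>r. c r * cnj (?\<Phi> r b))"
          using ip_kf xO by (intro qform_cong) auto
        also have "\<dots> = of_real (nrm2 (q b))"
          using qform_gram[of X "\<lambda>r. kf (fst r)"] kH xO that by (simp add: q_def)
        finally show ?thesis by (simp add: qform_diag_scale)
      qed
      \<comment> \<open>The Pick form at \<open>c\<close> is the squared norm of the combination
        minus that of its image \<open>q\<close>.\<close>
      have "0 \<le> Re (qform X (pick_matrix K n \<Phi>) c)"
        using kernel_onD[OF pick[folded I_def] X] unfolding psd_iff_qform by blast
      also have "qform X (pick_matrix K n \<Phi>) c =
          qform X ?D c -
          qform X (\<lambda>r s. \<Sum>b<n. ?\<Phi> r b * cnj (?\<Phi> s b) * K (fst r) (fst s)) c"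
        unfolding qform_diff[symmetric]
        by (intro qform_cong) (auto simp: pick_matrix_def left_diff_distrib sum_distrib_right)
      also have "\<dots> = of_real (?n) - of_real (Pn.nrm2 q)"
        unfolding 1 qform_sum using 2 by (simp add: Pn.nrm2_def pow_ip_def nrm2_def)
      finally show ?thesis by simp
    qed
    finally show ?thesis using B0 by (simp add: mult.commute[of B "Pm.nrm2 _"] mult_right_mono)
  qed
  obtain v where v: "v \<in> pow_carrier H m" "Pm.nrm2 v \<le> B"
    and ev: "\<And>r. r \<in> I \<Longrightarrow> pow_ip ip m (e r) v = ?g r"
    using Pm.representing_vector[of I e ?g B, OF e bound B0] by blast
  have vH: "v a \<in> H" if "a < m" for a using v that by (auto simp: pow_carrier_def)
  have v_eq: "v a = g a" if a: "a < m" for a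
  proof
    fix x
    show "v a x = g a x"
    proof (cases "x \<in> \<Omega>")
      case True
      have "pow_ip ip m (e (x, a)) v = (\<Sum>b<m. if b = a then ip (kf x) (v a) else 0)"
        unfolding pow_ip_def using vH by (intro sum.cong) (auto simp: e_def ip_zero_left)
      also have "\<dots> = ip (kf x) (v a)" using a by simp
      also have "\<dots> = cnj (v a x)"
        using ip_commute[OF kH[OF True] vH[OF a]] R.reproducing[OF vH[OF a] True] by (simp add: kf_def)
      finally show ?thesis using ev[of "(x, a)"] True a by (simp add: I_def)
    next
      case False
      have "h b x = 0" if "b < n" for b using R.supported[OF hH[OF that] False] .
      then show ?thesis
        using R.supported[OF vH[OF a] False] by (simp add: g_def matrix_mult_op_def)
    qed
  qed
  have nsq: "(rkhs_norm \<Omega> K f)\<^sup>2 = nrm2 f" if "f \<in> H" for f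
    using rkhs_norm_sq[OF K] that unfolding H_def ip_def by simp
  have "Pm.nrm2 v = (\<Sum>a<m. nrm2 (v a))"
    by (simp add: Pm.nrm2_def pow_ip_def nrm2_def)
  also have "\<dots> = (\<Sum>a<m. (rkhs_norm \<Omega> K (g a))\<^sup>2)"
    using vH by (intro sum.cong) (auto simp: nsq v_eq)
  finally have "(\<Sum>a<m. (rkhs_norm \<Omega> K (g a))\<^sup>2) = Pm.nrm2 v" ..
  moreover have "(\<Sum>b<n. (rkhs_norm \<Omega> K (h b))\<^sup>2) = B"
    using hH unfolding B_def by (intro sum.cong) (auto simp: nsq)
  ultimately show "(\<forall>a<m. matrix_mult_op n \<Phi> h a \<in> rkhs_space \<Omega> K) \<and>
      tuple_norm \<Omega> K m (matrix_mult_op n \<Phi> h) \<le> tuple_norm \<Omega> K n h"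
    using vH v_eq v(2) unfolding tuple_norm_def g_def[symmetric] H_def by auto
qed

section \<open>The McCullough-Quiggin theorem\<close>

lemma kernel_pos_diag:
  assumes "kernel_on \<Omega> K" "x \<in> \<Omega>" "K x x \<noteq> 0"
  shows "0 < Re (K x x)"
  using kernel_on_diag[OF assms(1,2)] assms(3) by (auto simp: complex_eq_iff less_le)

lemma kernel_on_identity: "kernel_on UNIV (\<lambda>a b. of_bool (a = b))"
  unfolding kernel_on_def psd_iff_qform
proof (intro allI impI)
  fix X :: "'b set" and c :: "'b \<Rightarrow> complex" assume X: "finite X \<and> X \<subseteq> UNIV"
  have "qform X (\<lambda>a b. of_bool (a = b)) c = (\<Sum>a\<in>X. of_real ((cmod (c a))\<^sup>2))"
    unfolding qform_def
  proof (intro sum.cong refl)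
    fix a assume "a \<in> X"
    have "(\<Sum>b\<in>X. cnj (c a) * of_bool (a = b) * c b) = (\<Sum>b\<in>X. if a = b then cnj (c a) * c a else 0)"
      by (intro sum.cong) auto
    then show "(\<Sum>b\<in>X. cnj (c a) * of_bool (a = b) * c b) = of_real ((cmod (c a))\<^sup>2)"
      using X \<open>a \<in> X\<close> by (simp only: sum.delta' if_True complex_norm_square mult.commute)
  qed
  then show "0 \<le> Re (qform X (\<lambda>a b. of_bool (a = b)) c) \<and> Im (qform X (\<lambda>a b. of_bool (a = b)) c) = 0"
    by (simp add: sum_nonneg)
qed

text \<open>The index \<open>(x, a)\<close> carries the conjugate of row \<open>a\<close> of the
  matrix at \<open>x\<close>, and \<open>G\<close> compares row numbers. Then
  \<open>(G - \<langle>v, v\<rangle>) K\<close> is the Pick matrix, and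
  \<open>pick_extension\<close> adds the missing rows one at a time.\<close>

theorem cnp_kernel_if_complement:
  assumes K: "kernel_on \<Omega> K" and nz: "\<And>x y. x \<in> \<Omega> \<Longrightarrow> y \<in> \<Omega> \<Longrightarrow> K x y \<noteq> 0"
    and F: "kernel_on \<Omega> (\<lambda>x y. 1 - 1 / K x y)"
  shows "cnp_kernel \<Omega> K"
  unfolding cnp_kernel_def
proof (intro conjI allI impI K)
  fix m n :: nat and X :: "'a set" and W :: "'a \<Rightarrow> nat \<Rightarrow> nat \<Rightarrow> complex"
  assume "0 < m \<and> 0 < n \<and> finite X \<and> X \<subseteq> \<Omega> \<and> psd (X \<times> {..<m}) (pick_matrix K n W)"
  then have X: "finite X" "X \<subseteq> \<Omega>" "psd (X \<times> {..<m}) (pick_matrix K n W)" by auto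
  interpret C: hspace "pow_scale scaleC" "pow_carrier (UNIV :: complex set) n" "pow_ip cinner n"
    by (rule hspace_pow[OF hspace_cinner])
  define v where "v M p = (\<lambda>l. if l < n then cnj (M (fst p) (snd p) l) else 0)"
    for M :: "'a \<Rightarrow> nat \<Rightarrow> nat \<Rightarrow> complex" and p
  have ip_v: "pow_ip cinner n (v M q) (v M p) = (\<Sum>l<n. M (fst p) (snd p) l * cnj (M (fst q) (snd q) l))"
    for M p q by (simp add: pow_ip_def v_def cinner_complex_def mult.commute)
  define R where "R = (\<lambda>p. (p, v W p)) ` (X \<times> {..<m})"
  have G': "kernel_on (\<Omega> \<times> {..<m}) (\<lambda>p q. of_bool (snd p = snd q))"
    by (rule kernel_on_pullback[OF kernel_on_identity]) simp
  have F': "kernel_on (\<Omega> \<times> {..<m}) (\<lambda>p q. 1 - 1 / K (fst p) (fst q))"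
    by (rule kernel_on_pullback[OF F]) auto
  have nz': "K (fst p) (fst q) \<noteq> 0" if "p \<in> \<Omega> \<times> {..<m}" "q \<in> \<Omega> \<times> {..<m}" for p q
    using that nz by auto
  have pos': "0 < Re (K (fst p) (fst p))" if "p \<in> \<Omega> \<times> {..<m}" for p
    using that nz by (intro kernel_pos_diag[OF K]) auto
  have R: "R \<subseteq> (\<Omega> \<times> {..<m}) \<times> pow_carrier UNIV n"
    using X by (auto simp: R_def pow_carrier_def v_def)
  have dom: "kernel_on R (\<lambda>p q. (of_bool (snd (fst p) = snd (fst q)) - pow_ip cinner n (snd q) (snd p)) *
      K (fst (fst p)) (fst (fst q)))"
    unfolding R_def
  proof (rule kernel_on_image, unfold kernel_on_def fst_conv snd_conv, intro allI impI)
    fix Y assume "finite Y \<and> Y \<subseteq> X \<times> {..<m}"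
    then have "psd Y (pick_matrix K n W)"
      using psd_subset[OF X(3)] X(1) by auto
    then show "psd Y (\<lambda>p q. (of_bool (snd p = snd q) - pow_ip cinner n (v W q) (v W p)) * K (fst p) (fst q))"
      by (rule psd_cong[THEN iffD1, rotated]) (simp add: pick_matrix_def ip_v case_prod_beta)
  qed
  obtain \<Phi> where \<Phi>: "\<And>p. p \<in> \<Omega> \<times> {..<m} \<Longrightarrow> \<Phi> p \<in> pow_carrier UNIV n"
    and pos: "kernel_on (\<Omega> \<times> {..<m}) (\<lambda>p q. (of_bool (snd p = snd q) - pow_ip cinner n (\<Phi> q) (\<Phi> p)) * K (fst p) (fst q))"
    and ext: "\<And>p u. (p, u) \<in> R \<Longrightarrow> \<Phi> p = u"
    using C.pick_extension[OF G' F' nz' pos' R dom] by blast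
  define M where "M x a l = cnj (\<Phi> (x, a) l)" for x a l
  have v_M: "v M p = \<Phi> p" if "p \<in> \<Omega> \<times> {..<m}" for p
    using \<Phi>[OF that] by (auto simp: v_def M_def pow_carrier_def)
  have "kernel_on (\<Omega> \<times> {..<m}) (pick_matrix K n M)"
    using pos by (rule kernel_on_cong[THEN iffD1, rotated])
      (simp add: pick_matrix_def case_prod_beta ip_v flip: v_M)
  then have "contractive_matrix_multiplier \<Omega> K m n M"
    by (rule contractive_matrix_multiplier_of_kernel[OF K])
  moreover have "M x a b = W x a b" if "x \<in> X" "a < m" "b < n" for x a b
    using ext[of "(x, a)" "v W (x, a)"] that by (simp add: R_def M_def v_def)
  ultimately show "\<exists>\<Phi>. contractive_matrix_multiplier \<Omega> K m n \<Phi> \<and>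
      (\<forall>x\<in>X. \<forall>a<m. \<forall>b<n. \<Phi> x a b = W x a b)" by blast
qed

text \<open>
  Knese's argument: if \<open>1 - 1 / K = v v\<^sup>*\<close> on a finite set, then the Pick matrix of the row \<open>v\<close> is
  constant 1 there, and positivity forces the corresponding row of the Pick matrix of the
  interpolating multiplier at a further point to be 1 as well.
\<close>

theorem complement_if_cnp_kernel:
  assumes cnp: "cnp_kernel \<Omega> K" and nz: "\<And>x y. x \<in> \<Omega> \<Longrightarrow> y \<in> \<Omega> \<Longrightarrow> K x y \<noteq> 0"
    and w: "w \<in> \<Omega>" "\<And>x. x \<in> \<Omega> \<Longrightarrow> K x w = 1"
  shows "kernel_on \<Omega> (\<lambda>x y. 1 - 1 / K x y)"
proof -
  have K: "kernel_on \<Omega> K" using cnp by (simp add: cnp_kernel_def)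
  have herm: "K y x = cnj (K x y)" if "x \<in> \<Omega>" "y \<in> \<Omega>" for x y
    by (rule kernel_on_hermitian[OF K that])
  define F where "F x y = 1 - 1 / K x y" for x y
  \<comment> \<open>The induction keeps \<open>w\<close> in the set: it starts from
    \<open>{w}\<close>, where \<open>F\<close> is zero, and compares the row of each further point
    with that of \<open>w\<close>.\<close>
  have "psd (insert w X) F" if "finite X" "X \<subseteq> \<Omega>" for X
    using that
  proof (induction X rule: finite_induct)
    case empty
    show ?case by (simp add: psd_iff_qform qform_def F_def w)
  next
    case (insert z X)
    define Y where "Y = insert w X"
    have Y: "finite Y" "Y \<subseteq> \<Omega>" "w \<in> Y" "psd Y F" using insert w by (auto simp: Y_def)
    have z: "z \<in> \<Omega>" using insert by simp
    show ?case
    proof (cases "z \<in> Y")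
      case True
      then show ?thesis using Y(4) by (auto simp: Y_def insert_absorb)
    next
      case False
      obtain N :: nat and v where N: "0 < N"
        and v: "\<And>x y. x \<in> Y \<Longrightarrow> y \<in> Y \<Longrightarrow> F x y = (\<Sum>l<N. v x l * cnj (v y l))"
        using psd_gram[OF Y(1,4)] by metis
      have "psd (Y \<times> {..<1}) (pick_matrix K N (\<lambda>x a l. v x l))"
      proof -
        have "psd (Y \<times> {..<1::nat}) (\<lambda>p q. 1 * cnj 1)" by (rule psd_rank_one)
        moreover have "1 * cnj 1 = pick_matrix K N (\<lambda>x a l. v x l) p q"
          if "p \<in> Y \<times> {..<1}" "q \<in> Y \<times> {..<1}" for p q
        proof -
          have pq: "fst p \<in> Y" "fst q \<in> Y" "snd p = 0" "snd q = 0" using that by auto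
          then have "K (fst p) (fst q) \<noteq> 0" using nz Y(2) by blast
          then show ?thesis
            using v[OF pq(1,2), symmetric] pq by (simp add: pick_matrix_def case_prod_beta F_def)
        qed
        ultimately show ?thesis by (rule psd_cong[THEN iffD1, rotated])
      qed
      then obtain \<Phi> where \<Phi>: "contractive_matrix_multiplier \<Omega> K 1 N \<Phi>"
        and \<Phi>v: "\<And>x b. x \<in> Y \<Longrightarrow> b < N \<Longrightarrow> \<Phi> x 0 b = v x b"
        using cnp N Y(1,2) unfolding cnp_kernel_def by (metis zero_less_one)
      define s where "s x y = (\<Sum>b<N. \<Phi> x 0 b * cnj (\<Phi> y 0 b))" for x y
      have s_herm: "s y x = cnj (s x y)" for x y by (simp add: s_def mult.commute)
      define P where "P x y = (1 - s x y) * K x y" for x y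
      have P: "kernel_on \<Omega> P"
        unfolding P_def s_def by (rule contractive_matrix_multiplier_kernel[OF K \<Phi>])
      have sF: "s x y = F x y" if "x \<in> Y" "y \<in> Y" for x y
        using v[OF that] \<Phi>v that by (simp add: s_def)
      have P1: "P x y = 1" if "x \<in> Y" "y \<in> Y" for x y
      proof -
        have "K x y \<noteq> 0" using nz Y that by blast
        then show ?thesis using sF[OF that] by (simp add: P_def F_def)
      qed
      \<comment> \<open>\<open>F w w\<close> is zero, so the row of \<open>\<Phi>\<close> at
        \<open>w\<close> has norm zero; hence \<open>P z w = K z w = 1\<close>.\<close>
      have "s w w = 0" using sF[OF Y(3,3)] w by (simp add: F_def)
      have \<Phi>w: "\<Phi> w 0 b = 0" if "b < N" for b
      proof -
        have "(\<Sum>b<N. (cmod (\<Phi> w 0 b))\<^sup>2) = Re (s w w)"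
          unfolding s_def by (simp add: complex_norm_square[symmetric] del: of_real_power)
        then have "\<forall>b\<in>{..<N}. (cmod (\<Phi> w 0 b))\<^sup>2 = 0"
          using \<open>s w w = 0\<close> sum_nonneg_eq_0_iff[of "{..<N}" "\<lambda>b. (cmod (\<Phi> w 0 b))\<^sup>2"] by simp
        then show ?thesis using that by simp
      qed
      have Pzw: "P z w = 1" using \<Phi>w w z by (simp add: P_def s_def)
      have Pwz: "P w z = 1" using kernel_on_hermitian[OF P z w(1)] Pzw by simp
      have zw: "z \<noteq> w" using False Y by auto
      have Pzi: "P z i = 1" if i: "i \<in> Y" for i
      proof (cases "i = w")
        case False
        have iz: "i \<noteq> z" using i \<open>z \<notin> Y\<close> by auto
        \<comment> \<open>In the Schur complement at \<open>w\<close>, the diagonal entry at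
          \<open>i\<close> is \<open>1 - 1 = 0\<close>, which annihilates the entry at
          \<open>z\<close> and \<open>i\<close>.\<close>
        have "psd (insert w {i, z}) P"
          using w z i Y by (intro kernel_onD[OF P]) auto
        then have "psd {i, z} (\<lambda>x y. P x y - P x w * P w y / P w w)"
          by (intro psd_schur_complement(1)) (use False zw in auto)
        then have "psd (insert i {z}) (\<lambda>x y. P x y - P x w * P w y / P w w)" by simp
        from psd_schur_complement(2)[OF _ _ this, of z] show ?thesis
          using iz i Y(3) by (simp add: P1 Pzw)
      qed (simp add: Pzw)
      have "psd (insert w {z}) P"
        using w z by (intro kernel_onD[OF P]) auto
      then have "psd {z} (\<lambda>x y. P x y - P x w * P w y / P w w)"
        by (intro psd_schur_complement(1)) (use zw in auto)
      then have "1 \<le> Re (P z z)"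
        using psd_diag(1)[of "{z}" _ z] Y(3) by (force simp: P1 Pzw Pwz)
      define k where "k = Re (K z z)"
      have k: "K z z = of_real k" "0 < k"
        using kernel_pos_diag[OF K z nz[OF z z]] herm[OF z z] by (auto simp: k_def complex_eq_iff)
      have s_zz: "s z z = of_real (Re (s z z))" using s_herm[of z z] by (simp add: complex_eq_iff)
      have "P z z = of_real ((1 - Re (s z z)) * k)"
        unfolding P_def k(1) by (subst s_zz) simp
      then have "1 \<le> (1 - Re (s z z)) * k" using \<open>1 \<le> Re (P z z)\<close> by simp
      then have d: "0 \<le> 1 - 1 / k - Re (s z z)" using k(2) by (simp add: field_simps)
      \<comment> \<open>At the diagonal entry of \<open>z\<close>, \<open>s z z\<close> is only
        bounded above by \<open>F z z\<close>; the rank-one matrix of \<open>\<delta>\<close>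
        supplies the difference.\<close>
      define \<delta> where "\<delta> x = complex_of_real (if x = z then sqrt (1 - 1 / k - Re (s z z)) else 0)" for x
      have "psd (insert z Y) (\<lambda>x y. s x y + \<delta> x * cnj (\<delta> y))"
        unfolding s_def by (intro psd_add psd_gram_sum psd_rank_one)
      moreover have "s x y + \<delta> x * cnj (\<delta> y) = F x y" if "x \<in> insert z Y" "y \<in> insert z Y" for x y
      proof -
        have szi: "s z i = F z i" if "i \<in> Y" for i
        proof -
          have "K z i \<noteq> 0" using nz z that Y by blast
          then show ?thesis using Pzi[OF that] by (simp add: P_def F_def field_simps)
        qed
        have "\<delta> z * cnj (\<delta> z) = of_real (1 - 1 / k - Re (s z z))"
          using d by (simp add: \<delta>_def flip: of_real_mult)
        then have zz: "s z z + \<delta> z * cnj (\<delta> z) = F z z"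
          by (subst s_zz) (simp add: F_def k)
        have siz: "s i z = F i z" if "i \<in> Y" for i
        proof -
          have "i \<in> \<Omega>" using that Y by blast
          have "s i z = cnj (F z i)" by (simp only: s_herm[of i z] szi[OF that])
          also have "\<dots> = F i z" unfolding F_def herm[OF z \<open>i \<in> \<Omega>\<close>] by simp
          finally show ?thesis .
        qed
        show ?thesis
          using that zz szi siz sF False by (auto simp: \<delta>_def)
      qed
      ultimately have "psd (insert z Y) F" by (rule psd_cong[THEN iffD1, rotated])
      then show ?thesis by (simp add: Y_def insert_commute)
    qed
  qed
  then show ?thesis
    unfolding kernel_on_def F_def[symmetric, abs_def]
    by (meson finite_insert insert_subset psd_subset subset_insertI w(1))
qed

section \<open>The Szego kernel and contractive holomorphic functions\<close>

lemma norm_cinner_le: "cmod (cinner x y) \<le> norm x * norm y"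
  using cinner.cmod_ip_le[of x y] by (simp add: cinner_nrm)

lemma cinner_sum_scaleC:
  "cinner (\<Sum>j\<in>J. a j *\<^sub>C x j) (\<Sum>i\<in>J. b i *\<^sub>C y i) =
    (\<Sum>i\<in>J. \<Sum>j\<in>J. a j * cinner (x j) (y i) * cnj (b i))"
proof -
  have "cinner (\<Sum>j\<in>J. a j *\<^sub>C x j) (\<Sum>i\<in>J. b i *\<^sub>C y i) =
      (\<Sum>i\<in>J. cinner (\<Sum>j\<in>J. a j *\<^sub>C x j) (b i *\<^sub>C y i))"
    by (rule cinner.ip_sum_right) auto
  also have "\<dots> = (\<Sum>i\<in>J. \<Sum>j\<in>J. cinner (a j *\<^sub>C x j) (b i *\<^sub>C y i))"
    by (intro sum.cong refl cinner.ip_sum_left) auto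
  finally show ?thesis
    by (simp add: cinner_scaleC_left cinner.ip_scale_right mult_ac)
qed

text \<open>Makes the scalar Cauchy integral formula available for operator-valued
  functions.\<close>

lemma holomorphic_matrix_coeff:
  fixes \<Psi> :: "complex \<Rightarrow> ('a :: chilbert_space \<Rightarrow>\<^sub>L 'b :: chilbert_space)"
  assumes "vector_holomorphic_on \<Psi> S"
  shows "(\<lambda>z. cinner ((\<Psi> z) e) u) holomorphic_on S"
  unfolding holomorphic_on_def
proof
  fix z assume "z \<in> S"
  then obtain D where D: "(\<Psi> has_derivative (\<lambda>h. h *\<^sub>C D)) (at z within S)"
    using assms unfolding vector_holomorphic_on_def by blast
  have "bounded_linear (\<lambda>T. cinner (blinfun_apply T e) u)"
  proof (rule bounded_linear_intro[where K = "norm e * norm u"])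
    fix T T' :: "'a \<Rightarrow>\<^sub>L 'b" and r :: real
    show "cinner (blinfun_apply (T + T') e) u = cinner (blinfun_apply T e) u + cinner (blinfun_apply T' e) u"
      by (simp add: blinfun.add_left cinner_add_left)
    show "cinner (blinfun_apply (r *\<^sub>R T) e) u = r *\<^sub>R cinner (blinfun_apply T e) u"
      by (simp add: blinfun.scaleR_left cinner_scaleC_left scaleR_conv_of_real flip: scaleC_of_real)
    have "cmod (cinner (blinfun_apply T e) u) \<le> norm (blinfun_apply T e) * norm u"
      by (rule norm_cinner_le)
    also have "\<dots> \<le> norm T * norm e * norm u" by (intro mult_right_mono norm_blinfun) simp
    finally show "cmod (cinner (blinfun_apply T e) u) \<le> norm T * (norm e * norm u)" by (simp add: mult.assoc)
  qed
  from bounded_linear.has_derivative[OF this D]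
  have "((\<lambda>z. cinner ((\<Psi> z) e) u) has_field_derivative cinner (blinfun_apply D e) u) (at z within S)"
    by (simp add: has_field_derivative_def cinner_scaleC_left mult_commute_abs)
  then show "(\<lambda>z. cinner ((\<Psi> z) e) u) field_differentiable at z within S"
    by (auto simp: field_differentiable_def)
qed

text \<open>At a point \<open>c\<close> of the circle, \<open>\<rho>\<^sup>2 = c * cnj c\<close>, so
  the conjugate of the Szego kernel of radius \<open>\<rho>\<close> is \<open>c / (c - w)\<close>:
  this is Cauchy's formula with respect to normalized arc length. The conjugate arises because in
  the later use the kernel stands in the second argument of an inner product.\<close>

lemma circle_mean:
  assumes f: "f holomorphic_on cball 0 \<rho>" and \<rho>: "0 < \<rho>" and w: "cmod w < \<rho>"
  shows "((\<lambda>t. f (circlepath 0 \<rho> t) * cnj (1 / (1 - circlepath 0 \<rho> t * cnj w / of_real (\<rho>\<^sup>2))))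
    has_integral f w) {0..1}"
proof -
  let ?c = "circlepath 0 \<rho>"
  have c: "cmod (?c t) = \<rho>" for t using \<rho> by (simp add: circlepath norm_mult)
  have "((\<lambda>u. f u / (u - w)) has_contour_integral (2 * of_real pi * \<i> * f w)) ?c"
    using f w by (intro Cauchy_integral_circlepath_simple) auto
  then have "((\<lambda>t. f (?c t) / (?c t - w) * vector_derivative ?c (at t)) has_integral (2 * of_real pi * \<i> * f w)) {0..1}"
    by (simp add: has_contour_integral)
  then have "((\<lambda>t. 1 / (2 * of_real pi * \<i>) * (f (?c t) / (?c t - w) * vector_derivative ?c (at t)))
      has_integral 1 / (2 * of_real pi * \<i>) * (2 * of_real pi * \<i> * f w)) {0..1}"
    by (rule has_integral_mult_right)
  moreover have "1 / (2 * of_real pi * \<i>) * (f (?c t) / (?c t - w) * vector_derivative ?c (at t)) =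
      f (?c t) * cnj (1 / (1 - ?c t * cnj w / of_real (\<rho>\<^sup>2)))" for t
  proof -
    have d: "vector_derivative ?c (at t) = 2 * of_real pi * \<i> * ?c t"
      unfolding vector_derivative_circlepath by (simp add: circlepath mult_ac)
    have ne: "?c t \<noteq> w" "?c t \<noteq> 0" using c[of t] w \<rho> by auto
    have "of_real (\<rho>\<^sup>2) = ?c t * cnj (?c t)"
      by (metis c complex_norm_square)
    then have "cnj (1 / (1 - ?c t * cnj w / of_real (\<rho>\<^sup>2))) = 1 / (1 - w / ?c t)"
      using ne by simp
    also have "\<dots> = ?c t / (?c t - w)"
      using ne by (simp add: field_simps)
    finally have e: "cnj (1 / (1 - ?c t * cnj w / of_real (\<rho>\<^sup>2))) = ?c t / (?c t - w)" .
    show ?thesis unfolding d e by (simp add: field_simps)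
  qed
  ultimately show ?thesis by simp
qed

lemma circle_mean_form:
  assumes f: "\<And>i j. i \<in> J \<Longrightarrow> j \<in> J \<Longrightarrow> a i j holomorphic_on cball 0 \<rho>" and \<rho>: "0 < \<rho>"
    and z: "\<And>i. i \<in> J \<Longrightarrow> cmod (z i) < \<rho>" and "finite J"
  shows "((\<lambda>t. \<Sum>i\<in>J. \<Sum>j\<in>J. a i j (circlepath 0 \<rho> t) *
    cnj (1 / (1 - circlepath 0 \<rho> t * cnj (z i) / of_real (\<rho>\<^sup>2)))) has_integral (\<Sum>i\<in>J. \<Sum>j\<in>J. a i j (z i))) {0..1}"
  using assms by (intro has_integral_sum circle_mean) auto

text \<open>
  On the circle of radius \<open>\<rho>\<close>, integrate \<open>Re \<langle>\<Psi> G, h\<rangle> \<le> (\<parallel>G\<parallel>\<^sup>2 + \<parallel>h\<parallel>\<^sup>2) / 2\<close> with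
  \<open>G = \<Sum> k_j v j\<close> and \<open>h = \<Sum> k_j u j\<close>; the left-hand side has the mean value \<open>\<parallel>G\<parallel>\<^sup>2\<close>.
\<close>

lemma schur_form_radius:
  fixes \<Psi> :: "complex \<Rightarrow> ('a :: chilbert_space \<Rightarrow>\<^sub>L 'b :: chilbert_space)"
  assumes \<Psi>: "\<Psi> \<in> Hinf_ball" and J: "finite J" and \<rho>: "0 < \<rho>" "\<rho> < 1"
    and z: "\<And>j. j \<in> J \<Longrightarrow> cmod (z j) < \<rho>"
    and uv: "\<And>j e. j \<in> J \<Longrightarrow> cinner ((\<Psi> (z j)) e) (u j) = cinner e (v j)"
  shows "0 \<le> Re (\<Sum>i\<in>J. \<Sum>j\<in>J. (cinner (u j) (u i) - cinner (v j) (v i)) /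
    (1 - z i * cnj (z j) / of_real (\<rho>\<^sup>2)))"
proof -
  define k where "k j \<zeta> = 1 / (1 - \<zeta> * cnj (z j) / of_real (\<rho>\<^sup>2))" for j \<zeta>
  let ?c = "circlepath 0 \<rho>"
  define G where "G \<zeta> = (\<Sum>j\<in>J. k j \<zeta> *\<^sub>C v j)" for \<zeta>
  define h where "h \<zeta> = (\<Sum>j\<in>J. k j \<zeta> *\<^sub>C u j)" for \<zeta>
  have c: "cmod (?c t) = \<rho>" for t using \<rho> by (simp add: circlepath norm_mult)
  have k_hol: "k j holomorphic_on cball 0 \<rho>" if "j \<in> J" for j
  proof -
    have "1 - \<zeta> * cnj (z j) / of_real (\<rho>\<^sup>2) \<noteq> 0" if "\<zeta> \<in> cball 0 \<rho>" for \<zeta>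
    proof
      assume "1 - \<zeta> * cnj (z j) / of_real (\<rho>\<^sup>2) = 0"
      then have "\<zeta> * cnj (z j) = of_real (\<rho>\<^sup>2)" using \<rho> by (simp add: field_simps)
      then have "cmod \<zeta> * cmod (z j) = \<rho>\<^sup>2"
        by (metis complex_mod_cnj norm_mult norm_of_real abs_power2)
      moreover have "cmod \<zeta> * cmod (z j) < \<rho> * \<rho>"
      proof -
        have "cmod \<zeta> * cmod (z j) \<le> \<rho> * cmod (z j)"
          using that by (intro mult_right_mono) auto
        also have "\<dots> < \<rho> * \<rho>" using z[OF \<open>j \<in> J\<close>] \<rho>(1) by simp
        finally show ?thesis .
      qed
      ultimately show False by (simp add: power2_eq_square)
    qed
    then show ?thesis unfolding k_def by (intro holomorphic_intros) auto
  qed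
  have M_hol: "(\<lambda>\<zeta>. cinner ((\<Psi> \<zeta>) x) y) holomorphic_on cball 0 \<rho>" for x y
    using holomorphic_matrix_coeff[of \<Psi> "ball 0 1" x y] \<Psi> \<rho>
    by (auto simp: Hinf_ball_def elim!: holomorphic_on_subset)
  define A where "A = (\<Sum>i\<in>J. \<Sum>j\<in>J. k j (z i) * cinner (v j) (v i))"
  define B where "B = (\<Sum>i\<in>J. \<Sum>j\<in>J. k j (z i) * cinner (u j) (u i))"
  have cc: "cnj (k i \<zeta>) = cnj (1 / (1 - \<zeta> * cnj (z i) / of_real (\<rho>\<^sup>2)))" for i \<zeta>
    by (simp add: k_def)
  have 1: "((\<lambda>t. cinner (G (?c t)) (G (?c t))) has_integral A) {0..1}"
    unfolding G_def cinner_sum_scaleC A_def cc using J \<rho> z k_hol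
    by (intro circle_mean_form[where a = "\<lambda>i j \<zeta>. k j \<zeta> * cinner (v j) (v i)"] holomorphic_intros) auto
  have 2: "((\<lambda>t. cinner (h (?c t)) (h (?c t))) has_integral B) {0..1}"
    unfolding h_def cinner_sum_scaleC B_def cc using J \<rho> z k_hol
    by (intro circle_mean_form[where a = "\<lambda>i j \<zeta>. k j \<zeta> * cinner (u j) (u i)"] holomorphic_intros) auto
  have 3: "((\<lambda>t. cinner ((\<Psi> (?c t)) (G (?c t))) (h (?c t))) has_integral A) {0..1}"
  proof -
    have "(\<Psi> (?c t)) (G (?c t)) = (\<Sum>j\<in>J. k j (?c t) *\<^sub>C (\<Psi> (?c t)) (v j))" for t
      using \<Psi> c[of t] \<rho> unfolding G_def blinfun.sum_right
      by (intro sum.cong) (auto simp: Hinf_ball_def bounded_ops_def)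
    then have eq: "cinner ((\<Psi> (?c t)) (G (?c t))) (h (?c t)) = (\<Sum>i\<in>J. \<Sum>j\<in>J.
        k j (?c t) * cinner ((\<Psi> (?c t)) (v j)) (u i) * cnj (k i (?c t)))" for t
      by (simp add: h_def cinner_sum_scaleC)
    have A: "A = (\<Sum>i\<in>J. \<Sum>j\<in>J. k j (z i) * cinner ((\<Psi> (z i)) (v j)) (u i))"
      unfolding A_def by (intro sum.cong refl) (simp add: uv)
    show ?thesis
      unfolding eq A cc using J \<rho> z k_hol M_hol
      by (intro circle_mean_form[where a = "\<lambda>i j \<zeta>. k j \<zeta> * cinner ((\<Psi> \<zeta>) (v j)) (u i)"]
          holomorphic_intros) auto
  qed
  have Re: "((\<lambda>t. Re (f t)) has_integral Re x) {0..1}" if "(f has_integral x) {0..1}"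
    for f :: "real \<Rightarrow> complex" and x
    using has_integral_linear[OF that bounded_linear_Re] by (simp add: o_def)
  have "Re A \<le> 1/2 * (Re A + Re B)"
  proof (rule has_integral_le[OF Re[OF 3]])
    show "((\<lambda>t. 1/2 * (Re (cinner (G (?c t)) (G (?c t))) + Re (cinner (h (?c t)) (h (?c t)))))
        has_integral 1/2 * (Re A + Re B)) {0..1}"
      by (intro has_integral_mult_right has_integral_add Re[OF 1] Re[OF 2])
    fix t :: real
    let ?G = "G (?c t)" and ?h = "h (?c t)"
    have "norm (\<Psi> (?c t)) \<le> 1" using \<Psi> c[of t] \<rho> by (auto simp: Hinf_ball_def)
    then have "norm ((\<Psi> (?c t)) ?G) \<le> 1 * norm ?G"
      by (intro order_trans[OF norm_blinfun] mult_right_mono) auto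
    then have "norm ((\<Psi> (?c t)) ?G) * norm ?h \<le> norm ?G * norm ?h"
      by (intro mult_right_mono) auto
    then have "Re (cinner ((\<Psi> (?c t)) ?G) ?h) \<le> norm ?G * norm ?h"
      using complex_Re_le_cmod norm_cinner_le order_trans by metis
    also have "\<dots> \<le> 1/2 * ((norm ?G)\<^sup>2 + (norm ?h)\<^sup>2)"
      using sum_squares_bound[of "norm ?G" "norm ?h"] by simp
    finally show "Re (cinner ((\<Psi> (?c t)) ?G) ?h) \<le>
        1/2 * (Re (cinner ?G ?G) + Re (cinner ?h ?h))"
      by (simp add: cinner_self)
  qed
  then have "Re A \<le> Re B" by simp
  moreover have "(\<Sum>i\<in>J. \<Sum>j\<in>J. (cinner (u j) (u i) - cinner (v j) (v i)) /
    (1 - z i * cnj (z j) / of_real (\<rho>\<^sup>2))) = B - A"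
    unfolding A_def B_def k_def sum_subtractf[symmetric]
    by (intro sum.cong refl) (simp add: diff_divide_distrib)
  ultimately show ?thesis by simp
qed

lemma disc_szego_nonzero: "cmod z < 1 \<Longrightarrow> cmod w < 1 \<Longrightarrow> 1 - z * cnj w \<noteq> 0"
proof
  assume zw: "cmod z < 1" "cmod w < 1" "1 - z * cnj w = 0"
  then have "cmod (z * cnj w) = 1" by (metis eq_iff_diff_eq_0 norm_one)
  moreover have "cmod z * cmod w < 1 * 1" using zw by (intro mult_strict_mono') auto
  ultimately show False by (simp add: norm_mult)
qed

text \<open>Holomorphy holds only in the open disc, so the form is first bounded on circles of
  radius \<open>\<rho> < 1\<close>, and then \<open>\<rho>\<close> tends to 1 from the left;
  finitely many points lie inside all sufficiently large circles.\<close>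

lemma schur_kernel:
  fixes \<Psi> :: "complex \<Rightarrow> ('a :: chilbert_space \<Rightarrow>\<^sub>L 'b :: chilbert_space)"
  assumes \<Psi>: "\<Psi> \<in> Hinf_ball" and z: "\<And>j. j \<in> S \<Longrightarrow> cmod (z j) < 1"
    and uv: "\<And>j e. j \<in> S \<Longrightarrow> cinner ((\<Psi> (z j)) e) (u j) = cinner e (v j)"
  shows "kernel_on S (\<lambda>i j. (cinner (u j) (u i) - cinner (v j) (v i)) / (1 - z i * cnj (z j)))"
  unfolding kernel_on_def
proof (intro allI impI)
  let ?M = "\<lambda>i j. (cinner (u j) (u i) - cinner (v j) (v i)) / (1 - z i * cnj (z j))"
  fix J assume "finite J \<and> J \<subseteq> S"
  then have J: "finite J" "J \<subseteq> S" by auto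
  show "psd J ?M"
  proof (rule psdI)
    fix i j
    show "(cinner (u i) (u j) - cinner (v i) (v j)) / (1 - z j * cnj (z i)) =
        cnj ((cinner (u j) (u i) - cinner (v j) (v i)) / (1 - z i * cnj (z j)))"
      using cinner_commute[of "u i" "u j"] cinner_commute[of "v i" "v j"] by (simp add: mult.commute)
  next
    fix c :: "'c \<Rightarrow> complex"
    \<comment> \<open>The coefficients are absorbed into the vectors: the multiples of
      \<open>u j\<close> and \<open>v j\<close> by \<open>c j\<close> satisfy the same tangential
      condition.\<close>
    define Q where "Q \<rho> = (\<Sum>i\<in>J. \<Sum>j\<in>J. (cinner (c j *\<^sub>C u j) (c i *\<^sub>C u i) -
      cinner (c j *\<^sub>C v j) (c i *\<^sub>C v i)) / (1 - z i * cnj (z j) / of_real (\<rho>\<^sup>2)))" for \<rho> :: real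
    have ev: "\<forall>\<^sub>F \<rho> in at_left 1. 0 \<le> Re (Q \<rho>)"
    proof -
      have "\<forall>\<^sub>F \<rho> in at_left (1::real). \<forall>j\<in>J. cmod (z j) < \<rho>"
        using J z by (intro eventually_ball_finite ballI eventually_at_leftI[of "cmod (z _)"]) auto
      moreover have "\<forall>\<^sub>F \<rho> in at_left (1::real). 0 < \<rho> \<and> \<rho> < 1"
        by (rule eventually_at_leftI[of 0]) auto
      ultimately show ?thesis
      proof eventually_elim
        case (elim \<rho>)
        then show ?case
          unfolding Q_def using J uv
          by (intro schur_form_radius[OF \<Psi>]) (auto simp: cinner.ip_scale_right subset_iff)
      qed
    qed
    have "((\<lambda>\<rho>. Re (Q \<rho>)) \<longlongrightarrow> Re (Q 1)) (at_left 1)"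
      unfolding Q_def using J z disc_szego_nonzero
      by (intro tendsto_intros) (auto simp: subset_iff)
    then have "0 \<le> Re (Q 1)"
      using ev by (rule tendsto_lowerbound) simp
    also have "Q 1 = qform J ?M c"
      unfolding Q_def qform_def
      by (intro sum.cong refl)
        (simp add: cinner_scaleC_left cinner.ip_scale_right algebra_simps diff_divide_distrib)
    finally show "0 \<le> Re (qform J ?M c)" .
  qed
qed

section \<open>From Szego positivity to a holomorphic interpolant\<close>

instance chilbert_space \<subseteq> banach ..

text \<open>The geometric series of the Szego kernel turns the form into a sum of squared norms,
  whose term at \<open>n = 0\<close> is the squared norm of the plain sum.\<close>

lemma szego_form_sums:
  fixes x :: "'i \<Rightarrow> 'a :: chilbert_space"
  assumes z: "\<And>j. j \<in> J \<Longrightarrow> cmod (z j) < 1"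
  shows "(\<lambda>n. (norm (\<Sum>j\<in>J. (cnj (z j) ^ n) *\<^sub>C x j))\<^sup>2) sums
    Re (\<Sum>i\<in>J. \<Sum>j\<in>J. cinner (x j) (x i) / (1 - z i * cnj (z j)))"
proof -
  have "(\<lambda>n. (z i * cnj (z j)) ^ n * cinner (x j) (x i)) sums (1 / (1 - z i * cnj (z j)) * cinner (x j) (x i))"
    if "i \<in> J" "j \<in> J" for i j
  proof (intro sums_mult2 geometric_sums)
    have "cmod (z i) * cmod (z j) < 1 * 1" using z that by (intro mult_strict_mono') auto
    then show "norm (z i * cnj (z j)) < 1" by (simp add: norm_mult)
  qed
  then have "(\<lambda>n. \<Sum>i\<in>J. \<Sum>j\<in>J. (z i * cnj (z j)) ^ n * cinner (x j) (x i)) sums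
      (\<Sum>i\<in>J. \<Sum>j\<in>J. 1 / (1 - z i * cnj (z j)) * cinner (x j) (x i))"
    by (intro sums_sum) auto
  then have "(\<lambda>n. Re (\<Sum>i\<in>J. \<Sum>j\<in>J. (z i * cnj (z j)) ^ n * cinner (x j) (x i))) sums
      Re (\<Sum>i\<in>J. \<Sum>j\<in>J. cinner (x j) (x i) / (1 - z i * cnj (z j)))"
    using sums_Re by fastforce
  moreover have "Re (\<Sum>i\<in>J. \<Sum>j\<in>J. (z i * cnj (z j)) ^ n * cinner (x j) (x i)) =
      (norm (\<Sum>j\<in>J. (cnj (z j) ^ n) *\<^sub>C x j))\<^sup>2" for n
  proof -
    have "(\<Sum>i\<in>J. \<Sum>j\<in>J. (z i * cnj (z j)) ^ n * cinner (x j) (x i)) =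
        cinner (\<Sum>j\<in>J. (cnj (z j) ^ n) *\<^sub>C x j) (\<Sum>j\<in>J. (cnj (z j) ^ n) *\<^sub>C x j)"
      unfolding cinner_sum_scaleC by (intro sum.cong refl) (simp add: power_mult_distrib mult_ac)
    then show ?thesis by (simp add: cinner_self)
  qed
  ultimately show ?thesis by simp
qed

text \<open>Four termwise derivatives of the geometric series have the coefficients
  \<open>(n + 1) * (n + 2) * (n + 3) * (n + 4)\<close>. The fourth power is the square of the factor
  \<open>n\<^sup>2\<close> in \<open>norm_second_difference_le\<close>.\<close>

lemma summable_fourth_power:
  fixes x :: real
  assumes "0 \<le> x" "x < 1"
  shows "summable (\<lambda>n. real n ^ 4 * x ^ n)"
proof -
  have 0: "summable (\<lambda>n. (\<lambda>_. 1::real) n * y ^ n)" if "norm y < 1" for y :: real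
    using that by (simp add: summable_geometric)
  have step: "summable (\<lambda>n. diffs c n * y ^ n)"
    if "\<And>y. norm y < 1 \<Longrightarrow> summable (\<lambda>n. c n * y ^ n)" "norm y < 1" for c and y :: real
    using termdiff_converges[of y 1 c] that by blast
  have "summable (\<lambda>n. diffs (diffs (diffs (diffs (\<lambda>_. 1)))) n * x ^ n)"
    using assms by (intro step 0) auto
  then show ?thesis
  proof (rule summable_comparison_test'[where N = 0])
    fix n :: nat
    have "real n ^ 4 = real n * real n * real n * real n" by (simp add: power4_eq_xxxx)
    also have "\<dots> \<le> diffs (diffs (diffs (diffs (\<lambda>_. 1)))) n"
      by (auto simp: diffs_def intro!: mult_mono simp flip: mult.assoc)
    finally show "norm (real n ^ 4 * x ^ n) \<le> diffs (diffs (diffs (diffs (\<lambda>_. 1)))) n * x ^ n"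
      using assms by (simp add: mult_right_mono)
  qed
qed

text \<open>The factor \<open>r\<close> on the left replaces the exponent \<open>i - 1\<close>, a
  truncated subtraction, on the right.\<close>

lemma norm_power_diff_le:
  fixes a b :: complex
  assumes "cmod a \<le> r" "cmod b \<le> r"
  shows "r * cmod (a ^ i - b ^ i) \<le> cmod (a - b) * (real i * r ^ i)"
proof -
  have r: "0 \<le> r" using assms(1) norm_ge_zero order_trans by blast
  have "r * cmod (\<Sum>l<i. b ^ (i - Suc l) * a ^ l) \<le> r * (\<Sum>l<i. r ^ (i - Suc l) * r ^ l)"
    using assms r by (intro mult_left_mono sum_norm_le) (auto simp: norm_mult norm_power intro!: mult_mono power_mono)
  also have "\<dots> = (\<Sum>l<i. r ^ i)"
    unfolding sum_distrib_left by (intro sum.cong) (auto simp flip: power_add power_Suc)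
  finally have "r * cmod (\<Sum>l<i. b ^ (i - Suc l) * a ^ l) \<le> real i * r ^ i" by simp
  then have "cmod (a - b) * (r * cmod (\<Sum>l<i. b ^ (i - Suc l) * a ^ l)) \<le> cmod (a - b) * (real i * r ^ i)"
    by (rule mult_left_mono) simp
  then show ?thesis by (simp add: power_diff_sumr2 norm_mult mult_ac)
qed

text \<open>The difference is the sum over \<open>i < n\<close> of
  \<open>w ^ (n - Suc i) * (a ^ i - b ^ i)\<close>; scaled by \<open>r\<^sup>2\<close>, each of the
  \<open>n\<close> terms is at most \<open>cmod (a - b) * (real n * r ^ n)\<close>.\<close>

lemma norm_second_difference_le:
  fixes a b w :: complex
  assumes "cmod a \<le> r" "cmod b \<le> r" "cmod w \<le> r" "a \<noteq> w" "b \<noteq> w"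
  shows "r\<^sup>2 * cmod ((a ^ n - w ^ n) / (a - w) - (b ^ n - w ^ n) / (b - w)) \<le> cmod (a - b) * ((real n)\<^sup>2 * r ^ n)"
proof -
  have r: "0 \<le> r" using assms(1) norm_ge_zero order_trans by blast
  have "(a ^ n - w ^ n) / (a - w) - (b ^ n - w ^ n) / (b - w) = (\<Sum>i<n. w ^ (n - Suc i) * (a ^ i - b ^ i))"
    using assms(4,5) power_diff_sumr2[of a n w] power_diff_sumr2[of b n w]
    by (simp add: right_diff_distrib sum_subtractf)
  then have "r\<^sup>2 * cmod ((a ^ n - w ^ n) / (a - w) - (b ^ n - w ^ n) / (b - w)) \<le>
      r\<^sup>2 * (\<Sum>i<n. cmod (w ^ (n - Suc i) * (a ^ i - b ^ i)))"
    by (simp add: mult_left_mono norm_sum)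
  also have "\<dots> \<le> (\<Sum>i<n. cmod (a - b) * (real n * r ^ n))"
    unfolding sum_distrib_left
  proof (rule sum_mono)
    fix i assume "i \<in> {..<n}"
    then have i: "i < n" by simp
    have "r\<^sup>2 * cmod (w ^ (n - Suc i) * (a ^ i - b ^ i)) =
        (cmod w ^ (n - Suc i) * r) * (r * cmod (a ^ i - b ^ i))"
      by (simp add: norm_mult norm_power power2_eq_square mult_ac)
    also have "\<dots> \<le> (r ^ (n - Suc i) * r) * (cmod (a - b) * (real i * r ^ i))"
      using assms r by (intro mult_mono norm_power_diff_le power_mono) auto
    also have "\<dots> = cmod (a - b) * (real i * (r ^ (n - Suc i) * r * r ^ i))"
      by (simp add: mult_ac)
    also have "r ^ (n - Suc i) * r * r ^ i = r ^ n"
    proof -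
      have "r ^ (n - Suc i) * r * r ^ i = r ^ (Suc (n - Suc i) + i)"
        by (simp add: power_add mult_ac)
      also have "Suc (n - Suc i) + i = n" using i by simp
      finally show ?thesis .
    qed
    also have "cmod (a - b) * (real i * r ^ n) \<le> cmod (a - b) * (real n * r ^ n)"
      using i r by (intro mult_left_mono mult_right_mono) auto
    finally show "r\<^sup>2 * cmod (w ^ (n - Suc i) * (a ^ i - b ^ i)) \<le> cmod (a - b) * (real n * r ^ n)" .
  qed
  finally show ?thesis by (simp add: power2_eq_square mult_ac)
qed

text \<open>A Lipschitz bound for the difference quotients at \<open>w\<close> makes them Cauchy,
  and completeness supplies the derivative as their limit, without a candidate given in
  advance.\<close>

lemma vector_derivative_exists:
  fixes F :: "complex \<Rightarrow> 'a :: {complex_normed_vector, banach}"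
  assumes w: "cmod w < r"
    and lip: "\<And>a b. cmod a < r \<Longrightarrow> cmod b < r \<Longrightarrow> a \<noteq> w \<Longrightarrow> b \<noteq> w \<Longrightarrow>
      norm ((1 / (a - w)) *\<^sub>C (F a - F w) - (1 / (b - w)) *\<^sub>C (F b - F w)) \<le> C * cmod (a - b)"
  shows "\<exists>D. (F has_derivative (\<lambda>h. h *\<^sub>C D)) (at w)"
proof -
  define Q where "Q a = (1 / (a - w)) *\<^sub>C (F a - F w)" for a
  have C0: "0 \<le> C * cmod (a - b)" if "cmod a < r" "cmod b < r" "a \<noteq> w" "b \<noteq> w" for a b
    using order_trans[OF norm_ge_zero lip[OF that]] .
  \<comment> \<open>Dividing by \<open>n + 2\<close> keeps the points strictly within radius
    \<open>r\<close> even at \<open>n = 0\<close>.\<close>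
  define s where "s n = w + of_real ((r - cmod w) / real (n + 2))" for n :: nat
  have s: "cmod (s n) < r" "s n \<noteq> w" for n
  proof -
    have "(r - cmod w) / real (n + 2) < r - cmod w"
      using w by (simp add: divide_less_eq)
    then have "cmod w + cmod (of_real ((r - cmod w) / real (n + 2))) < r"
      using w by (simp del: of_real_divide)
    then show "cmod (s n) < r" unfolding s_def by (rule le_less_trans[OF norm_triangle_ineq])
    have "(r - cmod w) / real (n + 2) \<noteq> 0" using w by simp
    then show "s n \<noteq> w" unfolding s_def by (metis add_cancel_right_right of_real_eq_0_iff)
  qed
  have s_lim: "s \<longlonglongrightarrow> w"
  proof -
    have "(\<lambda>n. (r - cmod w) / real (n + 2)) \<longlonglongrightarrow> 0"
      by (rule LIMSEQ_ignore_initial_segment[of "\<lambda>n. (r - cmod w) / real n"])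
        (rule lim_const_over_n)
    then have "s \<longlonglongrightarrow> w + of_real 0"
      unfolding s_def by (intro tendsto_intros)
    then show ?thesis by simp
  qed
  have "Cauchy (\<lambda>n. Q (s n))"
    unfolding Cauchy_def
  proof (intro allI impI)
    fix e :: real assume e: "0 < e"
    \<comment> \<open>No sign of \<open>C\<close> is assumed, so \<open>\<bar>C\<bar> + 1\<close>
      serves as the divisor.\<close>
    have C': "0 < \<bar>C\<bar> + 1" by simp
    obtain N where N: "\<And>m n. N \<le> m \<Longrightarrow> N \<le> n \<Longrightarrow> dist (s m) (s n) < e / (\<bar>C\<bar> + 1)"
      using LIMSEQ_imp_Cauchy[OF s_lim] e C' unfolding Cauchy_def by (meson divide_pos_pos)
    have "dist (Q (s m)) (Q (s n)) < e" if "N \<le> m" "N \<le> n" for m n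
    proof -
      have "dist (Q (s m)) (Q (s n)) \<le> C * cmod (s m - s n)"
        unfolding Q_def dist_norm using s by (intro lip) auto
      also have "\<dots> \<le> (\<bar>C\<bar> + 1) * cmod (s m - s n)"
        by (intro mult_right_mono) auto
      also have "\<dots> < e"
        using N[OF that] C' by (simp add: dist_norm pos_less_divide_eq mult.commute)
      finally show ?thesis .
    qed
    then show "\<exists>M. \<forall>m\<ge>M. \<forall>n\<ge>M. dist (Q (s m)) (Q (s n)) < e" by blast
  qed
  then obtain D where D: "(\<lambda>n. Q (s n)) \<longlonglongrightarrow> D" using Cauchy_convergent convergent_def by blast
  have QD: "norm (Q a - D) \<le> C * cmod (a - w)" if "cmod a < r" "a \<noteq> w" for a
  proof (rule LIMSEQ_le)
    show "(\<lambda>n. norm (Q a - Q (s n))) \<longlonglongrightarrow> norm (Q a - D)" by (intro tendsto_intros D)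
    show "(\<lambda>n. C * cmod (a - s n)) \<longlonglongrightarrow> C * cmod (a - w)" by (intro tendsto_intros s_lim)
    show "\<exists>N. \<forall>n\<ge>N. norm (Q a - Q (s n)) \<le> C * cmod (a - s n)"
      unfolding Q_def using lip s that by blast
  qed
  have "bounded_linear (\<lambda>h. h *\<^sub>C D)"
    by (rule bounded_linear_intro[where K = "norm D"])
      (simp_all add: scaleC_add_left norm_scaleC scaleR_conv_of_real scaleC_scaleC flip: scaleC_of_real)
  moreover have "((\<lambda>y. norm ((F y - F w) - (y - w) *\<^sub>C D) / norm (y - w)) \<longlongrightarrow> 0) (at w)"
  proof (rule Lim_null_comparison)
    have "((\<lambda>y. C * cmod (y - w)) \<longlongrightarrow> C * cmod (w - w)) (at w)" by (intro tendsto_intros)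
    then show "((\<lambda>y. C * cmod (y - w)) \<longlongrightarrow> 0) (at w)" by simp
    have "\<forall>\<^sub>F y in at w. y \<in> ball w (r - cmod w) \<and> y \<noteq> w"
      using w by (intro eventually_conj eventually_at_in_open' eventually_neq_at_within) auto
    then show "\<forall>\<^sub>F y in at w. norm (norm ((F y - F w) - (y - w) *\<^sub>C D) / norm (y - w)) \<le> C * cmod (y - w)"
    proof eventually_elim
      case (elim y)
      then have y: "cmod y < r" "y \<noteq> w"
        using norm_triangle_ineq[of w "y - w"] by (auto simp: dist_norm norm_minus_commute)
      have "F y - F w = (y - w) *\<^sub>C Q y"
        using y(2) by (simp add: Q_def scaleC_scaleC scaleC_one)
      then have "(F y - F w) - (y - w) *\<^sub>C D = (y - w) *\<^sub>C (Q y - D)"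
        by (metis add_diff_cancel_right' diff_add_cancel scaleC_add_right)
      then show ?case
        using QD[OF y] y(2) by (simp add: norm_scaleC)
    qed
  qed
  ultimately show ?thesis unfolding has_derivative_iff_norm by blast
qed

text \<open>The Szego kernel has the rank-one complement \<open>a * cnj b\<close>, so the data
  extend to all pairs \<open>(a, x)\<close> of a point of the disc and a vector. Positivity of the
  extended family, read through \<open>szego_form_sums\<close>, yields linearity of
  \<open>T a\<close> when all points coincide, and bounds on second divided differences when there
  are three; \<open>\<Psi> a\<close> is the adjoint of \<open>T a\<close>.\<close>

theorem schur_interpolation:
  fixes u :: "'i \<Rightarrow> 'f :: chilbert_space" and v :: "'i \<Rightarrow> 'e :: chilbert_space"
  assumes z: "\<And>j. j \<in> S \<Longrightarrow> cmod (z j) < 1"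
    and psd: "kernel_on S (\<lambda>i j. (cinner (u j) (u i) - cinner (v j) (v i)) / (1 - z i * cnj (z j)))"
  obtains \<Psi> :: "complex \<Rightarrow> ('e \<Rightarrow>\<^sub>L 'f)" where "\<Psi> \<in> Hinf_ball"
    "\<And>j e. j \<in> S \<Longrightarrow> cinner ((\<Psi> (z j)) e) (u j) = cinner e (v j)"
proof -
  interpret E: hspace scaleC UNIV "cinner :: 'e \<Rightarrow> 'e \<Rightarrow> complex" by (rule hspace_cinner)
  define I where "I = ball (0 :: complex) 1 \<times> (UNIV :: 'f set)"
  define k where "k p q = 1 / (1 - fst p * cnj (fst q))" for p q :: "complex \<times> 'f"
  define R where "R = (\<lambda>i. ((z i, u i), v i)) ` S"
  have ne: "1 - a * cnj b \<noteq> 0" if "a \<in> ball 0 1" "b \<in> ball 0 1" for a b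
    using disc_szego_nonzero that by simp
  have G: "kernel_on I (\<lambda>p q. cinner (snd q) (snd p))"
    by (rule cinner.kernel_on_gram) simp
  have F: "kernel_on I (\<lambda>p q. 1 - 1 / k p q)"
  proof -
    have "kernel_on I (\<lambda>p q. fst p * cnj (fst q))" by (rule kernel_on_rank_one)
    then show ?thesis
      by (rule kernel_on_cong[THEN iffD1, rotated]) (simp add: k_def)
  qed
  have nz: "k p q \<noteq> 0" if "p \<in> I" "q \<in> I" for p q
    using ne that by (auto simp: k_def I_def)
  have pos_diag: "0 < 1 - (cmod a)\<^sup>2" if "a \<in> ball 0 1" for a
    using that by (simp add: power_less_one_iff abs_square_less_1)
  have k_diag: "k p p = of_real (1 / (1 - (cmod (fst p))\<^sup>2))" for p
    by (simp add: k_def complex_norm_square[symmetric] del: of_real_power)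
  have pos: "0 < Re (k p p)" if "p \<in> I" for p
    unfolding k_diag using pos_diag that by (auto simp: I_def)
  have RI: "R \<subseteq> I \<times> UNIV" using z by (auto simp: R_def I_def)
  have dom: "kernel_on R (\<lambda>p q. (cinner (snd (fst q)) (snd (fst p)) - cinner (snd q) (snd p)) * k (fst p) (fst q))"
    unfolding R_def
    by (rule kernel_on_image, rule kernel_on_cong[THEN iffD1, rotated, OF psd]) (simp add: k_def)
  let ?P = "\<lambda>\<Phi>. kernel_on I (\<lambda>p q. (cinner (snd q) (snd p) - cinner (\<Phi> q) (\<Phi> p)) * k p q)"
  have "\<exists>\<Phi>. ?P \<Phi> \<and>
      (\<forall>p x. (p, x) \<in> R \<longrightarrow> \<Phi> p = x)"
  proof (rule E.pick_extension[OF G F nz pos RI dom])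
    fix \<Phi>
    assume "?P \<Phi>"
      and "\<And>p x. (p, x) \<in> R \<Longrightarrow> \<Phi> p = x"
    then show ?thesis by (intro exI[of _ \<Phi>] conjI allI impI)
  qed
  then obtain \<Phi> where "?P \<Phi> \<and>
      (\<forall>p x. (p, x) \<in> R \<longrightarrow> \<Phi> p = x)" ..
  note \<Phi> = conjunct1[OF this] and ext = conjunct2[OF this, rule_format]
  define T where "T a x = \<Phi> (a, x)" for a x
  let ?N = "\<lambda>(J :: nat set) a c x n. (norm (\<Sum>j\<in>J. (cnj (a j) ^ n) *\<^sub>C c j *\<^sub>C x j))\<^sup>2"
  \<comment> \<open>Of the series for the values of \<open>T\<close> only the term
    \<open>n = 0\<close> is kept; the series for the arguments stays whole.\<close>
  have key: "(norm (\<Sum>j\<in>J. c j *\<^sub>C T (a j) (x j)))\<^sup>2 \<le>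
      (\<Sum>n. ?N J a c x n)"
    "summable (\<lambda>n. ?N J a c x n)"
    if J: "finite J" and a: "\<And>j. j \<in> J \<Longrightarrow> a j \<in> ball 0 1" for J :: "nat set" and a c x
  proof -
    let ?B = "\<lambda>y. \<Sum>i\<in>J. \<Sum>j\<in>J. cinner (c j *\<^sub>C y j) (c i *\<^sub>C y i) / (1 - a i * cnj (a j))"
    let ?Q = "\<lambda>i j. (cinner (x j) (x i) - cinner (T (a j) (x j)) (T (a i) (x i))) / (1 - a i * cnj (a j))"
    have a': "cmod (a j) < 1" if "j \<in> J" for j using a[OF that] by simp
    have "psd J ?Q"
    proof -
      have "kernel_on J (\<lambda>i j. (cinner (snd (a j, x j)) (snd (a i, x i)) -
          cinner (\<Phi> (a j, x j)) (\<Phi> (a i, x i))) * k (a i, x i) (a j, x j))"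
        by (rule kernel_on_pullback[OF \<Phi>, of "\<lambda>j. (a j, x j)"]) (use a in \<open>auto simp: I_def\<close>)
      then show ?thesis
        using J by (simp add: kernel_on_def T_def k_def)
    qed
    then have "0 \<le> Re (qform J ?Q c)"
      unfolding psd_iff_qform by blast
    also have "qform J ?Q c =
        ?B x -
        ?B (\<lambda>j. T (a j) (x j))"
      unfolding qform_def sum_subtractf[symmetric]
      by (intro sum.cong refl)
        (simp add: cinner_scaleC_left cinner.ip_scale_right algebra_simps diff_divide_distrib)
    finally have le: "Re (?B (\<lambda>j. T (a j) (x j)))
        \<le> Re (?B x)"
      by simp
    note sx = szego_form_sums[of J a "\<lambda>j. c j *\<^sub>C x j", OF a']
    note sT = szego_form_sums[of J a "\<lambda>j. c j *\<^sub>C T (a j) (x j)", OF a']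
    show "summable (\<lambda>n. ?N J a c x n)"
      using sums_summable[OF sx] .
    have "(norm (\<Sum>j\<in>J. c j *\<^sub>C T (a j) (x j)))\<^sup>2 =
        (\<Sum>n<1. (norm (\<Sum>j\<in>J. (cnj (a j) ^ n) *\<^sub>C c j *\<^sub>C T (a j) (x j)))\<^sup>2)"
      by (simp add: scaleC_one)
    also have "\<dots> \<le> (\<Sum>n. (norm (\<Sum>j\<in>J. (cnj (a j) ^ n) *\<^sub>C c j *\<^sub>C T (a j) (x j)))\<^sup>2)"
      by (intro sum_le_suminf sums_summable[OF sT]) auto
    also have "\<dots> \<le> (\<Sum>n. ?N J a c x n)"
      using le sums_unique[OF sT] sums_unique[OF sx] by simp
    finally show "(norm (\<Sum>j\<in>J. c j *\<^sub>C T (a j) (x j)))\<^sup>2 \<le>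
      (\<Sum>n. ?N J a c x n)" .
  qed
  \<comment> \<open>At a single point \<open>a\<close>, all terms of the series are multiples of one
    and the same combination, so a linear relation between the arguments carries over to the
    values.\<close>
  have lin: "(\<Sum>j\<in>J. c j *\<^sub>C T a (x j)) = 0"
    if "finite J" "a \<in> ball 0 1" "(\<Sum>j\<in>J. c j *\<^sub>C x j) = 0" for J :: "nat set" and a c x
  proof -
    have "(\<Sum>j\<in>J. (cnj a ^ n) *\<^sub>C c j *\<^sub>C x j) = 0" for n
      using cinner.scale_sum_right[of "cnj a ^ n" "\<lambda>j. c j *\<^sub>C x j" J] that(3) by simp
    then show ?thesis
      using key(1)[OF that(1), of "\<lambda>_. a" c x] that(2) by simp
  qed
  have T_add: "T a (x + y) = T a x + T a y" if "a \<in> ball 0 1" for a x y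
  proof -
    have "T a x + (T a y - T a (x + y)) = 0"
      using lin[of "{0, 1, 2}" a "\<lambda>j. if j = 2 then - 1 else 1" "\<lambda>j. if j = 0 then x else if j = 1 then y else x + y"] that
      by (simp add: scaleC_one)
    then show ?thesis by (simp add: add_diff_eq)
  qed
  have T_scale: "T a (b *\<^sub>C x) = b *\<^sub>C T a x" if "a \<in> ball 0 1" for a b x
  proof -
    have "b *\<^sub>C T a x - T a (b *\<^sub>C x) = 0"
      using lin[of "{0, 1}" a "\<lambda>j. if j = 0 then b else - 1" "\<lambda>j. if j = 0 then x else b *\<^sub>C x"] that
      by (simp add: scaleC_one)
    then show ?thesis by simp
  qed
  have T_norm: "norm (T a x) \<le> 1 * norm x" if "a \<in> ball 0 1" for a x
  proof -
    have "0 \<le> Re ((cinner x x - cinner (T a x) (T a x)) * k (a, x) (a, x))"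
      using kernel_on_diag[OF \<Phi>, of "(a, x)"] that by (simp add: I_def T_def)
    also have "\<dots> = ((norm x)\<^sup>2 - (norm (T a x))\<^sup>2) * (1 / (1 - (cmod a)\<^sup>2))"
      unfolding k_diag cinner_self by (simp flip: of_real_diff of_real_power)
    finally have "(norm (T a x))\<^sup>2 \<le> (norm x)\<^sup>2"
      using pos_diag[OF that] by (simp add: zero_le_divide_iff)
    then show ?thesis by (simp add: power2_le_iff_abs_le)
  qed
  have "\<exists>P. P \<in> bounded_ops \<and> (\<forall>x e. cinner (T a x) e = cinner x (blinfun_apply P e)) \<and> norm P \<le> 1"
    if a: "a \<in> ball 0 1" for a
    by (rule adjoint_exists[of "T a" 1, OF T_add[OF a] T_scale[OF a] T_norm[OF a]]) auto
  then obtain \<Psi> where \<Psi>: "\<And>a. a \<in> ball 0 1 \<Longrightarrow> \<Psi> a \<in> bounded_ops"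
    "\<And>a x e. a \<in> ball 0 1 \<Longrightarrow> cinner (T a x) e = cinner x ((\<Psi> a) e)"
    "\<And>a. a \<in> ball 0 1 \<Longrightarrow> norm (\<Psi> a) \<le> 1"
    by metis
  have \<Psi>': "cinner ((\<Psi> a) e) x = cinner e (T a x)" if "a \<in> ball 0 1" for a x e
    using \<Psi>(2)[OF that, of x e] cinner_commute[of e "T a x"] cinner_commute[of "(\<Psi> a) e" x]
    by simp
  have "vector_holomorphic_on \<Psi> (ball 0 1)"
    unfolding vector_holomorphic_on_def
  proof
    fix w :: complex assume "w \<in> ball 0 1"
    then obtain r where r: "cmod w < r" "r < 1" using dense by (metis mem_ball_0)
    then have r0: "0 < r" using norm_ge_zero[of w] by linarith
    define M where "M = (\<Sum>n. real n ^ 4 * (r\<^sup>2) ^ n)"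
    have M: "summable (\<lambda>n. real n ^ 4 * (r\<^sup>2) ^ n)"
      using r r0 by (intro summable_fourth_power) (auto simp: abs_square_less_1)
    have M0: "0 \<le> M" unfolding M_def by (intro suminf_nonneg M) auto
    have "\<exists>D. (\<Psi> has_derivative (\<lambda>h. h *\<^sub>C D)) (at w)"
    \<comment> \<open>Operators into a Banach space form a Banach space, as the limit of difference
      quotients requires. The constant comes from the bound in
      \<open>norm_second_difference_le\<close>, squared and summed over \<open>n\<close>.\<close>
    proof (rule vector_derivative_exists[OF r(1), where C = "sqrt M / r\<^sup>2"])
      fix a b assume ab: "cmod a < r" "cmod b < r" "a \<noteq> w" "b \<noteq> w"
      have disc: "a \<in> ball 0 1" "b \<in> ball 0 1" "w \<in> ball 0 1" using ab r by auto
      \<comment> \<open>The coefficients at the points \<open>a\<close>, \<open>b\<close> and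
        \<open>w\<close> of the difference of the two quotients of \<open>\<Psi>\<close>. The values
        of \<open>T\<close> take their conjugates, since \<open>T\<close> is the adjoint.\<close>
      define \<alpha> where "\<alpha> j = (if j = 0 then 1 / (a - w) else if j = 1 then - 1 / (b - w)
        else 1 / (b - w) - 1 / (a - w))" for j :: nat
      define p where "p j = (if j = 0 then a else if j = 1 then b else w)" for j :: nat
      let ?J = "{0, 1, 2 :: nat}"
      have p: "p j \<in> ball 0 1" for j using disc by (simp add: p_def)
      let ?C = "sqrt M / r\<^sup>2 * cmod (a - b)"
      have T_bound: "(norm (\<Sum>j\<in>?J. cnj (\<alpha> j) *\<^sub>C T (p j) x))\<^sup>2 \<le>
          (?C * norm x)\<^sup>2" for x
      proof -
        let ?d = "\<lambda>n. (a ^ n - w ^ n) / (a - w) - (b ^ n - w ^ n) / (b - w)"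
        let ?s = "\<lambda>n. \<Sum>j\<in>?J. (cnj (p j) ^ n) *\<^sub>C cnj (\<alpha> j) *\<^sub>C x"
        have "norm (?s n) \<le>
            cmod (a - b) / r\<^sup>2 * norm x * ((real n)\<^sup>2 * r ^ n)" for n
        proof -
          have "?s n = cnj (\<Sum>j\<in>?J. p j ^ n * \<alpha> j) *\<^sub>C x"
            by (simp add: scaleC_add_left scaleC_scaleC)
          also have "(\<Sum>j\<in>?J. p j ^ n * \<alpha> j) = ?d n"
            by (simp add: p_def \<alpha>_def diff_divide_distrib right_diff_distrib)
          finally have eq: "norm (?s n) =
              cmod (?d n) * norm x"
            by (simp only: norm_scaleC complex_mod_cnj)
          have "r\<^sup>2 * cmod (?d n) \<le> cmod (a - b) * ((real n)\<^sup>2 * r ^ n)"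
            using ab r by (intro norm_second_difference_le) auto
          then have "cmod (?d n) \<le> cmod (a - b) * ((real n)\<^sup>2 * r ^ n) / r\<^sup>2"
            using r0 by (subst pos_le_divide_eq) (auto simp: mult.commute)
          then have "cmod (?d n) * norm x \<le>
              cmod (a - b) * ((real n)\<^sup>2 * r ^ n) / r\<^sup>2 * norm x"
            by (rule mult_right_mono) simp
          then show ?thesis unfolding eq by (simp add: mult_ac)
        qed
        then have "(norm (?s n))\<^sup>2 \<le>
            (cmod (a - b) / r\<^sup>2 * norm x * ((real n)\<^sup>2 * r ^ n))\<^sup>2" for n
          by (rule power_mono) simp
        also have "(cmod (a - b) / r\<^sup>2 * norm x * ((real n)\<^sup>2 * r ^ n))\<^sup>2 =
            (cmod (a - b) / r\<^sup>2 * norm x)\<^sup>2 * (real n ^ 4 * (r\<^sup>2) ^ n)" for n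
          by (simp add: power_mult_distrib power2_eq_square power4_eq_xxxx mult_ac)
        finally have bnd: "(norm (?s n))\<^sup>2 \<le>
            (cmod (a - b) / r\<^sup>2 * norm x)\<^sup>2 * (real n ^ 4 * (r\<^sup>2) ^ n)" for n .
        have "(norm (\<Sum>j\<in>?J. cnj (\<alpha> j) *\<^sub>C T (p j) x))\<^sup>2 \<le>
            (\<Sum>n. (norm (?s n))\<^sup>2)"
          using p by (intro key(1)) auto
        also have "\<dots> \<le> (\<Sum>n. (cmod (a - b) / r\<^sup>2 * norm x)\<^sup>2 * (real n ^ 4 * (r\<^sup>2) ^ n))"
          using p by (intro suminf_le bnd summable_mult M key(2)) auto
        also have "\<dots> = (cmod (a - b) / r\<^sup>2 * norm x)\<^sup>2 * M"
          unfolding M_def by (rule suminf_mult[OF M])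
        also have "\<dots> = (?C * norm x)\<^sup>2"
          using M0 by (simp add: power_mult_distrib power_divide)
        finally show ?thesis .
      qed
      have nn: "0 \<le> ?C" using M0 by simp
      have T_bound': "norm (\<Sum>j\<in>?J. cnj (\<alpha> j) *\<^sub>C T (p j) x) \<le> ?C * norm x" for x
        by (rule power2_le_imp_le[OF T_bound mult_nonneg_nonneg[OF nn norm_ge_zero]])
      let ?D = "(1 / (a - w)) *\<^sub>C (\<Psi> a - \<Psi> w) - (1 / (b - w)) *\<^sub>C (\<Psi> b - \<Psi> w)"
      have D: "cinner (?D e) x = cinner e (\<Sum>j\<in>?J. cnj (\<alpha> j) *\<^sub>C T (p j) x)" for e x
      proof -
        have "cinner (?D e) x =
            1 / (a - w) * (cinner e (T a x) - cinner e (T w x)) - 1 / (b - w) * (cinner e (T b x) - cinner e (T w x))"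
          using \<Psi>' disc by (simp add: blinfun.diff_left cinner.ip_diff_left cinner_scaleC_left)
        also have "\<dots> = (\<Sum>j\<in>?J. \<alpha> j * cinner e (T (p j) x))"
          by (simp add: \<alpha>_def p_def algebra_simps diff_divide_distrib)
        also have "\<dots> = cinner e (\<Sum>j\<in>?J. cnj (\<alpha> j) *\<^sub>C T (p j) x)"
          by (subst cinner.ip_sum_right) (simp_all only: cinner.ip_scale_right UNIV_I complex_cnj_cnj)
        finally show ?thesis .
      qed
      show "norm ?D \<le> ?C"
      proof (rule norm_blinfun_bound[OF nn])
        fix e
        let ?x = "?D e"
        \<comment> \<open>Testing \<open>?D e\<close> against itself moves the estimate to the
          combination of values of \<open>T\<close>.\<close>
        have "(norm ?x)\<^sup>2 = cmod (cinner ?x ?x)" by (simp only: cinner_self norm_of_real abs_power2)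
        also have "\<dots> \<le> norm e * norm (\<Sum>j\<in>?J. cnj (\<alpha> j) *\<^sub>C T (p j) ?x)"
          unfolding D by (rule norm_cinner_le)
        also have "\<dots> \<le> norm e * (?C * norm ?x)"
          by (intro mult_left_mono T_bound') simp
        finally have "norm ?x * norm ?x \<le> (?C * norm e) * norm ?x"
          by (simp only: power2_eq_square mult_ac)
        then show "norm ?x \<le> ?C * norm e"
          using mult_nonneg_nonneg[OF nn norm_ge_zero[of e]] norm_ge_zero[of ?x]
          by (metis less_le mult_le_cancel_right_pos)
      qed
    qed
    then show "\<exists>D. (\<Psi> has_derivative (\<lambda>h. h *\<^sub>C D)) (at w within ball 0 1)"
      using has_derivative_at_withinI by blast
  qed
  then have "\<Psi> \<in> Hinf_ball" using \<Psi> by (simp add: Hinf_ball_def)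
  moreover have "cinner ((\<Psi> (z j)) e) (u j) = cinner e (v j)" if "j \<in> S" for j e
  proof -
    have "T (z j) (u j) = v j" unfolding T_def by (rule ext) (use that in \<open>auto simp: R_def\<close>)
    then show ?thesis using \<Psi>'[of "z j" e "u j"] z[OF that] by simp
  qed
  ultimately show ?thesis using that by blast
qed

section \<open>Characterization of the CNP property\<close>

theorem theorem1p3:
  fixes \<Omega> :: "'x set" and K :: "'x \<Rightarrow> 'x \<Rightarrow> complex" and w :: 'x
    and f :: "'x \<Rightarrow> ('e :: chilbert_space \<Rightarrow>\<^sub>L complex)"
    and g :: "'x \<Rightarrow> ('f :: chilbert_space \<Rightarrow>\<^sub>L complex)"
    and \<phi> :: "'x \<Rightarrow> complex"
  assumes "\<Omega> \<noteq> {}"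
    and "kernel_on \<Omega> K"
    and "\<forall>x\<in>\<Omega>. \<forall>y\<in>\<Omega>. K x y \<noteq> 0"
    and "w \<in> \<Omega>" and "\<forall>x\<in>\<Omega>. K x w = 1"
    and "\<forall>x\<in>\<Omega>. f x \<in> bounded_ops" and "\<forall>x\<in>\<Omega>. g x \<in> bounded_ops"
    and "\<exists>x\<in>\<Omega>. g x \<noteq> 0"
    and "\<forall>x\<in>\<Omega>. \<forall>y\<in>\<Omega>. 1 - 1 / K x y =
      scalar_of_op (g x o\<^sub>L adjoint_op (g y)) - scalar_of_op (f x o\<^sub>L adjoint_op (f y))"
    and "\<forall>x\<in>\<Omega>. \<phi> x \<in> ball 0 1"
    and "\<exists>x\<in>\<Omega>. \<exists>y\<in>\<Omega>. \<phi> x \<noteq> \<phi> y"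
    and "\<phi> \<in> contractive_multipliers \<Omega> K"
    and "\<phi> w = 0"
  shows "cnp_kernel \<Omega> (dbr_kernel K \<phi>) \<longleftrightarrow>
    (\<exists>\<Psi> :: complex \<Rightarrow> (('e \<times> complex) \<Rightarrow>\<^sub>L 'f).
      \<Psi> \<in> Hinf_ball \<and>
      (\<exists>\<psi>\<^sub>1 \<psi>\<^sub>2. (\<forall>z\<in>ball 0 1. \<psi>\<^sub>1 z \<in> bounded_ops \<and> \<psi>\<^sub>2 z \<in> bounded_ops \<and>
          \<Psi> z = row_op (\<psi>\<^sub>1 z) (\<psi>\<^sub>2 z)) \<and>
        (\<forall>x\<in>\<Omega>. f x = g x o\<^sub>L \<psi>\<^sub>1 (\<phi> x) \<and> \<phi> x = scalar_of_op (g x o\<^sub>L \<psi>\<^sub>2 (\<phi> x)))))"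
    (is "_ \<longleftrightarrow> ?R")
proof -
  define L where "L = dbr_kernel K \<phi>"
  have \<phi>: "cmod (\<phi> x) < 1" if "x \<in> \<Omega>" for x using assms(10) that by simp
  have den: "1 - \<phi> x * cnj (\<phi> y) \<noteq> 0" if "x \<in> \<Omega>" "y \<in> \<Omega>" for x y
    using disc_szego_nonzero \<phi> that by simp
  have L: "kernel_on \<Omega> L"
    unfolding L_def by (rule contractive_multiplier_kernel[OF assms(2,12)])
  have L_nz: "L x y \<noteq> 0" if "x \<in> \<Omega>" "y \<in> \<Omega>" for x y
    using assms(3) den that by (simp add: L_def dbr_kernel_def)
  \<comment> \<open>\<open>\<phi> w = 0\<close> keeps \<open>L\<close> normalized at
    \<open>w\<close>, as \<open>complement_if_cnp_kernel\<close> requires.\<close>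
  have L_w: "L x w = 1" if "x \<in> \<Omega>" for x
    using assms(5,13) that by (simp add: L_def dbr_kernel_def)
  have cnp: "cnp_kernel \<Omega> L \<longleftrightarrow> kernel_on \<Omega> (\<lambda>x y. 1 - 1 / L x y)"
    using cnp_kernel_if_complement[OF L L_nz] complement_if_cnp_kernel[of \<Omega> L w, OF _ L_nz assms(4) L_w] by blast
  define \<gamma> where "\<gamma> x = blinfun_apply (adjoint_op (g x)) 1" for x
  define \<eta> where "\<eta> x = blinfun_apply (adjoint_op (f x)) 1" for x
  \<comment> \<open>The Riesz vector of the functional that sends \<open>(e, a)\<close> to
    \<open>(f x) e + a * \<phi> x\<close>; hence the conjugate. With \<open>\<gamma> x\<close> as
    the Riesz vector of \<open>g x\<close>, both factorizations together say that the adjoint of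
    \<open>\<Psi> (\<phi> x)\<close> sends \<open>\<gamma> x\<close> to \<open>v x\<close>.\<close>
  define v where "v x = (\<eta> x, cnj (\<phi> x))" for x
  have g: "(g x) u = cinner u (\<gamma> x)" if "x \<in> \<Omega>" for x u
    unfolding \<gamma>_def using assms(7) that by (intro functional_adjoint) auto
  have f: "(f x) u = cinner u (\<eta> x)" if "x \<in> \<Omega>" for x u
    unfolding \<eta>_def using assms(6) that by (intro functional_adjoint) auto
  have F: "1 - 1 / L x y = (cinner (\<gamma> y) (\<gamma> x) - cinner (v y) (v x)) / (1 - \<phi> x * cnj (\<phi> y))"
    if "x \<in> \<Omega>" "y \<in> \<Omega>" for x y
  proof -
    have "1 - 1 / K x y = cinner (\<gamma> y) (\<gamma> x) - cinner (\<eta> y) (\<eta> x)"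
      using assms(9) that g[of x "\<gamma> y"] f[of x "\<eta> y"] by (simp add: scalar_of_op_def \<gamma>_def \<eta>_def)
    moreover have "1 - 1 / L x y = ((1 - 1 / K x y) - \<phi> x * cnj (\<phi> y)) / (1 - \<phi> x * cnj (\<phi> y))"
      using den[OF that] assms(3) that by (simp add: L_def dbr_kernel_def field_simps)
    ultimately show ?thesis
      by (simp add: v_def cinner_prod_def cinner_complex_def diff_diff_eq mult.commute)
  qed
  let ?M = "\<lambda>x y. (cinner (\<gamma> y) (\<gamma> x) - cinner (v y) (v x)) / (1 - \<phi> x * cnj (\<phi> y))"
  have "kernel_on \<Omega> (\<lambda>x y. 1 - 1 / L x y) \<longleftrightarrow>
      kernel_on \<Omega> ?M"
    using F by (rule kernel_on_cong)
  also have "\<dots> \<longleftrightarrow> ?R"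
  proof
    assume "kernel_on \<Omega> ?M"
    then obtain \<Psi> :: "complex \<Rightarrow> (('e \<times> complex) \<Rightarrow>\<^sub>L 'f)" where \<Psi>: "\<Psi> \<in> Hinf_ball"
      and ext: "\<And>x p. x \<in> \<Omega> \<Longrightarrow> cinner ((\<Psi> (\<phi> x)) p) (\<gamma> x) = cinner p (v x)"
      using schur_interpolation[of \<Omega> \<phi> \<gamma> v] \<phi> by blast
    \<comment> \<open>Composition with the two embeddings recovers the blocks of the row
      \<open>\<Psi> z\<close>.\<close>
    define inl :: "'e \<Rightarrow>\<^sub>L ('e \<times> complex)" where "inl = Blinfun (\<lambda>e. (e, 0))"
    define inr :: "complex \<Rightarrow>\<^sub>L ('e \<times> complex)" where "inr = Blinfun (\<lambda>a. (0, a))"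
    have inl: "inl e = (e, 0)" for e
      unfolding inl_def
      by (simp add: bounded_linear_Blinfun_apply bounded_linear_Pair bounded_linear_ident bounded_linear_zero)
    have inr: "inr a = (0, a)" for a
      unfolding inr_def
      by (simp add: bounded_linear_Blinfun_apply bounded_linear_Pair bounded_linear_ident bounded_linear_zero)
    have 1: "\<Psi> z o\<^sub>L inl \<in> bounded_ops \<and> \<Psi> z o\<^sub>L inr \<in> bounded_ops \<and>
        \<Psi> z = row_op (\<Psi> z o\<^sub>L inl) (\<Psi> z o\<^sub>L inr)" if "z \<in> ball 0 1" for z
    proof (intro conjI)
      have hom: "(\<Psi> z) (a *\<^sub>C p) = a *\<^sub>C (\<Psi> z) p" for a p
        using \<Psi> that unfolding Hinf_ball_def bounded_ops_def by blast
      have "a *\<^sub>C inl e = inl (a *\<^sub>C e)" for a e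
        by (simp add: inl scaleC_prod_def scaleC_complex_def)
      then show "\<Psi> z o\<^sub>L inl \<in> bounded_ops"
        by (simp add: bounded_ops_def flip: hom)
      have "a *\<^sub>C inr b = inr (a *\<^sub>C b)" for a b
        by (simp add: inr scaleC_prod_def)
      then show "\<Psi> z o\<^sub>L inr \<in> bounded_ops"
        by (simp add: bounded_ops_def flip: hom)
      show "\<Psi> z = row_op (\<Psi> z o\<^sub>L inl) (\<Psi> z o\<^sub>L inr)"
        by (rule blinfun_eqI) (auto simp: row_op_def blinfun.add_left inl inr simp flip: blinfun.add_right)
    qed
    have 2: "f x = g x o\<^sub>L (\<Psi> (\<phi> x) o\<^sub>L inl) \<and> \<phi> x = scalar_of_op (g x o\<^sub>L (\<Psi> (\<phi> x) o\<^sub>L inr))"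
      if x: "x \<in> \<Omega>" for x
    proof
      show "f x = g x o\<^sub>L (\<Psi> (\<phi> x) o\<^sub>L inl)"
        by (rule blinfun_eqI) (simp add: f[OF x] g[OF x] ext[OF x] inl v_def cinner_prod_def cinner_complex_def)
      show "\<phi> x = scalar_of_op (g x o\<^sub>L (\<Psi> (\<phi> x) o\<^sub>L inr))"
        by (simp add: scalar_of_op_def g[OF x] ext[OF x] inr v_def cinner_prod_def cinner_complex_def
            cinner.ip_zero_left)
    qed
    show ?R
      by (intro exI[of _ \<Psi>] conjI \<Psi> exI[of _ "\<lambda>z. \<Psi> z o\<^sub>L inl"] exI[of _ "\<lambda>z. \<Psi> z o\<^sub>L inr"] ballI 1 2)
  next
    assume ?R
    then obtain \<Psi> :: "complex \<Rightarrow> (('e \<times> complex) \<Rightarrow>\<^sub>L 'f)" and \<psi>\<^sub>1 \<psi>\<^sub>2 where \<Psi>: "\<Psi> \<in> Hinf_ball"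
      and \<psi>: "\<And>z. z \<in> ball 0 1 \<Longrightarrow> \<psi>\<^sub>1 z \<in> bounded_ops \<and> \<psi>\<^sub>2 z \<in> bounded_ops \<and> \<Psi> z = row_op (\<psi>\<^sub>1 z) (\<psi>\<^sub>2 z)"
      and eq: "\<And>x. x \<in> \<Omega> \<Longrightarrow> f x = g x o\<^sub>L \<psi>\<^sub>1 (\<phi> x) \<and> \<phi> x = scalar_of_op (g x o\<^sub>L \<psi>\<^sub>2 (\<phi> x))"
      by blast
    show "kernel_on \<Omega> ?M"
    proof (rule schur_kernel[OF \<Psi> \<phi>])
      fix x and p :: "'e \<times> complex" assume x: "x \<in> \<Omega>"
      obtain e a where p: "p = (e, a)" by (cases p)
      have disc: "\<phi> x \<in> ball 0 1" using \<phi>[OF x] by simp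
      \<comment> \<open>An operator on the scalars is determined by its value at 1, the only one
        that \<open>scalar_of_op\<close> records.\<close>
      have "(\<psi>\<^sub>2 (\<phi> x)) (a *\<^sub>C 1) = a *\<^sub>C (\<psi>\<^sub>2 (\<phi> x)) 1"
        using \<psi>[OF disc] unfolding bounded_ops_def by blast
      then have \<psi>\<^sub>2: "(\<psi>\<^sub>2 (\<phi> x)) a = a *\<^sub>C (\<psi>\<^sub>2 (\<phi> x)) 1"
        by (simp add: scaleC_complex_def)
      have "cinner ((\<Psi> (\<phi> x)) p) (\<gamma> x) =
          (g x) ((\<psi>\<^sub>1 (\<phi> x)) e + (\<psi>\<^sub>2 (\<phi> x)) a)"
        using \<psi>[OF disc] by (simp add: g[OF x] p row_op_def blinfun.add_left)
      also have "\<dots> = (g x) ((\<psi>\<^sub>1 (\<phi> x)) e) +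
          a * (g x) ((\<psi>\<^sub>2 (\<phi> x)) 1)"
        unfolding \<psi>\<^sub>2 by (simp add: g[OF x] cinner_add_left cinner_scaleC_left)
      also have "\<dots> = (f x) e + a * \<phi> x"
        using eq[OF x] by (simp add: scalar_of_op_def)
      also have "\<dots> = cinner p (v x)"
        by (simp add: f[OF x] p v_def cinner_prod_def cinner_complex_def)
      finally show "cinner ((\<Psi> (\<phi> x)) p) (\<gamma> x) = cinner p (v x)" .
    qed
  qed
  finally show ?thesis using cnp unfolding L_def by blast
qed

end
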